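(* For arbitrarily large $n$ there is a polytope $Q$ with $n$ vertices whose surface can be cut open along $2^{\Omega(n)}$ combinatorially distinct cut trees, each unfolding to a simple polygon, and these unfoldings include $2^{\Omega(n)}$ geometrically distinct (pairwise noncongruent) simple polygons.
   Context: A polytope is a convex polyhedron. A geometric cut tree $\mathcal{T}_C$ for $Q$ is a tree drawn on $\partial Q$, each arc a polygonal path, such that cutting $\partial Q$ along $\mathcal{T}_C$ and flattening $\partial Q\setminus\mathcal{T}_C$ into the plane yields a simple (nonoverlapping) polygon. The combinatorial cut tree $T_C$ of $\mathcal{T}_C$ is the labeled graph with a node for each point of $\mathcal{T}_C$ of degree not equal to 2 and a node for each point of $\mathcal{T}_C$ at a vertex of $Q$ (labeled by that vertex); arcs are the polygonal paths of $\mathcal{T}_C$ connecting these nodes. Cut trees are combinatorially distinct when their combinatorial cut trees differ as labeled trees. *)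

theory Defs
  imports "HOL-Analysis.Analysis"
begin

fun polypath :: "'a::real_normed_vector list \<Rightarrow> real \<Rightarrow> 'a" where
  "polypath [] = linepath 0 0"
| "polypath [p] = linepath p p"
| "polypath [p, q] = linepath p q"
| "polypath (p # q # r # rest) = linepath p q +++ polypath (q # r # rest)"

definition polygonal_arc :: "(real \<Rightarrow> 'a::real_normed_vector) \<Rightarrow> bool" where
  "polygonal_arc g \<longleftrightarrow> (\<exists>ps. length ps \<ge> 2 \<and> g = polypath ps \<and> arc g)"

definition simple_polygon :: "(real^2) set \<Rightarrow> bool" where
  "simple_polygon P \<longleftrightarrow> (\<exists>ps. length ps \<ge> 2 \<and> hd ps = last ps \<and> simple_path (polypath ps) \<and>
      P = path_image (polypath ps) \<union> inside (path_image (polypath ps)))"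

definition convex_polytope3 :: "(real^3) set \<Rightarrow> bool" where
  "convex_polytope3 Q \<longleftrightarrow> polytope Q \<and> aff_dim Q = 3"

definition poly_vertices :: "(real^3) set \<Rightarrow> (real^3) set" where
  "poly_vertices Q = {v. v extreme_point_of Q}"

text \<open>Cutting the surface of Q along T and flattening the rest into the plane yields
  the simple polygon P: there is a continuous injective map of the surface minus T onto
  the interior of P that places each connected piece of each face rigidly.\<close>
definition unfolds_to :: "(real^3) set \<Rightarrow> (real^3) set \<Rightarrow> (real^2) set \<Rightarrow> bool" where
  "unfolds_to Q T P \<longleftrightarrow> simple_polygon P \<and>
     (\<exists>\<phi> :: real^3 \<Rightarrow> real^2.
        continuous_on (frontier Q - T) \<phi> \<and> inj_on \<phi> (frontier Q - T) \<and>
        \<phi> ` (frontier Q - T) = interior P \<and>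
        (\<forall>F. F facet_of Q \<longrightarrow> (\<forall>C \<in> components (F - T). \<forall>x\<in>C. \<forall>y\<in>C.
              dist (\<phi> x) (\<phi> y) = dist x y)))"

definition geometric_cut_tree :: "(real^3) set \<Rightarrow> (real^3) set \<Rightarrow> bool" where
  "geometric_cut_tree Q T \<longleftrightarrow> T \<subseteq> frontier Q \<and>
     (\<exists>A. finite A \<and> A \<noteq> {} \<and> (\<forall>g\<in>A. polygonal_arc g) \<and> T = \<Union> (path_image ` A)) \<and>
     connected T \<and> simply_connected T \<and>
     (\<exists>P. unfolds_to Q T P)"

definition point_degree :: "(real^3) set \<Rightarrow> real^3 \<Rightarrow> nat \<Rightarrow> bool" where
  "point_degree T x k \<longleftrightarrow>
     (\<exists>r>0. \<forall>s. 0 < s \<and> s < r \<longrightarrow> card (components (T \<inter> ball x s - {x})) = k)"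

definition ct_nodes :: "(real^3) set \<Rightarrow> (real^3) set \<Rightarrow> (real^3) set" where
  "ct_nodes Q T = {x \<in> T. \<not> point_degree T x 2} \<union> (poly_vertices Q \<inter> T)"

definition ct_arc :: "(real^3) set \<Rightarrow> (real^3) set \<Rightarrow> real^3 \<Rightarrow> real^3 \<Rightarrow> bool" where
  "ct_arc Q T a b \<longleftrightarrow> a \<noteq> b \<and> a \<in> ct_nodes Q T \<and> b \<in> ct_nodes Q T \<and>
     (\<exists>g. arc g \<and> path_image g \<subseteq> T \<and> pathstart g = a \<and> pathfinish g = b \<and>
          path_image g \<inter> ct_nodes Q T = {a, b})"

text \<open>Isomorphism of combinatorial cut trees as labeled trees (nodes at vertices of Q
  are labeled by that vertex, other nodes are unlabeled).\<close>
definition comb_isomorphic :: "(real^3) set \<Rightarrow> (real^3) set \<Rightarrow> (real^3) set \<Rightarrow> bool" where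
  "comb_isomorphic Q T1 T2 \<longleftrightarrow> (\<exists>f. bij_betw f (ct_nodes Q T1) (ct_nodes Q T2) \<and>
     (\<forall>a\<in>ct_nodes Q T1. \<forall>b\<in>ct_nodes Q T1. ct_arc Q T1 a b \<longleftrightarrow> ct_arc Q T2 (f a) (f b)) \<and>
     (\<forall>x\<in>ct_nodes Q T1. (x \<in> poly_vertices Q \<longleftrightarrow> f x \<in> poly_vertices Q) \<and>
                         (x \<in> poly_vertices Q \<longrightarrow> f x = x)))"

definition congruent :: "(real^2) set \<Rightarrow> (real^2) set \<Rightarrow> bool" where
  "congruent P1 P2 \<longleftrightarrow> (\<exists>f :: real^2 \<Rightarrow> real^2. (\<forall>x y. dist (f x) (f y) = dist x y) \<and> f ` P1 = P2)"

end

theory Submission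
  imports Defs
begin

text \<open>
  The polytope is a tall prism over a regular \<open>k\<close>-gon, \<open>k = 2 * m + 1\<close>. Each base is cut along the same tree: a star
  with an interior point \<open>ctr\<close> as centre and the corners as leaves, except that for every set bit \<open>j\<close> of a number
  \<open>c < 2 ^ m\<close> the branch to corner \<open>2 * j + 1\<close> starts a bit away from \<open>ctr\<close>, on the branch to corner \<open>2 * j\<close>.
  One vertical edge joins the two trees. The lateral faces then unroll to a strip of rectangles, and the pieces of the
  bases are flipped outwards along their sides. Every piece projects orthogonally into its own side, so nothing
  overlaps: the unfolding is the region between the graph of a piecewise linear function and its mirror image.

  Bit \<open>j\<close> is visible in the labelled tree, because the corners \<open>2 * j + 1\<close> and \<open>2 * m\<close> have a common neighbour
  (namely \<open>ctr\<close>) if and only if the bit is 0. The point \<open>ctr\<close> also depends on \<open>c\<close>: its distance from the last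
  side grows with \<open>c\<close>, and if the prism is tall enough, this distance determines the diameter of the unfolding.
\<close>

section \<open>Topological preliminaries\<close>

text \<open>Nonoverlap and noncongruence must hold for all \<open>2 ^ m\<close> trees at once, and
  the construction is shaped by both. Nonoverlap: sides have length 2 and \<open>ctr\<close> stays
  within 1/8 of the centre, so the chain bounding a piece opposite to its side has its intermediate
  vertices strictly above that side. The chain is even concave, so membership in a piece is a
  conjunction of linear inequalities. Noncongruence: instead of comparing nets under all motions,
  one real invariant is planted, the diameter. The last side joins corners \<open>2 * m\<close> and
  0, whose branches are never shifted, so its piece is a full triangle with apex \<open>ctr\<close>;
  moving \<open>ctr\<close> straight away from that side makes this apex strictly the highest point
  of the net. Odd \<open>k\<close> leaves corner \<open>2 * m\<close> outside the pairs
  \<open>2 * j\<close>, \<open>2 * j + 1\<close> that carry the bits, so it is a fixed reference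
  against which every shiftable branch can be tested.\<close>

lemma connected_subset_one_of_closed_cover:
  fixes F :: "'i \<Rightarrow> 'a::topological_space set"
  assumes "finite I" "connected C" "C \<noteq> {}" "C \<subseteq> \<Union>(F ` I)"
    and closed: "\<And>i. i \<in> I \<Longrightarrow> closedin (top_of_set C) (C \<inter> F i)"
    and disjoint: "\<And>i j. i \<in> I \<Longrightarrow> j \<in> I \<Longrightarrow> i \<noteq> j \<Longrightarrow> C \<inter> F i \<inter> F j = {}"
  shows "\<exists>i\<in>I. C \<subseteq> F i"
proof -
  obtain x i where x: "x \<in> C" "i \<in> I" "x \<in> F i" using assms(3,4) by blast
  \<comment> \<open>Off \<open>F i\<close> the set \<open>C\<close> is a finite union of closed
    traces, so the trace of \<open>F i\<close> is clopen in the connected set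
    \<open>C\<close>.\<close>
  have "C - (C \<inter> F i) = \<Union>((\<lambda>j. C \<inter> F j) ` (I - {i}))"
  proof (intro equalityI subsetI)
    fix y assume y: "y \<in> C - (C \<inter> F i)"
    then obtain j where "j \<in> I" "y \<in> F j" using assms(4) by blast
    then show "y \<in> \<Union>((\<lambda>j. C \<inter> F j) ` (I - {i}))" using y by auto
  next
    fix y assume "y \<in> \<Union>((\<lambda>j. C \<inter> F j) ` (I - {i}))"
    then obtain j where "j \<in> I" "j \<noteq> i" "y \<in> C" "y \<in> F j" by auto
    then show "y \<in> C - (C \<inter> F i)" using disjoint[OF x(2) \<open>j \<in> I\<close>] by auto
  qed
  moreover have "closedin (top_of_set C) (\<Union>((\<lambda>j. C \<inter> F j) ` (I - {i})))"
    using closed assms(1) by (intro closedin_Union) auto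
  ultimately have "openin (top_of_set C) (C \<inter> F i)"
    using closed[OF x(2)] by (simp add: openin_closedin_eq)
  with closed[OF x(2)] have "C \<inter> F i = {} \<or> C \<inter> F i = C"
    using \<open>connected C\<close> connected_clopen by blast
  with x show ?thesis by blast
qed

text \<open>Each \<open>F i\<close> is maximal because a connected set containing it lies in a
  single member of the cover. This counts the germs of a star at its centre.\<close>

lemma components_finite_disjoint_Union:
  fixes F :: "'i \<Rightarrow> 'a::topological_space set"
  assumes fin: "finite I" and con: "\<And>i. i \<in> I \<Longrightarrow> connected (F i)" and ne: "\<And>i. i \<in> I \<Longrightarrow> F i \<noteq> {}"
    and closed: "\<And>i. i \<in> I \<Longrightarrow> closedin (top_of_set (\<Union>(F ` I))) (F i)"
    and disjoint: "\<And>i j. i \<in> I \<Longrightarrow> j \<in> I \<Longrightarrow> i \<noteq> j \<Longrightarrow> F i \<inter> F j = {}"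
  shows "components (\<Union>(F ` I)) = F ` I"
proof -
  let ?U = "\<Union>(F ` I)"
  have comp: "F i \<in> components ?U" if i: "i \<in> I" for i
    unfolding in_components_maximal
  proof (intro conjI allI impI)
    show "F i \<noteq> {}" "F i \<subseteq> ?U" "connected (F i)" using ne con i by auto
    fix D assume D: "D \<noteq> {} \<and> F i \<subseteq> D \<and> D \<subseteq> ?U \<and> connected D"
    have "\<exists>j\<in>I. D \<subseteq> F j"
    proof (rule connected_subset_one_of_closed_cover[OF fin])
      show "closedin (top_of_set D) (D \<inter> F j)" if "j \<in> I" for j
      proof -
        from closed[OF that] obtain K where K: "closed K" "F j = ?U \<inter> K"
          unfolding closedin_closed by blast
        then have "D \<inter> F j = D \<inter> K" using D by auto
        then show ?thesis using K(1) by (simp add: closedin_closed_Int)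
      qed
    qed (use D disjoint in auto)
    then obtain j where "j \<in> I" "D \<subseteq> F j" by blast
    then show "D = F i" using D disjoint[of i j] i ne[OF i] by (cases "i = j") auto
  qed
  show ?thesis
  proof (intro equalityI subsetI)
    fix D assume D: "D \<in> components ?U"
    obtain x where "x \<in> D" using in_components_nonempty[OF D] by blast
    moreover have "D \<subseteq> ?U" using D by (rule in_components_subset)
    ultimately obtain i where "i \<in> I" "x \<in> F i" by blast
    then show "D \<in> F ` I"
      using components_eq[OF D comp[of i]] \<open>x \<in> D\<close> by auto
  qed (use comp in auto)
qed

text \<open>The parametrisation by an open interval makes the germ of a segment at its punctured
  endpoint visibly connected and nonempty.\<close>

lemma segment_minus_endpoint_ball:
  fixes x c :: "'a::real_normed_vector"
  assumes "c \<noteq> x" "0 < s" "s \<le> dist x c"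
  shows "closed_segment x c \<inter> ball x s - {x} = (\<lambda>t. x + t *\<^sub>R (c - x)) ` {0<..<s / dist x c}"
proof -
  have d: "dist x c > 0" using assms by simp
  have dd: "dist x (x + t *\<^sub>R (c - x)) = \<bar>t\<bar> * dist x c" for t
    by (simp add: dist_norm norm_minus_commute)
  show ?thesis
  proof (intro equalityI subsetI)
    fix y assume y: "y \<in> closed_segment x c \<inter> ball x s - {x}"
    then obtain t where t: "0 \<le> t" "t \<le> 1" "y = (1 - t) *\<^sub>R x + t *\<^sub>R c" by (auto simp: in_segment)
    then have yt: "y = x + t *\<^sub>R (c - x)" by (simp add: algebra_simps)
    then have "\<bar>t\<bar> * dist x c < s" using y dd[of t] by simp
    moreover have "t \<noteq> 0" using y yt by auto
    ultimately show "y \<in> (\<lambda>t. x + t *\<^sub>R (c - x)) ` {0<..<s / dist x c}"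
      using t yt d by (auto simp: field_simps)
  next
    fix y assume "y \<in> (\<lambda>t. x + t *\<^sub>R (c - x)) ` {0<..<s / dist x c}"
    then obtain t where t: "0 < t" "t < s / dist x c" "y = x + t *\<^sub>R (c - x)" by auto
    have "t * dist x c < s" using t d by (simp add: field_simps)
    moreover have "t < 1" using t d assms by (smt (verit) divide_le_eq_1_pos)
    moreover have "y = (1 - t) *\<^sub>R x + t *\<^sub>R c" using t by (simp add: algebra_simps)
    ultimately show "y \<in> closed_segment x c \<inter> ball x s - {x}"
      using t assms dd[of t] by (auto simp: in_segment intro!: exI[of _ t])
  qed
qed

text \<open>A ball that misses \<open>R\<close> and reaches no far end of a segment meets
  \<open>T\<close> in the segments alone. Once \<open>x\<close> is removed, their traces are
  disjoint, connected and relatively closed, hence the components.\<close>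

lemma point_degree_star:
  fixes x :: "real^3"
  assumes fin: "finite C" and ne: "x \<notin> C"
    and disjoint: "\<And>c d. c \<in> C \<Longrightarrow> d \<in> C \<Longrightarrow> c \<noteq> d \<Longrightarrow> closed_segment x c \<inter> closed_segment x d = {x}"
    and R: "closed R" "x \<notin> R"
    and T: "T = (\<Union>c\<in>C. closed_segment x c) \<union> R"
  shows "point_degree T x (card C)"
proof -
  have "open (- R)" "x \<in> - R" using R by auto
  then obtain e where e: "e > 0" "ball x e \<subseteq> - R" using openE by blast
  define r where "r = Min (insert e (dist x ` C))"
  have r: "r > 0" "r \<le> e" "\<And>c. c \<in> C \<Longrightarrow> r \<le> dist x c"
    using fin ne e unfolding r_def by (auto simp: Min_gr_iff)
  have "card (components (T \<inter> ball x s - {x})) = card C" if s: "0 < s" "s < r" for s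
  proof -
    define F where "F c = closed_segment x c \<inter> ball x s - {x}" for c
    have F: "F c = (\<lambda>t. x + t *\<^sub>R (c - x)) ` {0<..<s / dist x c}" if "c \<in> C" for c
      unfolding F_def by (rule segment_minus_endpoint_ball) (use ne s r(3)[OF that] that in auto)
    have U: "T \<inter> ball x s - {x} = \<Union>(F ` C)"
    proof -
      have "ball x s \<inter> R = {}" using e s r subset_ball[of s e x] by auto
      then show ?thesis unfolding T F_def by auto
    qed
    have neF: "F c \<noteq> {}" if "c \<in> C" for c
    proof -
      have "dist x c > 0" using ne that by auto
      then have "0 < s / dist x c" using s by simp
      then show ?thesis unfolding F[OF that] by simp
    qed
    have disF: "F c \<inter> F d = {}" if "c \<in> C" "d \<in> C" "c \<noteq> d" for c d
      using disjoint[OF that] unfolding F_def by auto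
    have "components (\<Union>(F ` C)) = F ` C"
    proof (rule components_finite_disjoint_Union[OF fin _ neF _ disF])
      show "connected (F c)" if "c \<in> C" for c
        unfolding F[OF that] by (intro connected_continuous_image continuous_intros) auto
      show "closedin (top_of_set (\<Union>(F ` C))) (F c)" if "c \<in> C" for c
      proof -
        have "F c = \<Union>(F ` C) \<inter> closed_segment x c" using that unfolding F_def by auto
        then show ?thesis by (metis closed_segment closedin_closed_Int)
      qed
    qed
    moreover have "inj_on F C" using neF disF by (metis inj_onI inf.idem)
    ultimately show ?thesis unfolding U by (simp add: card_image)
  qed
  then show ?thesis unfolding point_degree_def using r(1) by blast
qed

lemma point_degree_unique:
  assumes "point_degree T x k" "point_degree T x l"
  shows "k = l"
proof -
  obtain r r' where "r > 0" "r' > 0"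
    and "\<And>s. 0 < s \<Longrightarrow> s < r \<Longrightarrow> card (components (T \<inter> ball x s - {x})) = k"
    and "\<And>s. 0 < s \<Longrightarrow> s < r' \<Longrightarrow> card (components (T \<inter> ball x s - {x})) = l"
    using assms unfolding point_degree_def by blast
  moreover have "0 < min r r' / 2" "min r r' / 2 < r" "min r r' / 2 < r'"
    using \<open>r > 0\<close> \<open>r' > 0\<close> by auto
  ultimately show ?thesis by metis
qed

text \<open>Absolute retracts express being a tree: gluing one on at a single point keeps the
  property, and it implies contractible, hence connected and simply connected. The added sets meet
  each other only inside \<open>S\<close>, so every stage is again glued at one point.\<close>

lemma AR_Un_finite_tree:
  fixes F :: "'i \<Rightarrow> 'a::euclidean_space set"
  assumes "finite I" "AR S" "closed S"
    and "\<And>i. i \<in> I \<Longrightarrow> AR (F i)" "\<And>i. i \<in> I \<Longrightarrow> closed (F i)"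
    and "\<And>i. i \<in> I \<Longrightarrow> \<exists>p. F i \<inter> S = {p}"
    and "\<And>i j. i \<in> I \<Longrightarrow> j \<in> I \<Longrightarrow> i \<noteq> j \<Longrightarrow> F i \<inter> F j \<subseteq> S"
  shows "AR (S \<union> \<Union>(F ` I)) \<and> closed (S \<union> \<Union>(F ` I))"
  using assms
proof (induction I rule: finite_induct)
  case (insert i I)
  have IH: "AR (S \<union> \<Union>(F ` I))" "closed (S \<union> \<Union>(F ` I))"
    using insert by auto
  obtain p where p: "F i \<inter> S = {p}" using insert.prems by blast
  have "F i \<inter> F j \<subseteq> {p}" if "j \<in> I" for j
    using insert.prems(6)[of i j] insert.hyps(2) p that by blast
  then have "F i \<inter> (S \<union> \<Union>(F ` I)) = {p}" using p by blast
  then have "AR (F i \<union> (S \<union> \<Union>(F ` I)))"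
    using AR_closed_Un[of "F i" "S \<union> \<Union>(F ` I)"] insert.prems(3,4)[of i] IH AR_singleton[of p] by simp
  moreover have "S \<union> \<Union>(F ` insert i I) = F i \<union> (S \<union> \<Union>(F ` I))" by auto
  moreover have "closed (F i \<union> (S \<union> \<Union>(F ` I)))" using insert.prems IH by auto
  ultimately show ?case by simp
qed simp

text \<open>The point \<open>p\<close> is the only passage between the two closed sets. This later
  forces an arc that leaves a branch to run through the start of that branch.\<close>

lemma connected_meets_gate:
  fixes S R :: "'a::topological_space set"
  assumes "connected C" "C \<subseteq> S \<union> R" "closed S" "closed R" "S \<inter> R \<subseteq> {p}" "C \<inter> S \<noteq> {}" "C \<inter> R \<noteq> {}"
  shows "p \<in> C"
proof (rule ccontr)
  assume "p \<notin> C"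
  then have "S \<inter> R \<inter> C = {}" using assms(5) by auto
  then show False using connected_closedD[OF assms(1) _ assms(2-4)] assms(6,7) by (simp add: Int_commute)
qed

text \<open>Points off \<open>S\<close> and \<open>U\<close> escape along unbounded connected sets,
  while a component of the complement of \<open>S\<close> that meets \<open>U\<close> cannot cross
  the frontier of \<open>U\<close>.\<close>

lemma inside_eq_region:
  fixes S U :: "'a::real_normed_vector set"
  assumes "bounded U" "U \<inter> S = {}" "frontier U \<subseteq> S"
    and out: "\<And>v. v \<notin> S \<union> U \<Longrightarrow> \<exists>C. connected C \<and> v \<in> C \<and> C \<inter> S = {} \<and> \<not> bounded C"
  shows "inside S = U"
proof (intro equalityI subsetI)
  fix v assume v: "v \<in> inside S"
  show "v \<in> U"
  proof (rule ccontr)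
    assume "v \<notin> U"
    moreover have "v \<notin> S" using v inside_no_overlap by blast
    ultimately obtain C where C: "connected C" "v \<in> C" "C \<inter> S = {}" "\<not> bounded C" using out by blast
    then have "C \<subseteq> connected_component_set (- S) v" by (simp add: connected_component_maximal disjoint_eq_subset_Compl)
    then show False using v C(4) bounded_subset unfolding inside_def by blast
  qed
next
  fix v assume v: "v \<in> U"
  let ?C = "connected_component_set (- S) v"
  have "v \<in> - S" using v assms by blast
  have "?C \<inter> S = {}" using connected_component_subset by fastforce
  then have "?C \<inter> frontier U = {}" using assms by blast
  moreover have "v \<in> ?C" using \<open>v \<in> - S\<close> by simp
  ultimately have "?C \<subseteq> U"
    using connected_Int_frontier[of ?C U] v by blast
  then show "v \<in> inside S" unfolding inside_def using assms(1) bounded_subset v \<open>v \<in> - S\<close> by blast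
qed

section \<open>Polygons bounded by two piecewise linear graphs\<close>

definition vec2 :: "real \<Rightarrow> real \<Rightarrow> real^2" where "vec2 x y = vector [x, y]"

lemma vec2_nth [simp]: "vec2 x y $ 1 = x" "vec2 x y $ 2 = y"
  by (simp_all add: vec2_def)

lemma vec2_eq_iff: "v = w \<longleftrightarrow> v $ 1 = w $ 1 \<and> v $ 2 = (w $ 2 :: real)" for v w :: "real^2"
  by (auto simp: vec_eq_iff forall_2)

lemma dist_vec2: "dist v w = sqrt ((v$1 - w$1)\<^sup>2 + (v$2 - w$2)\<^sup>2)" for v w :: "real^2"
  by (simp add: dist_vec_def L2_set_def UNIV_2 dist_real_def)

lemma pathstart_polypath: "pathstart (polypath (p # ps)) = p"
  by (cases ps; cases "tl ps") (auto simp: neq_Nil_conv)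

lemma pathfinish_polypath: "ps \<noteq> [] \<Longrightarrow> pathfinish (polypath ps) = last ps"
  by (induction ps rule: polypath.induct) auto

lemma polypath_step:
  assumes "ps \<noteq> []" "tl ps \<noteq> []"
  shows "polypath (p # ps) = linepath p (hd ps) +++ polypath ps"
  using assms by (cases ps; cases "tl ps") auto

lemma path_image_polypath_step:
  assumes "ps \<noteq> []" "tl ps \<noteq> []"
  shows "path_image (polypath (p # ps)) = closed_segment p (hd ps) \<union> path_image (polypath ps)"
  unfolding polypath_step[OF assms]
  by (subst path_image_join) (use assms in \<open>auto simp: neq_Nil_conv pathstart_polypath\<close>)

lemma arc_polypath_step:
  assumes "ps \<noteq> []" "tl ps \<noteq> []" "arc (polypath ps)" "p \<noteq> hd ps"
    and "closed_segment p (hd ps) \<inter> path_image (polypath ps) \<subseteq> {hd ps}"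
  shows "arc (polypath (p # ps))"
  unfolding polypath_step[OF assms(1,2)]
  by (rule arc_join) (use assms in \<open>auto simp: neq_Nil_conv pathstart_polypath\<close>)

text \<open>Only the breakpoints with index at most \<open>N\<close> matter; \<open>g\<close> is a junk value outside \<open>{X 0..X N}\<close>.\<close>

locale roof =
  fixes X Y :: "nat \<Rightarrow> real" and N :: nat
  assumes N: "N \<ge> 1" and X_less: "\<And>r. r < N \<Longrightarrow> X r < X (Suc r)" and Y_pos: "\<And>r. r \<le> N \<Longrightarrow> 0 < Y r"
begin

definition g :: "real \<Rightarrow> real" where
  "g x = (let r = (LEAST r. x \<le> X (Suc r)) in
          Y r + (x - X r) / (X (Suc r) - X r) * (Y (Suc r) - Y r))"

lemma X_less_iff: assumes "r \<le> N" "s \<le> N" "r < s" shows "X r < X s"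
  using assms(3,2)
proof (induction s)
  case (Suc s)
  then show ?case using X_less[of s] by (cases "r = s") auto
qed simp

lemma X_le: "r \<le> N \<Longrightarrow> s \<le> N \<Longrightarrow> r \<le> s \<Longrightarrow> X r \<le> X s"
  using X_less_iff[of r s] by (cases "r = s") auto

lemma g_eq:
  assumes r: "r < N" and x: "X r \<le> x" "x \<le> X (Suc r)"
  shows "g x = Y r + (x - X r) / (X (Suc r) - X r) * (Y (Suc r) - Y r)"
proof (cases "x = X r \<and> r > 0")
  case False
  have "(LEAST r. x \<le> X (Suc r)) = r"
  proof (rule Least_equality)
    show "x \<le> X (Suc r)" by fact
    show "r \<le> s" if "x \<le> X (Suc s)" for s
    proof (rule ccontr)
      assume "\<not> r \<le> s"
      then have "X (Suc s) \<le> X r" using r by (intro X_le) auto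
      then show False using False that x \<open>\<not> r \<le> s\<close> by auto
    qed
  qed
  then show ?thesis unfolding g_def Let_def by simp
next
  case True
  then obtain q where q: "r = Suc q" by (cases r) auto
  \<comment> \<open>At an inner breakpoint the least index is that of the interval on the left,
    whose formula also gives \<open>Y r\<close> there.\<close>
  have "(LEAST r. x \<le> X (Suc r)) = q"
  proof (rule Least_equality)
    show "x \<le> X (Suc q)" using True q by simp
    show "q \<le> s" if "x \<le> X (Suc s)" for s
    proof (rule ccontr)
      assume "\<not> q \<le> s"
      then have "X (Suc s) < X r" using r q by (intro X_less_iff) auto
      then show False using True that by auto
    qed
  qed
  moreover have "X (Suc q) - X q \<noteq> 0" using X_less[of q] q r by simp
  ultimately show ?thesis unfolding g_def Let_def using True q by simp
qed

lemma interval_cover: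
  assumes "X 0 \<le> x" "x \<le> X N"
  obtains r where "r < N" "X r \<le> x" "x \<le> X (Suc r)"
proof -
  have "\<exists>r<j. X r \<le> x \<and> x \<le> X (Suc r)" if "x \<le> X j" "1 \<le> j" for j
    using that
  proof (induction j)
    case (Suc j)
    show ?case
    proof (cases "j \<ge> 1 \<and> x \<le> X j")
      case True then show ?thesis using Suc.IH less_Suc_eq by blast
    next
      case False
      then have "X j \<le> x" using assms(1) by (cases j) auto
      then show ?thesis using Suc.prems by blast
    qed
  qed simp
  then show ?thesis using that assms(2) N by blast
qed

lemma g_pos: assumes "X 0 \<le> x" "x \<le> X N" shows "0 < g x"
proof -
  obtain r where r: "r < N" "X r \<le> x" "x \<le> X (Suc r)" using interval_cover[OF assms] .
  define t where "t = (x - X r) / (X (Suc r) - X r)"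
  have t: "0 \<le> t" "t \<le> 1" using r X_less[OF r(1)] by (auto simp: t_def field_simps)
  have "g x = (1 - t) * Y r + t * Y (Suc r)" unfolding g_eq[OF r] t_def[symmetric] by (simp add: algebra_simps)
  moreover have "0 < Y r" "0 < Y (Suc r)" using Y_pos r by auto
  ultimately show ?thesis using t by (cases "t = 0") (auto intro!: add_nonneg_pos)
qed

lemma g_break: "r \<le> N \<Longrightarrow> g (X r) = Y r"
proof (cases "r < N")
  case True then show ?thesis using g_eq[of r "X r"] X_less[of r] by simp
next
  case False
  assume "r \<le> N"
  with False N obtain q where "r = Suc q" "q < N" by (cases r) auto
  then show ?thesis using g_eq[of q "X r"] X_less[of q] by simp
qed

lemma continuous_g: "continuous_on {X 0..X N} g"
proof -
  have "{X 0..X N} = (\<Union>r\<in>{..<N}. {X r..X (Suc r)})"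
  proof (intro equalityI subsetI)
    fix x assume "x \<in> {X 0..X N}"
    then show "x \<in> (\<Union>r\<in>{..<N}. {X r..X (Suc r)})" using interval_cover[of x] by auto
  next
    fix x assume "x \<in> (\<Union>r\<in>{..<N}. {X r..X (Suc r)})"
    then obtain r where r: "r < N" "X r \<le> x" "x \<le> X (Suc r)" by auto
    then show "x \<in> {X 0..X N}" using X_le[of 0 r] X_le[of "Suc r" N] by auto
  qed
  moreover have "continuous_on (\<Union>r\<in>{..<N}. {X r..X (Suc r)}) g"
  proof (rule continuous_on_closed_Union)
    fix r assume r: "r \<in> {..<N}"
    have "continuous_on {X r..X (Suc r)} (\<lambda>x. Y r + (x - X r) / (X (Suc r) - X r) * (Y (Suc r) - Y r))"
      using X_less[of r] r by (intro continuous_intros) auto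
    then show "continuous_on {X r..X (Suc r)} g"
      using g_eq[of r] r by (auto cong: continuous_on_cong_simp)
  qed auto
  ultimately show ?thesis by simp
qed

text \<open>The sign \<open>s\<close> treats the upper chain and its mirror image together.\<close>

lemma segment_graph:
  assumes "r < N" and s: "s = 1 \<or> s = -1"
  shows "closed_segment (vec2 (X (Suc r)) (s * Y (Suc r))) (vec2 (X r) (s * Y r)) =
         {v. X r \<le> v$1 \<and> v$1 \<le> X (Suc r) \<and> v$2 = s * g (v$1)}"
proof (intro equalityI subsetI)
  have d: "X (Suc r) - X r > 0" using X_less assms by simp
  {
    fix v assume "v \<in> closed_segment (vec2 (X (Suc r)) (s * Y (Suc r))) (vec2 (X r) (s * Y r))"
    then obtain t where t: "0 \<le> t" "t \<le> 1"
      and v: "v$1 = X (Suc r) + t * (X r - X (Suc r))" "v$2 = s * Y (Suc r) + t * (s * Y r - s * Y (Suc r))"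
      by (auto simp: in_segment vec2_eq_iff algebra_simps)
    have 1: "X r \<le> v$1" "v$1 \<le> X (Suc r)"
      using mult_left_mono[OF t(2), of "X (Suc r) - X r"] mult_nonneg_nonneg[OF t(1), of "X (Suc r) - X r"] d
      unfolding v by (auto simp: algebra_simps)
    have "(v$1 - X r) / (X (Suc r) - X r) = 1 - t"
      using d unfolding v by (simp add: field_simps)
    then have "g (v$1) = Y r + (1 - t) * (Y (Suc r) - Y r)"
      using g_eq[OF assms(1) 1] by simp
    then have "v$2 = s * g (v$1)" unfolding v(2) using s by (elim disjE) (simp_all add: algebra_simps)
    then show "v \<in> {v. X r \<le> v$1 \<and> v$1 \<le> X (Suc r) \<and> v$2 = s * g (v$1)}" using 1 by simp
  next
    fix v :: "real^2" assume "v \<in> {v. X r \<le> v$1 \<and> v$1 \<le> X (Suc r) \<and> v$2 = s * g (v$1)}"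
    then have v: "X r \<le> v$1" "v$1 \<le> X (Suc r)" "v$2 = s * g (v$1)" by auto
    define t where "t = (v$1 - X r) / (X (Suc r) - X r)"
    have t: "0 \<le> t" "t \<le> 1" using v d by (auto simp: t_def field_simps)
    have x: "v$1 = X r + t * (X (Suc r) - X r)" using d by (simp add: t_def)
    have "v$2 = s * (Y r + t * (Y (Suc r) - Y r))"
      using g_eq[OF assms(1) v(1,2)] v(3) by (simp add: t_def)
    then have "v = (1 - (1 - t)) *\<^sub>R vec2 (X (Suc r)) (s * Y (Suc r)) + (1 - t) *\<^sub>R vec2 (X r) (s * Y r)"
      using x by (simp add: vec2_eq_iff algebra_simps)
    then show "v \<in> closed_segment (vec2 (X (Suc r)) (s * Y (Suc r))) (vec2 (X r) (s * Y r))"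
      unfolding in_segment using t by (intro exI[of _ "1 - t"]) auto
  }
qed

lemma vertical_segment:
  "y \<le> z \<Longrightarrow> closed_segment (vec2 x y) (vec2 x z) = {v. v$1 = x \<and> y \<le> v$2 \<and> v$2 \<le> z}"
proof (intro equalityI subsetI)
  fix v assume "y \<le> z" "v \<in> closed_segment (vec2 x y) (vec2 x z)"
  then obtain t where t: "0 \<le> t" "t \<le> 1" "v$1 = x" "v$2 = y + t * (z - y)"
    by (auto simp: in_segment vec2_eq_iff algebra_simps)
  moreover have "0 \<le> t * (z - y)" "t * (z - y) \<le> 1 * (z - y)"
    by (rule mult_nonneg_nonneg mult_right_mono; use \<open>y \<le> z\<close> t in simp)+
  ultimately have "v$1 = x \<and> y \<le> v$2 \<and> v$2 \<le> z" by auto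
  then show "v \<in> {v. v$1 = x \<and> y \<le> v$2 \<and> v$2 \<le> z}" by auto
next
  fix v :: "real^2" assume yz: "y \<le> z" and "v \<in> {v. v$1 = x \<and> y \<le> v$2 \<and> v$2 \<le> z}"
  then have v: "v$1 = x" "y \<le> v$2" "v$2 \<le> z" by auto
  define t where "t = (if y = z then 0 else (v$2 - y) / (z - y))"
  have t: "0 \<le> t" "t \<le> 1" "v$2 = y + t * (z - y)" using v yz by (auto simp: t_def field_simps)
  then have "v = (1 - t) *\<^sub>R vec2 x y + t *\<^sub>R vec2 x z" using v by (simp add: vec2_eq_iff algebra_simps)
  then show "v \<in> closed_segment (vec2 x y) (vec2 x z)" unfolding in_segment using t by blast
qed

text \<open>Listed from right to left, so that a longer chain arises by prepending a point, in step
  with the recursion of \<open>polypath\<close>.\<close>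

definition up :: "nat \<Rightarrow> (real^2) list" where
  "up j = map (\<lambda>r. vec2 (X r) (Y r)) (rev [0..<Suc j])"

lemma up_Suc: "up (Suc j) = vec2 (X (Suc j)) (Y (Suc j)) # up j"
  by (simp add: up_def)

lemma up_not_Nil: "up j \<noteq> []" "hd (up j) = vec2 (X j) (Y j)" "last (up j) = vec2 (X 0) (Y 0)"
proof -
  show "up j \<noteq> []" by (simp add: up_def)
  show "hd (up j) = vec2 (X j) (Y j)" by (simp add: up_def)
  show "last (up j) = vec2 (X 0) (Y 0)" by (induction j) (auto simp: up_def)
qed

lemma tl_up: "j \<ge> 1 \<Longrightarrow> tl (up j) \<noteq> []"
  by (cases j) (auto simp: up_Suc up_not_Nil)

lemma up_arc:
  assumes "1 \<le> j" "j \<le> N"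
  shows "arc (polypath (up j)) \<and>
         path_image (polypath (up j)) = {v. X 0 \<le> v$1 \<and> v$1 \<le> X j \<and> v$2 = g (v$1)}"
  using assms
proof (induction j rule: dec_induct)
  case base
  have u: "polypath (up 1) = linepath (vec2 (X (Suc 0)) (Y (Suc 0))) (vec2 (X 0) (Y 0))"
    by (simp add: up_def)
  have "vec2 (X (Suc 0)) (Y (Suc 0)) \<noteq> vec2 (X 0) (Y 0)"
    using X_less[of 0] N by (auto simp: vec2_eq_iff)
  then show ?case unfolding u using segment_graph[of 0 1] N by simp
next
  case (step j)
  have j: "j < N" and IH: "arc (polypath (up j))"
    "path_image (polypath (up j)) = {v. X 0 \<le> v$1 \<and> v$1 \<le> X j \<and> v$2 = g (v$1)}" using step by auto
  have seg: "closed_segment (vec2 (X (Suc j)) (Y (Suc j))) (vec2 (X j) (Y j)) =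
      {v. X j \<le> v$1 \<and> v$1 \<le> X (Suc j) \<and> v$2 = g (v$1)}"
    using segment_graph[OF j, of 1] by simp
  have "arc (polypath (up (Suc j)))" unfolding up_Suc
  proof (rule arc_polypath_step)
    show "vec2 (X (Suc j)) (Y (Suc j)) \<noteq> hd (up j)" 
      using X_less[OF j] by (auto simp: up_not_Nil vec2_eq_iff)
    show "closed_segment (vec2 (X (Suc j)) (Y (Suc j))) (hd (up j)) \<inter> path_image (polypath (up j)) \<subseteq> {hd (up j)}"
      unfolding up_not_Nil seg IH(2) using g_break[of j] j by (auto simp: vec2_eq_iff)
  qed (use IH up_not_Nil tl_up step in auto)
  moreover have "path_image (polypath (up (Suc j))) = {v. X 0 \<le> v$1 \<and> v$1 \<le> X (Suc j) \<and> v$2 = g (v$1)}"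
    unfolding up_Suc path_image_polypath_step[OF up_not_Nil(1) tl_up[OF step(1)]]
    unfolding up_not_Nil seg IH(2) using X_le[of 0 j] X_less[OF j] j by auto
  ultimately show ?case by blast
qed

text \<open>The lower chain runs rightwards from \<open>j\<close> and the upper chain follows
  backwards; the jump between the two is the right vertical side. The boundary curve grows as
  \<open>j\<close> decreases to 0.\<close>

definition down :: "nat \<Rightarrow> (real^2) list" where
  "down j = map (\<lambda>r. vec2 (X r) (- Y r)) [j..<Suc N] @ up N"

lemma down_step: "j \<le> N \<Longrightarrow> down j = vec2 (X j) (- Y j) # (if j = N then up N else down (Suc j))"
proof -
  assume "j \<le> N"
  then have "[j..<Suc N] = j # [Suc j..<Suc N]" by (subst upt_conv_Cons) auto
  then show ?thesis by (auto simp: down_def)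
qed

lemma hd_down: "j \<le> N \<Longrightarrow> hd (down j) = vec2 (X j) (- Y j)"
  by (simp add: down_step)

lemma down_not_Nil: "j \<le> N \<Longrightarrow> down j \<noteq> []" "j \<le> N \<Longrightarrow> tl (down j) \<noteq> []"
  by (simp_all add: down_step up_not_Nil)

lemma last_down: "last (down j) = vec2 (X 0) (Y 0)"
  by (simp add: down_def up_not_Nil)

lemma down_arc:
  assumes "j \<le> N"
  shows "arc (polypath (down j)) \<and> path_image (polypath (down j)) =
      {v. X j \<le> v$1 \<and> v$1 \<le> X N \<and> v$2 = - g (v$1)} \<union>
      {v. v$1 = X N \<and> - g (X N) \<le> v$2 \<and> v$2 \<le> g (X N)} \<union>
      {v. X 0 \<le> v$1 \<and> v$1 \<le> X N \<and> v$2 = g (v$1)}"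
  using assms
proof (induction j rule: inc_induct)
  case base
  have U: "arc (polypath (up N))"
    "path_image (polypath (up N)) = {v. X 0 \<le> v$1 \<and> v$1 \<le> X N \<and> v$2 = g (v$1)}"
    using up_arc N by auto
  have d: "down N = vec2 (X N) (- Y N) # up N" by (simp add: down_step)
  have Y: "0 < Y N" "g (X N) = Y N" using Y_pos g_break by auto
  have seg: "closed_segment (vec2 (X N) (- Y N)) (vec2 (X N) (Y N)) = {v. v$1 = X N \<and> - g (X N) \<le> v$2 \<and> v$2 \<le> g (X N)}"
    using vertical_segment[of "- Y N" "Y N"] Y by auto
  have "arc (polypath (down N))" unfolding d
  proof (rule arc_polypath_step)
    show "vec2 (X N) (- Y N) \<noteq> hd (up N)" using Y by (auto simp: up_not_Nil vec2_eq_iff)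
    show "closed_segment (vec2 (X N) (- Y N)) (hd (up N)) \<inter> path_image (polypath (up N)) \<subseteq> {hd (up N)}"
      unfolding up_not_Nil seg U(2) using Y by (auto simp: vec2_eq_iff)
  qed (use U up_not_Nil tl_up N in auto)
  moreover have "path_image (polypath (down N)) = {v. v$1 = X N \<and> - g (X N) \<le> v$2 \<and> v$2 \<le> g (X N)} \<union>
      {v. X 0 \<le> v$1 \<and> v$1 \<le> X N \<and> v$2 = g (v$1)}"
    unfolding d path_image_polypath_step[OF up_not_Nil(1) tl_up[OF N]] up_not_Nil seg U(2) by simp
  moreover have "{v::real^2. X N \<le> v$1 \<and> v$1 \<le> X N \<and> v$2 = - g (v$1)} \<subseteq>
      {v. v$1 = X N \<and> - g (X N) \<le> v$2 \<and> v$2 \<le> g (X N)}"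
  proof
    fix v :: "real^2" assume v: "v \<in> {v. X N \<le> v$1 \<and> v$1 \<le> X N \<and> v$2 = - g (v$1)}"
    then have "v$1 = X N" by simp
    then show "v \<in> {v. v$1 = X N \<and> - g (X N) \<le> v$2 \<and> v$2 \<le> g (X N)}" using v Y by simp
  qed
  ultimately show ?case by (simp add: Un_absorb1)
next
  case (step j)
  note j = \<open>j < N\<close>
  have d: "down j = vec2 (X j) (- Y j) # down (Suc j)" using j by (simp add: down_step[of j])
  have seg: "closed_segment (vec2 (X j) (- Y j)) (vec2 (X (Suc j)) (- Y (Suc j))) =
      {v. X j \<le> v$1 \<and> v$1 \<le> X (Suc j) \<and> v$2 = - g (v$1)}"
    using segment_graph[OF j, of "-1"] by (simp add: closed_segment_commute)
  have IH: "arc (polypath (down (Suc j)))" "path_image (polypath (down (Suc j))) =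
      {v. X (Suc j) \<le> v$1 \<and> v$1 \<le> X N \<and> v$2 = - g (v$1)} \<union>
      {v. v$1 = X N \<and> - g (X N) \<le> v$2 \<and> v$2 \<le> g (X N)} \<union>
      {v. X 0 \<le> v$1 \<and> v$1 \<le> X N \<and> v$2 = g (v$1)}" using step by auto
  have le: "X 0 \<le> X j" "X j < X (Suc j)" "X (Suc j) \<le> X N" using X_le X_less j by auto
  have "arc (polypath (down j))" unfolding d
  proof (rule arc_polypath_step)
    show "vec2 (X j) (- Y j) \<noteq> hd (down (Suc j))" using le j by (auto simp: hd_down vec2_eq_iff)
    show "closed_segment (vec2 (X j) (- Y j)) (hd (down (Suc j))) \<inter> path_image (polypath (down (Suc j))) \<subseteq> {hd (down (Suc j))}"
    proof
      fix v assume "v \<in> closed_segment (vec2 (X j) (- Y j)) (hd (down (Suc j))) \<inter> path_image (polypath (down (Suc j)))"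
      then have v: "X j \<le> v$1" "v$1 \<le> X (Suc j)" "v$2 = - g (v$1)" "v \<in> path_image (polypath (down (Suc j)))"
        using j seg by (auto simp: hd_down)
      \<comment> \<open>Positivity of \<open>g\<close> keeps the new lower segment off the upper
        chain, so it can meet the rest only at its right end.\<close>
      have "g (v$1) > 0" using g_pos[of "v$1"] v le by auto
      then have "v$1 = X (Suc j)" using v le unfolding IH(2) by auto
      then show "v \<in> {hd (down (Suc j))}" using v j g_break[of "Suc j"] by (auto simp: hd_down vec2_eq_iff)
    qed
  qed (use IH down_not_Nil j in auto)
  moreover have split: "{v::real^2. X j \<le> v$1 \<and> v$1 \<le> X N \<and> R v} =
      {v. X j \<le> v$1 \<and> v$1 \<le> X (Suc j) \<and> R v} \<union> {v. X (Suc j) \<le> v$1 \<and> v$1 \<le> X N \<and> R v}" for R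
    using le by auto
  have "path_image (polypath (down j)) = closed_segment (vec2 (X j) (- Y j)) (vec2 (X (Suc j)) (- Y (Suc j)))
      \<union> path_image (polypath (down (Suc j)))"
    unfolding d using path_image_polypath_step[of "down (Suc j)"] down_not_Nil j by (auto simp: hd_down)
  then have "path_image (polypath (down j)) = {v. X j \<le> v$1 \<and> v$1 \<le> X N \<and> v$2 = - g (v$1)} \<union>
      {v. v$1 = X N \<and> - g (X N) \<le> v$2 \<and> v$2 \<le> g (X N)} \<union>
      {v. X 0 \<le> v$1 \<and> v$1 \<le> X N \<and> v$2 = g (v$1)}"
    unfolding seg IH(2) split[of "\<lambda>v. v$2 = - g (v$1)"] by (simp add: Un_assoc)
  ultimately show ?case by blast
qed

section \<open>The region between the two graphs and its boundary curve\<close>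

definition U :: "(real^2) set" where
  "U = {v. X 0 < v$1 \<and> v$1 < X N \<and> \<bar>v$2\<bar> < g (v$1)}"

definition P :: "(real^2) set" where
  "P = {v. X 0 \<le> v$1 \<and> v$1 \<le> X N \<and> \<bar>v$2\<bar> \<le> g (v$1)}"

text \<open>Begins at the upper left point, where \<open>down 0\<close> ends, so the list closes up
  and its first segment is the left vertical side.\<close>

definition bd :: "(real^2) list" where "bd = vec2 (X 0) (Y 0) # down 0"

lemma bd_simple_path: "simple_path (polypath bd)"
  and bd_image: "path_image (polypath bd) = P - U"
proof -
  have D: "arc (polypath (down 0))" "path_image (polypath (down 0)) =
      {v. X 0 \<le> v$1 \<and> v$1 \<le> X N \<and> v$2 = - g (v$1)} \<union>
      {v. v$1 = X N \<and> - g (X N) \<le> v$2 \<and> v$2 \<le> g (X N)} \<union>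
      {v. X 0 \<le> v$1 \<and> v$1 \<le> X N \<and> v$2 = g (v$1)}" using down_arc[of 0] by auto
  have Y: "0 < Y 0" "g (X 0) = Y 0" using Y_pos g_break by auto
  have lt: "X 0 < X N" using X_less_iff[of 0 N] N by auto
  have ne: "down 0 \<noteq> []" "tl (down 0) \<noteq> []" using down_not_Nil by auto
  have h: "hd (down 0) = vec2 (X 0) (- Y 0)" by (simp add: hd_down)
  have st: "pathstart (polypath (down 0)) = vec2 (X 0) (- Y 0)"
    using ne h by (metis list.collapse pathstart_polypath)
  have seg: "closed_segment (vec2 (X 0) (Y 0)) (vec2 (X 0) (- Y 0)) = {v. v$1 = X 0 \<and> - g (X 0) \<le> v$2 \<and> v$2 \<le> g (X 0)}"
    using vertical_segment[of "- Y 0" "Y 0"] Y by (auto simp: closed_segment_commute)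
  have gpos: "\<And>x. X 0 \<le> x \<Longrightarrow> x \<le> X N \<Longrightarrow> 0 < g x" by (rule g_pos)
  show "simple_path (polypath bd)"
    unfolding bd_def polypath_step[OF ne] h
  proof (rule simple_path_join_loop)
    show "arc (linepath (vec2 (X 0) (Y 0)) (vec2 (X 0) (- Y 0)))"
      using Y by (intro arc_linepath) (auto simp: vec2_eq_iff)
    show "path_image (linepath (vec2 (X 0) (Y 0)) (vec2 (X 0) (- Y 0))) \<inter> path_image (polypath (down 0))
      \<subseteq> {pathstart (linepath (vec2 (X 0) (Y 0)) (vec2 (X 0) (- Y 0))), pathstart (polypath (down 0))}"
    proof
      fix v assume v: "v \<in> path_image (linepath (vec2 (X 0) (Y 0)) (vec2 (X 0) (- Y 0))) \<inter> path_image (polypath (down 0))"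
      then have "v$1 = X 0" by (simp add: seg)
      moreover from this have "v$2 = - Y 0 \<or> v$2 = Y 0" using v lt Y by (simp add: D(2))
      ultimately show "v \<in> {pathstart (linepath (vec2 (X 0) (Y 0)) (vec2 (X 0) (- Y 0))), pathstart (polypath (down 0))}"
        by (auto simp: st vec2_eq_iff)
    qed
  qed (use D st last_down pathfinish_polypath[OF ne(1)] in auto)
  have im: "path_image (polypath bd) = {v. v$1 = X 0 \<and> - g (X 0) \<le> v$2 \<and> v$2 \<le> g (X 0)} \<union>
      path_image (polypath (down 0))"
    unfolding bd_def path_image_polypath_step[OF ne] h seg ..
  show "path_image (polypath bd) = P - U"
  proof (rule set_eqI)
    fix v :: "real^2"
    have abs: "\<bar>v$2\<bar> \<le> c \<longleftrightarrow> - c \<le> v$2 \<and> v$2 \<le> c" "\<bar>v$2\<bar> < c \<longleftrightarrow> - c < v$2 \<and> v$2 < c" for c by auto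
    define G where "G = g (v$1)"
    have ends: "v$1 = X 0 \<Longrightarrow> g (X 0) = G" "v$1 = X N \<Longrightarrow> g (X N) = G" by (simp_all add: G_def)
    show "v \<in> path_image (polypath bd) \<longleftrightarrow> v \<in> P - U"
      unfolding im D(2) P_def U_def Un_iff Diff_iff mem_Collect_eq abs G_def[symmetric]
      using lt gpos[of "v$1", folded G_def] ends
      by (cases "v$1 = X 0"; cases "v$1 = X N"; cases "X 0 \<le> v$1 \<and> v$1 \<le> X N") auto
  qed
qed

lemma open_U: "open U"
proof -
  have "continuous_on {v::real^2. X 0 < v$1 \<and> v$1 < X N} (\<lambda>v. g (v$1))"
    by (rule continuous_on_compose2[OF continuous_g]) (auto intro!: continuous_intros)
  then have "continuous_on {v::real^2. X 0 < v$1 \<and> v$1 < X N} (\<lambda>v. g (v$1) - \<bar>v$2\<bar>)"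
    by (intro continuous_intros) auto
  moreover have "open {v::real^2. X 0 < v$1 \<and> v$1 < X N}"
    unfolding Collect_conj_eq
    by (intro open_Int open_halfspace_component_gt_cart open_halfspace_component_lt_cart)
  ultimately have "open ({v::real^2. X 0 < v$1 \<and> v$1 < X N} \<inter> (\<lambda>v. g (v$1) - \<bar>v$2\<bar>) -` {0<..})"
    by (simp add: continuous_on_open_vimage Int_commute)
  moreover have "U = {v::real^2. X 0 < v$1 \<and> v$1 < X N} \<inter> (\<lambda>v. g (v$1) - \<bar>v$2\<bar>) -` {0<..}"
    unfolding U_def by auto
  ultimately show ?thesis by simp
qed

lemma closed_P: "closed P"
proof -
  let ?S = "{v::real^2. X 0 \<le> v$1 \<and> v$1 \<le> X N}"
  have "continuous_on ?S (\<lambda>v. g (v$1))"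
    by (rule continuous_on_compose2[OF continuous_g]) (auto intro!: continuous_intros)
  then have "continuous_on ?S (\<lambda>v. g (v$1) - \<bar>v$2\<bar>)"
    by (intro continuous_intros) auto
  moreover have "closed ?S"
    unfolding Collect_conj_eq
    by (intro closed_Int closed_halfspace_component_ge_cart closed_halfspace_component_le_cart)
  ultimately have "closed (?S \<inter> (\<lambda>v. g (v$1) - \<bar>v$2\<bar>) -` {0..})"
    by (simp add: continuous_on_closed_vimage Int_commute)
  moreover have "P = ?S \<inter> (\<lambda>v. g (v$1) - \<bar>v$2\<bar>) -` {0..}"
    unfolding P_def by auto
  ultimately show ?thesis by simp
qed

lemma U_subset_P: "U \<subseteq> P"
  by (auto simp: U_def P_def)

lemma bounded_U: "bounded U"
proof -
  have "bounded (g ` {X 0..X N})"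
    by (intro compact_imp_bounded compact_continuous_image continuous_g) auto
  then obtain M where M: "\<And>x. x \<in> {X 0..X N} \<Longrightarrow> \<bar>g x\<bar> \<le> M"
    unfolding bounded_iff real_norm_def by blast
  have "U \<subseteq> cbox (vec2 (X 0) (- M)) (vec2 (X N) M)"
  proof
    fix v assume "v \<in> U"
    then have "X 0 < v$1" "v$1 < X N" "\<bar>v$2\<bar> < g (v$1)" by (auto simp: U_def)
    moreover have "\<bar>g (v$1)\<bar> \<le> M" using calculation by (intro M) auto
    ultimately show "v \<in> cbox (vec2 (X 0) (- M)) (vec2 (X N) M)"
      by (auto simp: mem_box_cart forall_2)
  qed
  then show ?thesis using bounded_cbox bounded_subset by blast
qed

text \<open>One of the four axis directions leads away: horizontal if the abscissa is out of range,
  vertical otherwise.\<close>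

lemma outside_ray:
  assumes "v \<notin> P"
  obtains d :: "real^2" where "norm d = 1" "\<And>t. t \<ge> 0 \<Longrightarrow> v + t *\<^sub>R d \<notin> P"
proof -
  define ray where "ray a b = (\<forall>t\<ge>0. v + t *\<^sub>R vec2 a b \<notin> P)" for a b
  have "ray (-1) 0" if "v$1 < X 0" using that by (auto simp: ray_def P_def)
  moreover have "ray 1 0" if "v$1 > X N" using that by (auto simp: ray_def P_def)
  moreover have "ray 0 1" if "v$2 > g (v$1)" using that by (auto simp: ray_def P_def)
  moreover have "ray 0 (-1)" if "v$2 < - g (v$1)" using that by (auto simp: ray_def P_def)
  moreover have "v$1 < X 0 \<or> v$1 > X N \<or> v$2 > g (v$1) \<or> v$2 < - g (v$1)"
    using assms by (auto simp: P_def)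
  moreover have "norm (vec2 a b) = sqrt (a\<^sup>2 + b\<^sup>2)" for a b
    using dist_vec2[of "vec2 a b" 0] by simp
  ultimately show ?thesis using that unfolding ray_def by (smt (verit) power2_eq_1_iff real_sqrt_one zero_power2)
qed

lemma inside_bd: "inside (path_image (polypath bd)) = U"
  unfolding bd_image
proof (rule inside_eq_region)
  show "bounded U" by (rule bounded_U)
  show "frontier U \<subseteq> P - U"
    using closure_minimal[OF U_subset_P closed_P] open_U by (auto simp: frontier_def interior_open)
  fix v assume "v \<notin> P - U \<union> U"
  then have "v \<notin> P" by auto
  then obtain d where d: "norm d = 1" "\<And>t. t \<ge> 0 \<Longrightarrow> v + t *\<^sub>R d \<notin> P" using outside_ray by blast
  let ?C = "(\<lambda>t. v + t *\<^sub>R d) ` {0..}"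
  have "connected ?C" by (intro connected_continuous_image continuous_intros convex_connected convex_real_interval)
  moreover have "v \<in> ?C" by (rule image_eqI[of _ _ 0]) auto
  moreover have "?C \<inter> (P - U) = {}" using d by auto
  moreover have "\<not> bounded ?C"
  proof
    assume "bounded ?C"
    then obtain M where M: "\<And>t. t \<ge> 0 \<Longrightarrow> dist v (v + t *\<^sub>R d) \<le> M" 
      unfolding bounded_any_center[of _ v] by auto
    have "\<bar>t\<bar> \<le> M" if "t \<ge> 0" for t using M[OF that] d(1) by (simp add: dist_norm)
    from this[of "\<bar>M\<bar> + 1"] show False by auto
  qed
  ultimately show "\<exists>C. connected C \<and> v \<in> C \<and> C \<inter> (P - U) = {} \<and> \<not> bounded C" by blast
qed auto

lemma simple_polygon_P: "simple_polygon P"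
  unfolding simple_polygon_def
proof (intro exI conjI)
  show "2 \<le> length bd" using down_not_Nil[of 0] by (cases "down 0") (auto simp: bd_def)
  show "hd bd = last bd" using down_not_Nil[of 0] by (auto simp: bd_def last_down)
  show "simple_path (polypath bd)" by (rule bd_simple_path)
  show "P = path_image (polypath bd) \<union> inside (path_image (polypath bd))"
    using inside_bd[unfolded bd_image] U_subset_P unfolding bd_image by auto
qed

lemma interior_P: "interior P = U"
proof
  show "U \<subseteq> interior P" by (simp add: interior_maximal U_subset_P open_U)
  show "interior P \<subseteq> U"
  proof
    fix v assume v: "v \<in> interior P"
    then obtain e where e: "e > 0" "ball v e \<subseteq> P" using mem_interior by blast
    \<comment> \<open>Small displacements parallel to the axes stay in \<open>P\<close>, which turns
      each of its weak inequalities into a strict one.\<close>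
    have *: "v + vec2 a b \<in> P" if "\<bar>a\<bar> + \<bar>b\<bar> < e" for a b
    proof -
      have "norm (vec2 a b) \<le> \<bar>a\<bar> + \<bar>b\<bar>"
        using dist_vec2[of "vec2 a b" 0] sqrt_sum_squares_le_sum_abs[of a b] by simp
      then have "v + vec2 a b \<in> ball v e" using that by (simp add: dist_norm)
      then show ?thesis using e by blast
    qed
    have "v$1 - e/2 \<ge> X 0" "v$1 + e/2 \<le> X N" using *[of "-e/2" 0] *[of "e/2" 0] e(1) by (auto simp: P_def)
    moreover have "v$2 - e/2 \<ge> - g (v$1)" "v$2 + e/2 \<le> g (v$1)"
      using *[of 0 "-e/2"] *[of 0 "e/2"] e(1) by (auto simp: P_def)
    ultimately show "v \<in> U" using e(1) by (auto simp: U_def)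
  qed
qed

end

section \<open>The regular polygon\<close>

locale ngon =
  fixes m :: nat
  assumes m: "3 \<le> m"
begin

definition k :: nat where "k = 2 * m + 1"
text \<open>Half the central angle of a side. Its cotangent \<open>A\<close> is the apothem for
  sides of length 2; \<open>n i\<close> is the outer unit normal of side \<open>i\<close>, and
  multiplication by it carries the side in standard position to side \<open>i\<close>.\<close>

definition \<theta> :: real where "\<theta> = pi / real k"
definition A :: real where "A = cos \<theta> / sin \<theta>"
definition n :: "nat \<Rightarrow> complex" where "n i = cis ((2 * real i + 1) * \<theta>)"
definition b :: "nat \<Rightarrow> complex" where "b i = n i * Complex A (- 1)"
text \<open>\<open>x i\<close> and \<open>h i\<close> are Cartesian coordinates adapted to the side from \<open>b i\<close> to \<open>b (Suc i)\<close>: the position along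
  this side, which has length 2, and the distance from it towards the interior.\<close>

definition h :: "nat \<Rightarrow> complex \<Rightarrow> real" where "h i p = A - Re (p * cnj (n i))"
definition x :: "nat \<Rightarrow> complex \<Rightarrow> real" where "x i p = 1 + Im (p * cnj (n i))"
definition B :: "complex set" where "B = {p. \<forall>i<k. 0 \<le> h i p}"

lemma k_ge: "7 \<le> k" using m by (simp add: k_def)

lemma theta_bounds: "0 < \<theta>" "\<theta> < pi / 6" "real k * \<theta> = pi"
proof -
  show "0 < \<theta>" "real k * \<theta> = pi" using k_ge by (auto simp: \<theta>_def)
  have "pi / real k \<le> pi / 7" using k_ge by (intro divide_left_mono) auto
  also have "\<dots> < pi / 6" by (simp add: field_simps)
  finally show "\<theta> < pi / 6" by (simp add: \<theta>_def)
qed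

lemma sin_cos: "0 < sin \<theta>" "sin \<theta> < 1/2" "1/2 < cos \<theta>" "0 < cos (2 * \<theta>)" "0 < sin (2 * \<theta>)"
proof -
  show "0 < sin \<theta>" using theta_bounds by (intro sin_gt_zero) auto
  have "sin \<theta> < sin (pi / 6)" using theta_bounds by (intro sin_monotone_2pi) auto
  then show "sin \<theta> < 1/2" by (simp add: sin_30)
  have "cos (pi / 3) < cos \<theta>" using theta_bounds by (intro cos_monotone_0_pi) auto
  then show "1/2 < cos \<theta>" by (simp add: cos_60)
  show "0 < cos (2 * \<theta>)" using theta_bounds by (intro cos_gt_zero) auto
  show "0 < sin (2 * \<theta>)" using theta_bounds by (intro sin_gt_zero) auto
qed

text \<open>The middle bound compares heights over a side: \<open>2 * sin (2 * \<theta>)\<close> is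
  the height of the neighbouring corner, which thus lies lower than the centre. It rests on
  \<open>sin \<theta> < 1/2\<close>, that is, on having more than six sides.\<close>

lemma A_bounds: "1 < A" "2 * sin (2 * \<theta>) < A" "A * sin \<theta> = cos \<theta>"
proof -
  show "1 < A" using sin_cos by (simp add: A_def field_simps)
  have "sin \<theta> * sin \<theta> < 1/2 * (1/2)" using sin_cos by (intro mult_strict_mono) auto
  then have "4 * (sin \<theta> * sin \<theta>) * cos \<theta> < 1 * cos \<theta>" using sin_cos by (intro mult_strict_right_mono) auto
  then have "2 * sin (2 * \<theta>) * sin \<theta> < cos \<theta>" unfolding sin_double by (simp add: mult_ac)
  then show "2 * sin (2 * \<theta>) < A" using sin_cos by (simp add: A_def pos_less_divide_eq)
  show "A * sin \<theta> = cos \<theta>" using sin_cos by (simp add: A_def)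
qed

lemma n_norm: "n i * cnj (n i) = 1" "cnj (n i) * n i = 1"
  by (simp_all add: n_def cis_mult cis_cnj)

lemma n_Suc: "n (Suc i) = n i * cis (2 * \<theta>)"
  by (simp add: n_def cis_mult algebra_simps)

lemma n_k: "n k = n 0"
proof -
  have "(2 * real k + 1) * \<theta> = 2 * (real k * \<theta>) + \<theta>" by (simp add: algebra_simps)
  then have "n k = cis (2 * pi + \<theta>)" using theta_bounds(3) by (simp add: n_def)
  then show ?thesis by (simp add: n_def cis_mult[symmetric])
qed

lemma cis_A: "Complex A (- 1) = cis (- \<theta>) / complex_of_real (sin \<theta>)"
             "Complex A 1 = cis \<theta> / complex_of_real (sin \<theta>)"
  using sin_cos A_bounds(3) by (auto simp: complex_eq_iff Re_divide_of_real Im_divide_of_real A_def)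

lemma b_eq: "b i = cis (2 * real i * \<theta>) / complex_of_real (sin \<theta>)"
  by (simp add: b_def cis_A n_def cis_mult algebra_simps)

lemma b_Suc: "b (Suc i) = n i * Complex A 1"
  by (simp add: b_eq cis_A n_def cis_mult algebra_simps)

lemma b_k: "b k = b 0"
  by (simp add: b_def n_k)

lemma point_eq: "p = n i * Complex (A - h i p) (x i p - 1)"
proof -
  have "Complex (A - h i p) (x i p - 1) = p * cnj (n i)" by (simp add: h_def x_def complex_eq_iff)
  then show ?thesis using n_norm by (simp add: mult.left_commute)
qed

lemma x_h_point: "x i (n i * Complex u v) = v + 1" "h i (n i * Complex u v) = A - u"
proof -
  have "n i * Complex u v * cnj (n i) = (n i * cnj (n i)) * Complex u v" by (simp only: mult_ac)
  then have "n i * Complex u v * cnj (n i) = Complex u v" using n_norm[of i] by simp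
  then show "x i (n i * Complex u v) = v + 1" "h i (n i * Complex u v) = A - u"
    unfolding x_def h_def by (simp_all only: complex.sel)
qed

lemma coords_inject: "x i p = x i q \<Longrightarrow> h i p = h i q \<Longrightarrow> p = q"
  by (metis point_eq)

lemma coords_b: "x i (b i) = 0" "h i (b i) = 0" "x i (b (Suc i)) = 2" "h i (b (Suc i)) = 0"
  by (simp_all add: b_def[of i] b_Suc x_h_point)

lemma dist_coords: "(dist p q)\<^sup>2 = (x i p - x i q)\<^sup>2 + (h i p - h i q)\<^sup>2"
proof -
  have "p - q = n i * Complex (h i q - h i p) (x i p - x i q)"
    using point_eq[of p i] point_eq[of q i] by (metis (no_types, lifting) complex_diff right_diff_distrib diff_add_cancel add_diff_cancel_left' diff_diff_eq2 diff_minus_eq_add minus_diff_eq)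
  moreover have "cmod (n i) = 1" by (simp add: n_def)
  ultimately show ?thesis by (simp add: dist_norm norm_mult cmod_power2 power2_commute)
qed

lemma affine_comb:
  "h i (o' + v *\<^sub>R (p - o') + w *\<^sub>R (q - o')) = (1 - v - w) * h i o' + v * h i p + w * h i q"
  "x i (o' + v *\<^sub>R (p - o') + w *\<^sub>R (q - o')) = (1 - v - w) * x i o' + v * x i p + w * x i q"
  by (simp_all add: h_def x_def algebra_simps)

lemma affine_segment:
  "h i ((1 - u) *\<^sub>R p + u *\<^sub>R q) = (1 - u) * h i p + u * h i q"
  "x i ((1 - u) *\<^sub>R p + u *\<^sub>R q) = (1 - u) * x i p + u * x i q"
  by (simp_all add: h_def x_def algebra_simps)

lemma continuous_coords: "continuous_on S (h i)" "continuous_on S (x i)"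
  unfolding h_def x_def by (intro continuous_intros)+

lemma cos_between:
  assumes "\<theta> < y" "y < 2 * pi - \<theta>" shows "cos y < cos \<theta>"
proof (cases "y \<le> pi")
  case True
  then show ?thesis using assms theta_bounds by (intro cos_monotone_0_pi) auto
next
  case False
  have "cos y = cos (2 * pi - y)" by (simp add: cos_diff)
  also have "\<dots> < cos \<theta>" using False assms theta_bounds by (intro cos_monotone_0_pi) auto
  finally show ?thesis .
qed

lemma k_theta: "real j * \<theta> < pi \<longleftrightarrow> j < k"
  using theta_bounds by (metis mult_less_cancel_right_pos of_nat_less_iff)

section \<open>Incidence of corners and sides\<close>

lemma h_b_eq: "h j (b i) = (cos \<theta> - cos ((2 * real i - 2 * real j - 1) * \<theta>)) / sin \<theta>"
proof -
  have "b i * cnj (n j) = cis ((2 * real i - 2 * real j - 1) * \<theta>) / complex_of_real (sin \<theta>)"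
    by (simp add: b_eq n_def cis_mult cis_cnj algebra_simps)
  then have "Re (b i * cnj (n j)) = cos ((2 * real i - 2 * real j - 1) * \<theta>) / sin \<theta>"
    by (simp add: Re_divide_of_real)
  then show ?thesis by (simp add: h_def A_def diff_divide_distrib)
qed

text \<open>The last case is the wrap-around: side \<open>k - 1\<close> ends at
  \<open>b k = b 0\<close>.\<close>

definition adj :: "nat \<Rightarrow> nat \<Rightarrow> bool" where
  "adj j i \<longleftrightarrow> i = j \<or> i = Suc j \<or> (i = 0 \<and> j = k - 1)"

lemma h_b_adj: assumes "adj j i" shows "h j (b i) = 0"
proof -
  have "j = k - 1 \<Longrightarrow> h j (b 0) = 0" using coords_b(4)[of j] b_k k_ge by (cases k) auto
  then show ?thesis using assms coords_b by (auto simp: adj_def)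
qed

text \<open>The angle between a corner and the normal of a side is an odd multiple of
  \<open>\<theta>\<close>. Without incidence it differs from \<open>\<theta>\<close> and
  \<open>- \<theta>\<close> modulo a full turn, so its cosine is below
  \<open>cos \<theta>\<close>.\<close>

lemma h_b_pos: assumes "i < k" "j < k" "\<not> adj j i" shows "0 < h j (b i)"
proof -
  have "cos ((2 * real i - 2 * real j - 1) * \<theta>) < cos \<theta>"
  proof (cases "i \<le> j")
    case True
    have ij: "i < j" "\<not> (i = 0 \<and> j = k - 1)" using assms True by (auto simp: adj_def)
    have "cos ((2 * real i - 2 * real j - 1) * \<theta>) = cos ((2 * real j - 2 * real i + 1) * \<theta>)"
      by (metis (no_types, opaque_lifting) cos_minus minus_mult_left minus_diff_eq diff_diff_eq add.commute diff_minus_eq_add diff_add_eq uminus_add_conv_diff)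
    also have "\<dots> < cos \<theta>"
    proof (rule cos_between)
      have "1 * \<theta> < (2 * real j - 2 * real i + 1) * \<theta>" using ij theta_bounds by (intro mult_strict_right_mono) auto
      then show "\<theta> < (2 * real j - 2 * real i + 1) * \<theta>" by simp
      have "j - i + 1 < k" using ij assms by linarith
      then have "real j - real i + 1 < real k" using ij by linarith
      then have "(2 * real j - 2 * real i + 1) * \<theta> < (2 * real k - 1) * \<theta>"
        using theta_bounds by (intro mult_strict_right_mono) auto
      also have "\<dots> = 2 * pi - \<theta>" using theta_bounds(3) by (simp add: algebra_simps)
      finally show "(2 * real j - 2 * real i + 1) * \<theta> < 2 * pi - \<theta>" .
    qed
    finally show ?thesis .
  next
    case False
    have ij: "i > Suc j" using assms False by (auto simp: adj_def)
    show ?thesis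
    proof (rule cos_between)
      have "1 * \<theta> < (2 * real i - 2 * real j - 1) * \<theta>" using ij theta_bounds by (intro mult_strict_right_mono) auto
      then show "\<theta> < (2 * real i - 2 * real j - 1) * \<theta>" by simp
      have "real i - real j < real k" using ij assms by linarith
      then have "(2 * real i - 2 * real j - 1) * \<theta> < (2 * real k - 1) * \<theta>"
        using theta_bounds by (intro mult_strict_right_mono) auto
      also have "\<dots> = 2 * pi - \<theta>" using theta_bounds(3) by (simp add: algebra_simps)
      finally show "(2 * real i - 2 * real j - 1) * \<theta> < 2 * pi - \<theta>" .
    qed
  qed
  then show ?thesis unfolding h_b_eq using sin_cos by simp
qed

lemma h_b_nonneg: "i < k \<Longrightarrow> j < k \<Longrightarrow> 0 \<le> h j (b i)"
  using h_b_adj h_b_pos by (metis less_eq_real_def)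

lemma b_in_B: "i \<le> k \<Longrightarrow> b i \<in> B"
  using h_b_nonneg b_k k_ge unfolding B_def by (cases "i = k") auto

lemma h_b_zero_iff: "i < k \<Longrightarrow> j < k \<Longrightarrow> h j (b i) = 0 \<longleftrightarrow> adj j i"
  using h_b_adj h_b_pos by (metis less_irrefl)

lemma norm_b: "cmod (b i) = 1 / sin \<theta>"
  using sin_cos by (simp add: b_eq norm_divide)

lemma b_inj: assumes "i < k" "j < k" "b i = b j" shows "i = j"
proof -
  have "adj i j" "adj j i" using h_b_zero_iff[of i j] h_b_zero_iff[of j i] h_b_zero_iff[of i i] h_b_zero_iff[of j j] assms
    by (auto simp: adj_def)
  then show ?thesis using k_ge by (auto simp: adj_def)
qed

lemma edge_segment:
  assumes p: "p \<in> B" and i: "i < k" and 0: "h i p = 0"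
  shows "p \<in> closed_segment (b i) (b (Suc i))" "0 \<le> x i p" "x i p \<le> 2"
proof -
  define y where "y = x i p - 1"
  have p_eq: "p = n i * Complex A y" using point_eq[of p i] 0 by (simp add: y_def)
  have side: "\<bar>y\<bar> \<le> 1"
  proof -
    \<comment> \<open>With this identity the constraints of the two neighbouring sides become
      exactly \<open>y \<le> 1\<close> and \<open>- y \<le> 1\<close>.\<close>
    have *: "A * (1 - cos (2*\<theta>)) = sin (2*\<theta>)"
    proof -
      have "A * (1 - cos (2*\<theta>)) = 2 * (A * sin \<theta>) * sin \<theta>"
        by (simp add: cos_double_sin power2_eq_square)
      then show ?thesis using A_bounds(3) by (simp add: sin_double)
    qed
    have le1: "y \<le> 1" if "0 \<le> A - Re (p * cnj (n i * cis (2*\<theta>)))"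
    proof -
      have "p * cnj (n i * cis (2*\<theta>)) = n i * cnj (n i) * (Complex A y * cis (- (2*\<theta>)))"
        unfolding p_eq by (simp add: cis_cnj mult_ac)
      then have "Re (p * cnj (n i * cis (2*\<theta>))) = A * cos (2*\<theta>) + y * sin (2*\<theta>)"
        using n_norm by simp
      then have "y * sin (2*\<theta>) \<le> 1 * sin (2*\<theta>)" using that * by (simp add: algebra_simps)
      then show ?thesis using sin_cos mult_right_le_imp_le by blast
    qed
    have le2: "- y \<le> 1" if "0 \<le> A - Re (p * cnj (n i * cis (- (2*\<theta>))))"
    proof -
      have "p * cnj (n i * cis (- (2*\<theta>))) = n i * cnj (n i) * (Complex A y * cis (2*\<theta>))"
        unfolding p_eq by (simp add: cis_cnj mult_ac)
      then have "Re (p * cnj (n i * cis (- (2*\<theta>)))) = A * cos (2*\<theta>) - y * sin (2*\<theta>)"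
        using n_norm by simp
      then have "(- y) * sin (2*\<theta>) \<le> 1 * sin (2*\<theta>)" using that * by (simp add: algebra_simps)
      then show ?thesis using sin_cos mult_right_le_imp_le by blast
    qed
    have "\<exists>j<k. n j = n (Suc i)"
    proof (cases "Suc i = k")
      case True then show ?thesis using n_k k_ge by (intro exI[of _ 0]) auto
    next
      case False then show ?thesis using i by (intro exI[of _ "Suc i"]) auto
    qed
    then have "y \<le> 1" using le1 p unfolding n_Suc[symmetric] B_def h_def by auto
    moreover have "\<exists>j<k. n (Suc j) = n i"
    proof (cases i)
      case 0 then show ?thesis using n_k k_ge by (intro exI[of _ "k - 1"]) auto
    next
      case (Suc j) then show ?thesis using i by (intro exI[of _ j]) auto
    qed
    then obtain j where j: "j < k" "n (Suc j) = n i" by blast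
    then have "n i * cis (- (2*\<theta>)) = n j" unfolding j(2)[symmetric] n_Suc by (simp add: mult.assoc cis_mult)
    then have "- y \<le> 1" using le2 p j unfolding B_def h_def by auto
    ultimately show ?thesis by linarith
  qed
  then show "0 \<le> x i p" "x i p \<le> 2" by (auto simp: y_def)
  have "p = (1 - (y + 1) / 2) *\<^sub>R b i + ((y + 1) / 2) *\<^sub>R b (Suc i)"
  proof (rule coords_inject[of i])
  qed (unfold affine_segment, simp_all add: coords_b 0 y_def)
  then show "p \<in> closed_segment (b i) (b (Suc i))" unfolding in_segment using side by (intro exI[of _ "(y + 1) / 2"]) auto
qed

section \<open>The polygon as a convex body\<close>

lemma closed_B: "closed B"
proof -
  have "closed (\<Inter>i\<in>{..<k}. {p. 0 \<le> h i p})"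
    by (intro closed_INT ballI closed_Collect_le continuous_coords continuous_intros)
  moreover have "B = (\<Inter>i\<in>{..<k}. {p. 0 \<le> h i p})" by (auto simp: B_def)
  ultimately show ?thesis by simp
qed

lemma convex_B: "convex B"
  unfolding convex_alt B_def by (auto simp: affine_segment)

text \<open>Some normal makes an angle of at most \<open>\<theta>\<close> with \<open>p\<close>, so
  the constraint of that side alone bounds the norm. The corners attain the bound: it gives
  compactness here and extremality of the vertices of the prism later.\<close>

lemma norm_B: assumes "p \<in> B" shows "cmod p \<le> 1 / sin \<theta>"
proof -
  define t where "t = Arg2pi p"
  have t: "0 \<le> t" "t < 2 * pi" "p = cmod p * cis t"
    unfolding t_def using Arg2pi_ge_0[of p] Arg2pi_lt_2pi[of p] Arg2pi_eq[of p] by (simp_all add: cis_conv_exp)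
  define i where "i = nat \<lfloor>t / (2 * \<theta>)\<rfloor>"
  have i: "real i \<le> t / (2 * \<theta>)" "t / (2 * \<theta>) < real i + 1"
    using t theta_bounds by (auto simp: i_def)
  have "real i * (2 * \<theta>) \<le> t" "t < (real i + 1) * (2 * \<theta>)" using i theta_bounds by (auto simp: field_simps)
  then have it: "2 * real i * \<theta> \<le> t" "t \<le> 2 * real i * \<theta> + 2 * \<theta>" by (auto simp: algebra_simps)
  have "i < k"
    using it(1) t(2) k_theta[of i] by simp
  then have "0 \<le> h i p" using assms by (auto simp: B_def)
  moreover have "p * cnj (n i) = cmod p * cis (t - (2 * real i + 1) * \<theta>)"
    by (subst t(3)) (simp add: n_def cis_cnj cis_mult mult.assoc)
  ultimately have "cmod p * cos (t - (2 * real i + 1) * \<theta>) \<le> A" by (simp add: h_def)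
  moreover have "cos \<theta> \<le> cos (t - (2 * real i + 1) * \<theta>)"
  proof -
    have "\<bar>t - (2 * real i + 1) * \<theta>\<bar> \<le> \<theta>" using it by (auto simp: abs_le_iff algebra_simps)
    then have "cos \<theta> \<le> cos \<bar>t - (2 * real i + 1) * \<theta>\<bar>" using theta_bounds by (intro cos_monotone_0_pi_le) auto
    then show ?thesis by simp
  qed
  then have "cmod p * cos \<theta> \<le> cmod p * cos (t - (2 * real i + 1) * \<theta>)" by (intro mult_left_mono) auto
  ultimately have "cmod p * cos \<theta> \<le> 1 / sin \<theta> * cos \<theta>" by (simp add: A_def)
  moreover have "0 < cos \<theta>" using sin_cos by simp
  ultimately show ?thesis by (rule mult_right_le_imp_le)
qed

lemma compact_B: "compact B"
  using closed_B norm_B by (auto simp: compact_eq_bounded_closed bounded_iff)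

lemma interior_B: "interior B = {p. \<forall>i<k. 0 < h i p}"
proof
  have "open (\<Inter>i\<in>{..<k}. {p. 0 < h i p})"
    by (intro open_INT ballI open_Collect_less continuous_coords continuous_intros) auto
  moreover have "(\<Inter>i\<in>{..<k}. {p. 0 < h i p}) = {p. \<forall>i<k. 0 < h i p}" by auto
  ultimately have "open {p. \<forall>i<k. 0 < h i p}" by simp
  then show "{p. \<forall>i<k. 0 < h i p} \<subseteq> interior B" by (rule interior_maximal[rotated]) (auto simp: B_def less_imp_le)
  show "interior B \<subseteq> {p. \<forall>i<k. 0 < h i p}"
  proof clarify
    fix p i assume p: "p \<in> interior B" and i: "i < k"
    obtain e where e: "e > 0" "cball p e \<subseteq> B" using p mem_interior_cball by blast
    have "p + e *\<^sub>R n i \<in> cball p e" using e by (simp add: dist_norm n_def)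
    then have "0 \<le> h i (p + e *\<^sub>R n i)" using e i by (auto simp: B_def)
    moreover have "h i (p + e *\<^sub>R n i) = h i p - e"
      using n_norm[of i] by (simp add: h_def ring_distribs)
    ultimately show "0 < h i p" using e by simp
  qed
qed

lemma frontier_B: "frontier B = {p \<in> B. \<exists>i<k. h i p = 0}"
proof -
  have "frontier B = B - {p. \<forall>i<k. 0 < h i p}"
    using closed_B by (simp add: frontier_def interior_B)
  also have "\<dots> = {p \<in> B. \<exists>i<k. h i p = 0}"
    unfolding B_def by (force simp: less_le)
  finally show ?thesis .
qed

text \<open>The polygon is the hull of its frontier, and the frontier consists of sides, each
  spanned by two corners.\<close>

lemma B_hull: "B = convex hull (b ` {..<k})"
proof
  show "convex hull (b ` {..<k}) \<subseteq> B"
    using b_in_B by (intro hull_minimal convex_B) auto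
  have "frontier B \<subseteq> convex hull (b ` {..<k})"
  proof
    fix p assume "p \<in> frontier B"
    then obtain i where i: "i < k" "p \<in> B" "h i p = 0" by (auto simp: frontier_B)
    have "b (Suc i) \<in> b ` {..<k}" using i b_k k_ge by (cases "Suc i = k") auto
    then have "closed_segment (b i) (b (Suc i)) \<subseteq> convex hull (b ` {..<k})"
      using i by (intro closed_segment_subset convex_convex_hull hull_inc) auto
    then show "p \<in> convex hull (b ` {..<k})" using edge_segment[OF i(2,1,3)] by blast
  qed
  then have "convex hull (frontier B) \<subseteq> convex hull (b ` {..<k})"
    by (intro hull_minimal convex_convex_hull)
  moreover have "B = convex hull (frontier B)"
    by (rule Krein_Milman_frontier) (auto simp: convex_B compact_B)
  ultimately show "B \<subseteq> convex hull (b ` {..<k})" by simp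
qed

end

section \<open>The fan around the centre of the tree\<close>

locale ngon_tree = ngon +
  fixes c :: nat
  assumes c: "c < 2 ^ m"
begin

text \<open>The numerator \<open>c + 1\<close> moves \<open>ctr\<close> off the centre even for
  \<open>c = 0\<close>; the denominator limits the shift to 1/8. Distinct \<open>c\<close> give
  distinct \<open>t\<close>.\<close>

definition t :: real where "t = (real c + 1) / (8 * 2 ^ m)"
definition ctr :: complex where "ctr = - (t *\<^sub>R n (k - 1))"
text \<open>The branch of the tree ending at \<open>b i\<close> starts at distance ratio \<open>eps i\<close> from \<open>ctr\<close> on the branch to
  \<open>b (i - 1)\<close>. Bit \<open>j\<close> of \<open>c\<close> decides whether branch \<open>2 * j + 1\<close> is shifted in this way; since
  \<open>c < 2 ^ m\<close>, branch \<open>k\<close> (which is branch 0) never is.\<close>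

definition eps :: "nat \<Rightarrow> real" where "eps i = (if odd i \<and> bit c (i div 2) then 1 / 8 else 0)"
text \<open>Barycentric coordinates in a triangle of the fan; the remaining weight
  \<open>1 - v - w\<close> belongs to \<open>ctr\<close>.\<close>

definition tri :: "nat \<Rightarrow> real \<Rightarrow> real \<Rightarrow> complex" where
  "tri i v w = ctr + v *\<^sub>R (b i - ctr) + w *\<^sub>R (b (Suc i) - ctr)"

lemma t_bounds: "0 < t" "t \<le> 1 / 8"
proof -
  show "0 < t" by (simp add: t_def add_nonneg_pos)
  have "c + 1 \<le> 2 ^ m" using c by simp
  then have "real (c + 1) \<le> real (2 ^ m)" by (rule of_nat_mono)
  then have "real c + 1 \<le> 2 ^ m" by (simp add: add.commute)
  then show "t \<le> 1 / 8" by (simp add: t_def field_simps)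
qed

lemma eps_cases: "eps i = 0 \<or> eps i = 1 / 8" "0 \<le> eps i" "eps i < 1"
  by (auto simp: eps_def)

lemma eps_pos: assumes "eps i \<noteq> 0" shows "odd i" "eps (Suc i) = 0" "0 < i" "eps (i - 1) = 0" "eps i = 1 / 8"
  using assms by (auto simp: eps_def split: if_splits elim: oddE)

lemma eps_0: "eps 0 = 0" "eps k = 0"
proof -
  have "\<not> bit c m" using c by (simp add: bit_iff_odd)
  then show "eps k = 0" by (simp add: eps_def k_def)
qed (simp add: eps_def)

lemma eps_lt_k: "i \<le> k \<Longrightarrow> eps i \<noteq> 0 \<Longrightarrow> i < k"
  using eps_0 by (cases "i = k") auto

lemma coords_ctr: "h i ctr = A + t * Re (n (k - 1) * cnj (n i))" "x i ctr = 1 - t * Im (n (k - 1) * cnj (n i))"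
  by (simp_all add: h_def x_def ctr_def algebra_simps)

lemma Re_n: assumes "i < k - 1" shows "Re (n (k - 1) * cnj (n i)) < 1"
proof -
  have "n (k - 1) * cnj (n i) = cis (2 * real (k - 1 - i) * \<theta>)"
    using assms by (simp add: n_def cis_cnj cis_mult of_nat_diff algebra_simps)
  moreover have "cos (2 * real (k - 1 - i) * \<theta>) < cos \<theta>"
  proof (rule cos_between)
    have "1 * \<theta> < 2 * real (k - 1 - i) * \<theta>" using assms theta_bounds by (intro mult_strict_right_mono) auto
    then show "\<theta> < 2 * real (k - 1 - i) * \<theta>" by simp
    have "real (k - 1 - i) \<le> real k - 1" using k_ge by (simp add: of_nat_diff)
    then have "2 * real (k - 1 - i) * \<theta> < (2 * real k - 1) * \<theta>" using theta_bounds by (intro mult_strict_right_mono) auto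
    also have "\<dots> = 2 * pi - \<theta>" using theta_bounds(3) by (simp add: algebra_simps)
    finally show "2 * real (k - 1 - i) * \<theta> < 2 * pi - \<theta>" .
  qed
  ultimately show ?thesis using cos_le_one[of \<theta>] by (simp del: cos_le_one)
qed

lemma coords_ctr_bounds:
  "7 / 8 \<le> x i ctr" "x i ctr \<le> 9 / 8" "A - 1 / 8 \<le> h i ctr" "0 < h i ctr" "h i ctr \<le> A + t"
proof -
  define z where "z = n (k - 1) * cnj (n i)"
  have "cmod z = 1" by (simp add: z_def norm_mult n_def)
  then have "\<bar>Re z\<bar> \<le> 1" "\<bar>Im z\<bar> \<le> 1" using abs_Re_le_cmod[of z] abs_Im_le_cmod[of z] by auto
  then have "\<bar>t * Re z\<bar> \<le> t * 1" "\<bar>t * Im z\<bar> \<le> t * 1" using t_bounds by (auto simp: abs_mult intro!: mult_left_mono)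
  then show "7 / 8 \<le> x i ctr" "x i ctr \<le> 9 / 8" "A - 1 / 8 \<le> h i ctr" "0 < h i ctr" "h i ctr \<le> A + t"
    using t_bounds A_bounds unfolding coords_ctr z_def[symmetric] abs_le_iff by linarith+
qed

text \<open>Only the outer normal of the last side is opposite to the displacement of
  \<open>ctr\<close>, so every other side gains less than \<open>t\<close>. This strictness singles
  out the peak of the net.\<close>

lemma h_ctr_less: "i < k - 1 \<Longrightarrow> h i ctr < A + t"
  unfolding coords_ctr using Re_n[of i] t_bounds by simp

lemma coords_ctr_last: "h (k - 1) ctr = A + t" "x (k - 1) ctr = 1"
  unfolding coords_ctr n_norm by simp_all

lemma ctr_B: "ctr \<in> B" "ctr \<in> interior B"
proof -
  show "ctr \<in> interior B" using coords_ctr_bounds by (simp add: interior_B)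
  then show "ctr \<in> B" using interior_subset by blast
qed

text \<open>Consecutive sides have length 2 and turn by the exterior angle
  \<open>2 * \<theta>\<close>. The coordinates serve the flaps, which lie in the triangle over the
  preceding side but are unfolded along their own.\<close>

lemma coords_prev: "x (Suc i) (b i) = - 2 * cos (2 * \<theta>)" "h (Suc i) (b i) = 2 * sin (2 * \<theta>)"
proof -
  have n: "n i = n (Suc i) * cis (- (2 * \<theta>))" by (simp add: n_Suc mult.assoc cis_mult)
  have "b i = b (Suc i) - n i * (2 * \<i>)"
    unfolding b_Suc unfolding b_def by (simp add: complex_eq_iff algebra_simps)
  also have "\<dots> = n (Suc i) * (Complex A (- 1) - cis (- (2 * \<theta>)) * (2 * \<i>))"
    by (subst n) (simp add: b_def algebra_simps)
  also have "Complex A (- 1) - cis (- (2 * \<theta>)) * (2 * \<i>) = Complex (A - 2 * sin (2 * \<theta>)) (- 1 - 2 * cos (2 * \<theta>))"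
    by (simp add: complex_eq_iff)
  finally have "b i = n (Suc i) * Complex (A - 2 * sin (2 * \<theta>)) (- 1 - 2 * cos (2 * \<theta>))" .
  then show "x (Suc i) (b i) = - 2 * cos (2 * \<theta>)" "h (Suc i) (b i) = 2 * sin (2 * \<theta>)"
    using x_h_point by simp_all
qed

lemma tri_simps:
  "x i (tri i v w) = (1 - v - w) * x i ctr + 2 * w"
  "h i (tri i v w) = (1 - v - w) * h i ctr"
  "x (Suc i) (tri i v w) = (1 - v - w) * x (Suc i) ctr - v * (2 * cos (2 * \<theta>))"
  "h (Suc i) (tri i v w) = (1 - v - w) * h (Suc i) ctr + v * (2 * sin (2 * \<theta>))"
  by (simp_all add: tri_def affine_comb coords_b coords_prev)

lemma cone_cover:
  assumes "p \<in> B"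
  obtains i v w where "i < k" "0 \<le> v" "0 \<le> w" "v + w \<le> 1" "p = tri i v w"
proof (cases "p = ctr")
  case True
  have "0 < k" using k_ge by simp
  then show ?thesis using that[of 0 0 0] True by (simp add: tri_def)
next
  case False
  obtain d where d: "0 < d" "ctr + d *\<^sub>R (p - ctr) \<in> frontier B"
    by (rule ray_to_frontier[OF compact_imp_bounded[OF compact_B] ctr_B(2), of "p - ctr"]) (use False in auto)
  define q where "q = ctr + d *\<^sub>R (p - ctr)"
  obtain i where i: "i < k" "q \<in> B" "h i q = 0" using d unfolding frontier_B q_def by auto
  have "q = (1 - d) *\<^sub>R ctr + d *\<^sub>R p" by (simp add: q_def algebra_simps)
  \<comment> \<open>As \<open>h i\<close> is positive at \<open>ctr\<close> and nonnegative at
    \<open>p\<close>, it cannot vanish before \<open>p\<close> is reached, so the exit parameter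
    \<open>d\<close> is at least 1.\<close>
  then have "(1 - d) * h i ctr + d * h i p = 0" using i(3) affine_segment by metis
  moreover have "0 \<le> h i p" using assms i by (simp add: B_def)
  ultimately have "(1 - d) * h i ctr \<le> 0" using d by (smt (verit) mult_nonneg_nonneg)
  then have d1: "1 \<le> d" using coords_ctr_bounds(4)[of i] by (simp add: mult_le_0_iff)
  obtain u where u: "0 \<le> u" "u \<le> 1" "q = (1 - u) *\<^sub>R b i + u *\<^sub>R b (Suc i)"
    using edge_segment(1)[OF i(2,1,3)] by (auto simp: in_segment)
  have "q - ctr = (1 - u) *\<^sub>R (b i - ctr) + u *\<^sub>R (b (Suc i) - ctr)"
    using u(3) by (simp add: algebra_simps)
  moreover have "p = ctr + (1 / d) *\<^sub>R (q - ctr)" using d by (simp add: q_def)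
  ultimately have "p = tri i ((1 - u) / d) (u / d)"
    by (simp add: tri_def scaleR_add_right divide_inverse mult.commute)
  moreover have "(1 - u) / d + u / d \<le> 1" using d1 by (simp add: add_divide_distrib[symmetric])
  ultimately show ?thesis using that[of i "(1 - u) / d" "u / d"] u i d by auto
qed

lemma b_eq_iff:
  assumes "i < k" "j < k" "b i = b (Suc j)" shows "adj j i" "i \<noteq> j"
proof -
  show "adj j i" using h_b_zero_iff[OF assms(1,2)] assms(3) coords_b(4)[of j] by simp
  show "i \<noteq> j" using coords_b(1,3)[of j] assms(3) by auto
qed

text \<open>Central projection from the interior point \<open>ctr\<close> to the boundary is well defined, so
  two triangles of the fan around \<open>ctr\<close> can only share a spoke.\<close>

lemma cone_unique:
  assumes i: "i < k" and j: "j < k" and eq: "tri i v w = tri j v' w'"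
    and nonneg: "0 \<le> v" "0 \<le> w" "0 \<le> v'" "0 \<le> w'"
  shows "(v = 0 \<and> w = 0 \<and> v' = 0 \<and> w' = 0) \<or> (i = j \<and> v = v' \<and> w = w') \<or>
    (i \<noteq> j \<and> w = 0 \<and> v' = 0 \<and> v = w' \<and> b i = b (Suc j)) \<or>
    (i \<noteq> j \<and> v = 0 \<and> w' = 0 \<and> w = v' \<and> b (Suc i) = b j)"
proof -
  have pt: "\<exists>q\<in>B. h l q = 0 \<and> tri l v w = ctr + (v + w) *\<^sub>R (q - ctr) \<and> q = (v / (v+w)) *\<^sub>R b l + (w / (v+w)) *\<^sub>R b (Suc l)"
    if l: "l < k" and vw: "0 \<le> v" "0 \<le> w" "v + w > 0" for l v w
  proof -
    define u where "u = w / (v + w)"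
    have u: "0 \<le> u" "u \<le> 1" "1 - u = v / (v + w)" using vw by (auto simp: u_def field_simps)
    define q where "q = (1 - u) *\<^sub>R b l + u *\<^sub>R b (Suc l)"
    have "b l \<in> B" "b (Suc l) \<in> B" using b_in_B l by auto
    then have "q \<in> B" using convex_B u(1,2) unfolding q_def convex_alt by blast
    moreover have "h l q = 0" by (simp add: q_def affine_segment coords_b)
    moreover have "(v + w) * (1 - u) = v" "(v + w) * u = w" using vw by (simp_all add: u_def field_simps)
    then have "(v + w) *\<^sub>R q = v *\<^sub>R b l + w *\<^sub>R b (Suc l)"
      unfolding q_def scaleR_add_right scaleR_scaleR by simp
    then have "tri l v w = ctr + (v + w) *\<^sub>R (q - ctr)"
      by (simp add: tri_def algebra_simps)
    ultimately show ?thesis using u by (auto simp: q_def u_def)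
  qed
  \<comment> \<open>Otherwise \<open>q'\<close> would be a proper convex combination of
    \<open>ctr\<close> and a point of \<open>B\<close>, where \<open>h l\<close> is positive.
    Applied in both directions, this makes the two radii equal.\<close>
  have radius_le: "s' \<le> s" if q: "q \<in> B" "l < k" "h l q' = 0" and s: "0 < s" "0 < s'"
    and e: "ctr + s *\<^sub>R (q - ctr) = ctr + s' *\<^sub>R (q' - ctr)" for q q' l s s'
  proof (rule ccontr)
    assume "\<not> s' \<le> s"
    then have lt: "s < s'" by simp
    have "q' = (1 / s') *\<^sub>R (s' *\<^sub>R (q' - ctr)) + ctr" using s by simp
    also have "s' *\<^sub>R (q' - ctr) = s *\<^sub>R (q - ctr)" using e by simp
    also have "(1 / s') *\<^sub>R (s *\<^sub>R (q - ctr)) + ctr = (1 - s / s') *\<^sub>R ctr + (s / s') *\<^sub>R q"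
      by (simp add: algebra_simps)
    finally have "h l q' = (1 - s / s') * h l ctr + (s / s') * h l q" by (metis affine_segment(1))
    moreover have "0 < (1 - s / s') * h l ctr" using lt s coords_ctr_bounds(4) by simp
    moreover have "0 \<le> (s / s') * h l q" using q s by (auto simp: B_def)
    ultimately show False using q by simp
  qed
  show ?thesis
  proof (cases "v + w = 0 \<or> v' + w' = 0")
    case True
    have ctr: "v = 0 \<and> w = 0" if prems: "l < k" "0 \<le> v" "0 \<le> w" "tri l v w = ctr" for l v w
    proof (rule ccontr)
      assume "\<not> (v = 0 \<and> w = 0)"
      then have "v + w > 0" using that by auto
      then obtain q where "h l q = 0" "tri l v w = ctr + (v + w) *\<^sub>R (q - ctr)"
        using pt[OF prems(1-3)] by blast
      with \<open>v + w > 0\<close> that have "q = ctr" by simp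
      then show False using \<open>h l q = 0\<close> coords_ctr_bounds(4)[of l] by simp
    qed
    have "tri i v w = ctr"
    proof (cases "v + w = 0")
      case True then show ?thesis using nonneg by (simp add: tri_def add_nonneg_eq_0_iff)
    next
      case False
      then have "v' = 0" "w' = 0" using True nonneg by auto
      then show ?thesis using eq by (simp add: tri_def)
    qed
    then show ?thesis using ctr[of i v w] ctr[of j v' w'] eq i j nonneg by auto
  next
    case False
    then have pos: "0 < v + w" "0 < v' + w'" using nonneg by auto
    define s where "s = v + w"
    obtain q where q: "q \<in> B" "h i q = 0" "tri i v w = ctr + s *\<^sub>R (q - ctr)"
      "q = (v / s) *\<^sub>R b i + (w / s) *\<^sub>R b (Suc i)" using pt[of i v w] i nonneg pos by (auto simp: s_def)
    obtain q' where q': "q' \<in> B" "h j q' = 0" "tri j v' w' = ctr + (v' + w') *\<^sub>R (q' - ctr)"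
      "q' = (v' / (v' + w')) *\<^sub>R b j + (w' / (v' + w')) *\<^sub>R b (Suc j)" using pt[OF j nonneg(3,4) pos(2)] by blast
    have ss: "v' + w' = s"
      using radius_le[of q i q' s "v' + w'"] radius_le[of q j q' s "v' + w'"]
        radius_le[of q' i q "v' + w'" s] q q' eq i j pos by (simp add: s_def)
    then have qq: "q = q'" using q(3) q'(3) eq pos by (simp add: s_def)
    have s0: "0 < s" using pos by (simp add: s_def)
    have q'2: "q = (v' / s) *\<^sub>R b j + (w' / s) *\<^sub>R b (Suc j)" using q'(4) ss qq by simp
    have sums: "1 - w / s = v / s" "1 - w' / s = v' / s" using s0 ss by (auto simp: field_simps s_def)
    have xq: "x j q = 2 * (w' / s)" "x i q = 2 * (w / s)"
      using affine_segment(2)[of j "w' / s" "b j" "b (Suc j)"] affine_segment(2)[of i "w / s" "b i" "b (Suc i)"]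
      unfolding q'2[symmetric] sums q(4)[symmetric] coords_b by auto
    show ?thesis
    proof (cases "i = j")
      case True
      then have "w = w'" using xq s0 by simp
      then show ?thesis using True ss by (auto simp: s_def)
    next
      case False
      \<comment> \<open>The corner index is reduced below \<open>k\<close>, the range in which
        \<open>h_b_zero_iff\<close> decides incidence.\<close>
      define i1 where "i1 = (if Suc i = k then 0 else Suc i)"
      have i1: "i1 < k" "b (Suc i) = b i1" using i k_ge b_k by (auto simp: i1_def)
      have "h j q = (v / s) * h j (b i) + (w / s) * h j (b i1)"
        using affine_segment(1)[of j "w / s" "b i" "b (Suc i)"] unfolding sums q(4)[symmetric] by (simp add: i1(2))
      moreover have "0 \<le> (v / s) * h j (b i)" "0 \<le> (w / s) * h j (b i1)"
        using h_b_nonneg i i1 j nonneg s0 by simp_all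
      moreover have "h j q = 0" using qq q' by simp
      ultimately have "(v / s) * h j (b i) = 0" "(w / s) * h j (b i1) = 0" by linarith+
      then have adj: "v = 0 \<or> adj j i" "w = 0 \<or> adj j i1"
        using h_b_zero_iff i i1 j s0 by auto
      have "v = 0 \<or> w = 0"
        using adj False i j k_ge by (auto simp: adj_def i1_def split: if_splits)
      then show ?thesis
      proof
        assume v: "v = 0"
        then have "w = s" by (simp add: s_def)
        then have "adj j i1" using adj s0 by simp
        then have "i1 = j" using False i j k_ge by (auto simp: adj_def i1_def split: if_splits)
        then have "b (Suc i) = b j" using i1(2) by simp
        moreover have "q = b (Suc i)" using q(4) v \<open>w = s\<close> s0 by simp
        ultimately have "w' = 0" using xq(1) coords_b(1)[of j] s0 by simp
        then show ?thesis using False v \<open>b (Suc i) = b j\<close> ss by (auto simp: s_def)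
      next
        assume w: "w = 0"
        then have "v = s" by (simp add: s_def)
        then have "adj j i" using adj s0 by simp
        then have "b i = b (Suc j)" using False i j k_ge b_k by (auto simp: adj_def)
        moreover have "q = b i" using q(4) w \<open>v = s\<close> s0 by simp
        ultimately have "w' = s" using xq(1) coords_b(3)[of j] s0 by (simp add: field_simps)
        then show ?thesis using False w \<open>b i = b (Suc j)\<close> ss by (auto simp: s_def)
      qed
    qed
  qed
qed

end

section \<open>The pieces of the base\<close>

context ngon_tree begin

text \<open>The line \<open>v = eps (Suc i) * (1 - w)\<close> carries the branch to
  \<open>b (Suc i)\<close>. If that branch is shifted, the sliver behind it becomes the flap of side
  \<open>Suc i\<close>, to which it stays attached because the segment from \<open>ctr\<close> to
  \<open>b (Suc i)\<close> is then not cut.\<close>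

definition cell :: "nat \<Rightarrow> complex set" where
  "cell i = {tri i v w |v w. 0 \<le> v \<and> 0 \<le> w \<and> v + w \<le> 1 \<and> eps (Suc i) * (1 - w) \<le> v}"
definition flap :: "nat \<Rightarrow> complex set" where
  "flap i = {tri (i - 1) v w |v w. eps i \<noteq> 0 \<and> 0 \<le> v \<and> 0 \<le> w \<and> w \<le> 1 \<and> v \<le> eps i * (1 - w)}"
definition piece :: "nat \<Rightarrow> complex set" where "piece i = cell i \<union> flap i"
text \<open>The index is that of the fan triangle containing the branch; the branch ends at
  \<open>b (Suc i)\<close>.\<close>

definition hair :: "nat \<Rightarrow> complex set" where
  "hair i = {tri i (eps (Suc i) * (1 - w)) w |w. 0 \<le> w \<and> w \<le> 1}"
definition tau :: "complex set" where "tau = (\<Union>i<k. hair i)"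

text \<open>In the coordinates \<open>x i\<close>, \<open>h i\<close>, the boundary of \<open>piece i\<close> opposite to its side is the chain through
  \<open>(0, 0)\<close>, \<open>(XP i, HP i)\<close>, \<open>(XS i, HS i)\<close>, \<open>(2, 0)\<close>; if \<open>eps i = 0\<close> the second point is a redundant midpoint.
  \<open>C1\<close>, \<open>C2\<close>, \<open>C3\<close> are nonpositive below the lines carrying the three segments.\<close>

definition XS where "XS i = (1 - eps (Suc i)) * x i ctr"
definition HS where "HS i = (1 - eps (Suc i)) * h i ctr"
definition XP where "XP i = (if eps i = 0 then XS i / 2 else (1 - eps i) * x i ctr - eps i * (2 * cos (2 * \<theta>)))"
definition HP where "HP i = (if eps i = 0 then HS i / 2 else (1 - eps i) * h i ctr + eps i * (2 * sin (2 * \<theta>)))"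
definition C1 where "C1 i p = h i p * XP i - HP i * x i p"
definition C2 where "C2 i p = (h i p - HS i) * (XS i - XP i) - (HS i - HP i) * (x i p - XS i)"
definition C3 where "C3 i p = h i p * (2 - XS i) - HS i * (2 - x i p)"
text \<open>In the frame of side \<open>i\<close>, \<open>D i\<close> is twice the area of the
  triangle spanned by \<open>ctr\<close>, \<open>b i\<close> and the preceding corner, and
  \<open>K i\<close> is the same for \<open>ctr\<close>, \<open>b (Suc i)\<close> and the preceding
  corner, with sign.\<close>

definition D where "D i = x i ctr * (2 * sin (2 * \<theta>)) + h i ctr * (2 * cos (2 * \<theta>))"
definition K where "K i = 2 * h i ctr - 2 * sin (2 * \<theta>) * (2 - x i ctr) + 2 * cos (2 * \<theta>) * h i ctr"

lemma D_pos: "0 < D i"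
  unfolding D_def using coords_ctr_bounds[of i] sin_cos by (intro add_pos_pos mult_pos_pos) auto

text \<open>Geometrically, \<open>ctr\<close> lies on the inner side of the diagonal joining the two
  neighbours of \<open>b i\<close>. This makes the chain concave at \<open>XS i\<close>.\<close>

lemma K_pos: "0 < K i"
proof -
  have "2 * sin (2 * \<theta>) * (2 - x i ctr) \<le> A * (9 / 8)"
    using coords_ctr_bounds[of i] sin_cos A_bounds by (intro mult_mono) auto
  moreover have "A * (9 / 8) < 2 * h i ctr" using coords_ctr_bounds[of i] A_bounds by simp
  moreover have "0 < 2 * cos (2 * \<theta>) * h i ctr" using coords_ctr_bounds[of i] sin_cos by simp
  ultimately show ?thesis unfolding K_def by linarith
qed

text \<open>Of \<open>eps i\<close> and \<open>eps (Suc i)\<close> at most one is nonzero, so each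
  break results from one small shift, and the margins of 1/8 leave enough room.\<close>

lemma breaks: "0 < XP i" "XP i < XS i" "XS i < 2" "0 < HP i" "0 < HS i"
proof -
  have e: "1 - eps (Suc i) \<ge> 7 / 8" "1 - eps (Suc i) \<le> 1" using eps_cases[of "Suc i"] by auto
  have "7 / 8 * (7 / 8) \<le> XS i" unfolding XS_def using e coords_ctr_bounds[of i] by (intro mult_mono) auto
  moreover have "XS i \<le> 1 * (9 / 8)" unfolding XS_def using e coords_ctr_bounds[of i] by (intro mult_mono) auto
  ultimately have XS: "0 < XS i" "XS i < 2" by auto
  show "XS i < 2" by fact
  show HS: "0 < HS i" unfolding HS_def using e coords_ctr_bounds[of i] by simp
  have "0 < XP i \<and> XP i < XS i \<and> 0 < HP i"
  proof (cases "eps i = 0")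
    case True then show ?thesis using XS HS by (simp add: XP_def HP_def)
  next
    case False
    then have ee: "eps i = 1 / 8" "eps (Suc i) = 0" using eps_pos by auto
    have "XP i = 7 / 8 * x i ctr - cos (2 * \<theta>) / 4" "HP i = 7 / 8 * h i ctr + sin (2 * \<theta>) / 4" "XS i = x i ctr"
      by (simp_all add: XP_def HP_def XS_def ee)
    then show ?thesis using coords_ctr_bounds[of i] sin_cos cos_le_one[of "2 * \<theta>"] by linarith
  qed
  then show "0 < XP i" "XP i < XS i" "0 < HP i" by auto
qed

text \<open>In barycentric coordinates the line functions have coefficients of known sign, so their
  signs can be read off from the inequalities for \<open>v\<close> and \<open>w\<close>.\<close>

lemma C_cell:
  "C3 i (tri i v w) = 2 * h i ctr * (eps (Suc i) * (1 - w) - v)"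
  "eps i = 0 \<Longrightarrow> C1 i (tri i v w) = - ((1 - eps (Suc i)) * h i ctr * w)"
  "eps i = 0 \<Longrightarrow> C2 i (tri i v w) = - ((1 - eps (Suc i)) * h i ctr * w)"
  "eps i \<noteq> 0 \<Longrightarrow> C1 i (tri i v w) = - ((1 - v - w) * eps i * D i + 2 * w * HP i)"
  "eps i \<noteq> 0 \<Longrightarrow> C2 i (tri i v w) = - (eps i * (v * D i + w * K i))"
proof -
  show "C3 i (tri i v w) = 2 * h i ctr * (eps (Suc i) * (1 - w) - v)"
    unfolding C3_def tri_simps XS_def HS_def by algebra
  show "C1 i (tri i v w) = - ((1 - eps (Suc i)) * h i ctr * w)" if "eps i = 0"
    unfolding C1_def tri_simps XP_def HP_def XS_def HS_def using that by (simp add: field_simps)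
  show "C2 i (tri i v w) = - ((1 - eps (Suc i)) * h i ctr * w)" if "eps i = 0"
    unfolding C2_def tri_simps XP_def HP_def XS_def HS_def using that by (simp add: field_simps)
  assume e: "eps i \<noteq> 0"
  then have e': "eps (Suc i) = 0" using eps_pos by simp
  show "C1 i (tri i v w) = - ((1 - v - w) * eps i * D i + 2 * w * HP i)"
    unfolding C1_def tri_simps XP_def HP_def D_def using e by (simp add: algebra_simps)
  show "C2 i (tri i v w) = - (eps i * (v * D i + w * K i))"
    unfolding C2_def tri_simps XP_def HP_def XS_def HS_def D_def K_def using e e' by (simp add: algebra_simps)
qed

text \<open>The coordinates are those of the triangle over side \<open>i\<close>, but the line
  functions are those of side \<open>Suc i\<close>, along which the flap is unfolded.\<close>

lemma C_flap:
  assumes e: "eps (Suc i) \<noteq> 0"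
  shows "C1 (Suc i) (tri i v w) = D (Suc i) * (v - eps (Suc i) * (1 - w))"
    "C2 (Suc i) (tri i v w) = - (eps (Suc i) * w * D (Suc i))"
    "C3 (Suc i) (tri i v w) = - (2 * h (Suc i) ctr * w + v * K (Suc i))"
proof -
  have e': "eps (Suc (Suc i)) = 0" using e eps_pos by simp
  show "C1 (Suc i) (tri i v w) = D (Suc i) * (v - eps (Suc i) * (1 - w))"
    unfolding C1_def tri_simps XP_def HP_def D_def using e by (simp add: algebra_simps)
  show "C2 (Suc i) (tri i v w) = - (eps (Suc i) * w * D (Suc i))"
    unfolding C2_def tri_simps XP_def HP_def XS_def HS_def D_def using e e' by (simp add: algebra_simps)
  show "C3 (Suc i) (tri i v w) = - (2 * h (Suc i) ctr * w + v * K (Suc i))"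
    unfolding C3_def tri_simps XS_def HS_def K_def using e e' by (simp add: algebra_simps)
qed

text \<open>Cell and flap together form a convex polygon, so a union of two triangles is captured by
  a conjunction of linear constraints.\<close>

lemma piece_coords:
  "p \<in> piece i \<longleftrightarrow> 0 \<le> x i p \<and> x i p \<le> 2 \<and> 0 \<le> h i p \<and> C1 i p \<le> 0 \<and> C2 i p \<le> 0 \<and> C3 i p \<le> 0"
    (is "_ \<longleftrightarrow> ?R")
proof
  have o: "0 < x i ctr" "x i ctr < 2" "0 < h i ctr" using coords_ctr_bounds[of i] by auto
  have e: "0 \<le> eps (Suc i)" "eps (Suc i) < 1" by (rule eps_cases)+
  assume "p \<in> piece i"
  then consider "p \<in> cell i" | "p \<in> flap i" by (auto simp: piece_def)
  then show ?R
  proof cases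
    case 1
    then obtain v w where vw: "p = tri i v w" "0 \<le> v" "0 \<le> w" "v + w \<le> 1" "eps (Suc i) * (1 - w) \<le> v"
      by (auto simp: cell_def)
    have y: "0 \<le> 1 - v - w" using vw by simp
    have "0 \<le> (1 - v - w) * x i ctr" "(1 - v - w) * x i ctr \<le> (1 - v - w) * 2" "0 \<le> (1 - v - w) * h i ctr"
      using y o by (simp_all only: mult_left_mono mult_nonneg_nonneg less_imp_le)
    moreover have "x i p = (1 - v - w) * x i ctr + 2 * w" "h i p = (1 - v - w) * h i ctr"
      unfolding vw(1) by (simp_all add: tri_simps)
    ultimately have "0 \<le> x i p" "x i p \<le> 2" "0 \<le> h i p" using vw(2,3) by (simp_all add: algebra_simps)
    moreover have "C3 i p \<le> 0" unfolding vw(1) C_cell using vw o by (simp add: mult_le_0_iff)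
    moreover have "C1 i p \<le> 0 \<and> C2 i p \<le> 0"
    proof (cases "eps i = 0")
      case True
      then show ?thesis unfolding vw(1) C_cell(2,3)[OF True] using o e vw by simp
    next
      case False
      have "0 \<le> (1 - v - w) * eps i * D i" "0 \<le> 2 * w * HP i" "0 \<le> eps i * (v * D i + w * K i)"
        using vw D_pos[of i] K_pos[of i] breaks(4)[of i] eps_cases(2)[of i] by auto
      then show ?thesis unfolding vw(1) C_cell(4,5)[OF False] by linarith
    qed
    ultimately show ?R by blast
  next
    case 2
    then obtain v w where vw: "p = tri (i - 1) v w" "0 \<le> v" "0 \<le> w" "w \<le> 1" "v \<le> eps i * (1 - w)" and ei: "eps i \<noteq> 0"
      by (auto simp: flap_def)
    obtain j where j: "i = Suc j" using eps_pos(3)[OF ei] by (cases i) auto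
    have ej: "eps (Suc j) \<noteq> 0" using ei j by simp
    have p: "p = tri j v w" using vw j by simp
    have v1: "v \<le> 1 - w" using vw eps_cases[of i] by (smt (verit) mult_left_le_one_le)
    have "0 \<le> (1 - v - w) * h i ctr" "0 \<le> v * (2 * sin (2 * \<theta>))" using v1 vw o sin_cos by auto
    then have h0: "0 \<le> h i p" using tri_simps(4)[of j v w] unfolding p j by simp
    have C: "C1 i p \<le> 0" "C2 i p \<le> 0" "C3 i p \<le> 0"
    proof -
      show "C1 i p \<le> 0" unfolding p j C_flap[OF ej] using vw j D_pos[of "Suc j"] by (simp add: mult_le_0_iff)
      show "C2 i p \<le> 0" unfolding p j C_flap[OF ej] using vw eps_cases(2)[of "Suc j"] D_pos[of "Suc j"] by simp
      have "0 \<le> 2 * h (Suc j) ctr * w" "0 \<le> v * K (Suc j)" using vw o j K_pos[of "Suc j"] by auto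
      then show "C3 i p \<le> 0" unfolding p j C_flap[OF ej] by linarith
    qed
    have "HP i * x i p \<ge> h i p * XP i" using C(1) by (simp add: C1_def)
    moreover have "h i p * XP i \<ge> 0" using h0 breaks(1)[of i] by simp
    ultimately have "0 \<le> HP i * x i p" by linarith
    then have "0 \<le> x i p" using breaks(4)[of i] by (simp add: zero_le_mult_iff)
    moreover have "x i p \<le> 2"
    proof -
      have "(1 - v - w) * x i ctr \<le> 1 * 2" using v1 vw o by (intro mult_mono) auto
      moreover have "0 \<le> v * (2 * cos (2 * \<theta>))" using vw sin_cos by simp
      ultimately show ?thesis using tri_simps(3)[of j v w] unfolding p j by simp
    qed
    ultimately show ?R using h0 C by blast
  qed
next
  have o: "0 < x i ctr" "x i ctr < 2" "0 < h i ctr" using coords_ctr_bounds[of i] by auto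
  assume R: ?R
  \<comment> \<open>Since \<open>h i\<close> vanishes on the side, \<open>y\<close> is the weight of
    \<open>ctr\<close>; the abscissa then determines the weight \<open>w\<close> of the corner at
    position 2.\<close>
  define y where "y = h i p / h i ctr"
  define w where "w = (x i p - y * x i ctr) / 2"
  define v where "v = 1 - y - w"
  have p: "p = tri i v w"
  proof (rule coords_inject[of i])
    have yv: "1 - v - w = y" by (simp add: v_def)
    show "x i p = x i (tri i v w)" unfolding tri_simps yv by (simp add: w_def field_simps)
    show "h i p = h i (tri i v w)" unfolding tri_simps yv using o by (simp add: y_def)
  qed
  have y: "0 \<le> y" using R o by (simp add: y_def)
  have "2 * h i ctr * (eps (Suc i) * (1 - w) - v) \<le> 0" using R C_cell(1)[of i v w] p by simp
  then have v1: "eps (Suc i) * (1 - w) \<le> v" using o by (simp add: mult_le_0_iff)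
  have "0 \<le> (1 - eps (Suc i)) * (1 - w)" using v1 y unfolding v_def by (simp add: algebra_simps)
  then have w1: "w \<le> 1" using eps_cases(3)[of "Suc i"] by (simp add: zero_le_mult_iff)
  then have "0 \<le> eps (Suc i) * (1 - w)" using eps_cases(2)[of "Suc i"] by simp
  then have v0: "0 \<le> v" using v1 by simp
  show "p \<in> piece i"
  proof (cases "0 \<le> w")
    case True
    then have "p \<in> cell i" unfolding cell_def using p v0 v1 y v_def by fastforce
    then show ?thesis by (simp add: piece_def)
  next
    case False
    have ei: "eps i \<noteq> 0"
    proof
      assume e0: "eps i = 0"
      have "- ((1 - eps (Suc i)) * h i ctr * w) \<le> 0" using R C_cell(2)[OF e0, of v w] p by simp
      moreover have "0 < (1 - eps (Suc i)) * h i ctr" using o eps_cases(3)[of "Suc i"] by simp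
      ultimately have "0 \<le> w" using mult_pos_neg[of _ w] by fastforce
      then show False using False by simp
    qed
    obtain j where j: "i = Suc j" using eps_pos(3)[OF ei] by (cases i) auto
    have ej: "eps (Suc j) \<noteq> 0" using ei j by simp
    \<comment> \<open>A negative \<open>w\<close> puts \<open>p\<close> beyond the line through
      \<open>b i\<close> and \<open>ctr\<close>, in the preceding triangle. Its weights there come
      from Cramer's rule with determinant \<open>D i\<close>.\<close>
    define v' where "v' = (h i p * x i ctr - x i p * h i ctr) / D i"
    define y' where "y' = (x i p * (2 * sin (2 * \<theta>)) + h i p * (2 * cos (2 * \<theta>))) / D i"
    define w' where "w' = 1 - v' - y'"
    have "x i p < y * x i ctr" using False by (simp add: w_def)
    then have "x i p * h i ctr < h i p * x i ctr" using o by (simp add: y_def field_simps)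
    then have v': "0 \<le> v'" using D_pos[of i] by (simp add: v'_def)
    have y': "0 \<le> y'" using R D_pos[of i] sin_cos by (simp add: y'_def)
    have p': "p = tri j v' w'"
    proof (rule coords_inject[of i])
      have "y' * x i ctr - v' * (2 * cos (2 * \<theta>)) = x i p * D i / D i"
        unfolding y'_def v'_def times_divide_eq_left diff_divide_distrib[symmetric] D_def by (simp add: algebra_simps)
      then show "x i p = x i (tri j v' w')" using D_pos[of i] tri_simps(3)[of j v' w'] by (simp add: j w'_def)
      have "y' * h i ctr + v' * (2 * sin (2 * \<theta>)) = h i p * D i / D i"
        unfolding y'_def v'_def times_divide_eq_left add_divide_distrib[symmetric] D_def by (simp add: algebra_simps)
      then show "h i p = h i (tri j v' w')" using D_pos[of i] tri_simps(4)[of j v' w'] by (simp add: j w'_def)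
    qed
    have "D (Suc j) * (v' - eps (Suc j) * (1 - w')) \<le> 0" using R C_flap(1)[OF ej, of v' w'] p' j by simp
    then have "v' \<le> eps i * (1 - w')" using D_pos[of "Suc j"] j by (simp add: mult_le_0_iff)
    moreover have "0 \<le> eps (Suc j) * w' * D (Suc j)" using R C_flap(2)[OF ej, of v' w'] p' j by simp
    then have "0 \<le> w'" using D_pos[of "Suc j"] ej eps_cases(2)[of "Suc j"] by (simp add: zero_le_mult_iff)
    moreover have "w' \<le> 1" using v' y' by (simp add: w'_def)
    ultimately have "p \<in> flap i" unfolding flap_def using ei p' v' j by auto
    then show ?thesis by (simp add: piece_def)
  qed
qed

section \<open>The tree as the border between the pieces\<close>

lemma hair_in_tau: "i < k \<Longrightarrow> 0 \<le> w \<Longrightarrow> w \<le> 1 \<Longrightarrow> v = eps (Suc i) * (1 - w) \<Longrightarrow> tri i v w \<in> tau"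
  unfolding tau_def hair_def by blast

lemma ctr_in_tau: "ctr \<in> tau"
proof -
  have "tri (k - 1) 0 0 \<in> tau" using k_ge eps_0 by (intro hair_in_tau) auto
  then show ?thesis by (simp add: tri_def)
qed

lemma tri_0: "tri i 0 0 = ctr" by (simp add: tri_def)

lemma spoke_eq: "b i = b (Suc j) \<Longrightarrow> tri i v 0 = tri j 0 v"
  by (simp add: tri_def)

lemma b_prev: assumes "i < k" obtains j where "j < k" "b i = b (Suc j)" "eps i = eps (Suc j)" "i \<noteq> j"
proof (cases i)
  case 0
  have "b 0 = b (Suc (k - 1))" "eps 0 = eps (Suc (k - 1))" using b_k eps_0 k_ge by auto
  then show ?thesis using that[of "k - 1"] 0 k_ge by auto
next
  case (Suc j) then show ?thesis using that[of j] assms by auto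
qed

lemma spoke_in_tau: assumes "i < k" "eps i = 0" "0 \<le> v" "v \<le> 1" shows "tri i v 0 \<in> tau"
proof -
  obtain j where j: "j < k" "b i = b (Suc j)" "eps i = eps (Suc j)" using b_prev[OF assms(1)] by metis
  then have "tri j 0 v \<in> tau" using assms by (intro hair_in_tau) auto
  then show ?thesis using spoke_eq[OF j(2)] by simp
qed

lemma b_eps_eq: assumes "i < k" "j < k" "b i = b (Suc j)" shows "eps i = eps (Suc j)"
proof -
  obtain l where l: "l < k" "b i = b (Suc l)" "eps i = eps (Suc l)" using b_prev[OF assms(1)] by metis
  have "l = j"
  proof -
    have "adj l i" "adj j i" "i \<noteq> l" "i \<noteq> j" using b_eq_iff[OF assms(1) l(1,2)] b_eq_iff[OF assms] by auto
    then show ?thesis using k_ge assms l by (auto simp: adj_def)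
  qed
  then show ?thesis using l by simp
qed

lemma tau_b: "i \<le> k \<Longrightarrow> b i \<in> tau"
proof -
  assume i: "i \<le> k"
  have "\<exists>j<k. b i = b (Suc j)"
  proof (cases "i = k")
    case True then show ?thesis using k_ge by (intro exI[of _ "k - 1"]) auto
  next
    case False
    then have "i < k" using i by simp
    then obtain j where "j < k" "b i = b (Suc j)" by (rule b_prev)
    then show ?thesis by blast
  qed
  then obtain j where j: "j < k" "b i = b (Suc j)" by blast
  have "tri j 0 1 \<in> tau" using j by (intro hair_in_tau) auto
  then show ?thesis using j by (simp add: tri_def)
qed

text \<open>Distinct fan triangles share at most a spoke. There the weight of one corner vanishes,
  and the inequality defining the cell forces the point onto a branch. A cell and a flap in the same
  triangle meet along the shifted branch.\<close>

lemma tau_pieces_meet: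
  assumes i: "i < k" and p: "p \<in> piece i" and j: "j < k" and ij: "i \<noteq> j" and q: "p \<in> piece j"
  shows "p \<in> tau"
proof -
  have cells: "p \<in> tau" if prems: "i < k" "j < k" "i \<noteq> j" "p \<in> cell i" "p \<in> cell j" for i j
  proof -
    obtain v w where vw: "p = tri i v w" "0 \<le> v" "0 \<le> w" "v + w \<le> 1" "eps (Suc i) * (1 - w) \<le> v"
      using prems by (auto simp: cell_def)
    obtain v' w' where vw': "p = tri j v' w'" "0 \<le> v'" "0 \<le> w'" "v' + w' \<le> 1" "eps (Suc j) * (1 - w') \<le> v'"
      using prems by (auto simp: cell_def)
    have "v = 0 \<or> v' = 0" using cone_unique[OF prems(1,2), of v w v' w'] vw vw' prems(3) by auto
    then show ?thesis
    proof
      assume "v = 0"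
      moreover have "0 \<le> eps (Suc i) * (1 - w)" using vw eps_cases(2)[of "Suc i"] by simp
      ultimately show ?thesis using vw prems by (auto intro: hair_in_tau)
    next
      assume "v' = 0"
      moreover have "0 \<le> eps (Suc j) * (1 - w')" using vw' eps_cases(2)[of "Suc j"] by simp
      ultimately show ?thesis using vw' prems by (auto intro: hair_in_tau)
    qed
  qed
  have cell_flap: "p \<in> tau" if prems: "i < k" "j < k" "i \<noteq> j" "p \<in> cell i" "p \<in> flap j" for i j
  proof -
    obtain v w where vw: "p = tri i v w" "0 \<le> v" "0 \<le> w" "v + w \<le> 1" "eps (Suc i) * (1 - w) \<le> v"
      using prems by (auto simp: cell_def)
    obtain v' w' where vw': "p = tri (j - 1) v' w'" "0 \<le> v'" "0 \<le> w'" "w' \<le> 1" "v' \<le> eps j * (1 - w')" and ej: "eps j \<noteq> 0"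
      using prems by (auto simp: flap_def)
    obtain l where l: "j = Suc l" using eps_pos(3)[OF ej] by (cases j) auto
    have v0: "p \<in> tau" if "v = 0"
    proof -
      have "0 \<le> eps (Suc i) * (1 - w)" using vw eps_cases(2)[of "Suc i"] by simp
      then show ?thesis using vw that \<open>i < k\<close> by (auto intro: hair_in_tau)
    qed
    have "l < k" using l prems by simp
    from cone_unique[OF prems(1) this, of v w v' w'] vw vw' l
    consider "v = 0" | "i = l" "v = v'" "w = w'" | "b i = b (Suc l)" by auto
    then show ?thesis
    proof cases
      case 1 then show ?thesis by (rule v0)
    next
      case 2
      then have "v = eps (Suc i) * (1 - w)" using vw vw' l by simp
      then show ?thesis using vw 2 prems by (auto intro: hair_in_tau)
    next
      case 3
      then have "i = j" using b_inj prems l by auto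
      then show ?thesis using prems by simp
    qed
  qed
  have flaps: "p \<in> tau" if prems: "i < k" "j < k" "i \<noteq> j" "p \<in> flap i" "p \<in> flap j" for i j
  proof -
    obtain v w where vw: "p = tri (i - 1) v w" "0 \<le> v" "0 \<le> w" and ei: "eps i \<noteq> 0"
      using prems by (auto simp: flap_def)
    obtain v' w' where vw': "p = tri (j - 1) v' w'" "0 \<le> v'" "0 \<le> w'" and ej: "eps j \<noteq> 0"
      using prems by (auto simp: flap_def)
    obtain l where l: "i = Suc l" using eps_pos(3)[OF ei] by (cases i) auto
    obtain r where r: "j = Suc r" using eps_pos(3)[OF ej] by (cases j) auto
    have "l < k" "r < k" using l r prems by auto
    \<comment> \<open>A spoke shared by the two triangles would end at a corner that is shifted for
      one flap and, as predecessor of a shifted corner, unshifted for the other. Only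
      \<open>ctr\<close> remains.\<close>
    have no: "b l \<noteq> b (Suc r)" "b (Suc l) \<noteq> b r"
      using b_eps_eq[OF \<open>l < k\<close> \<open>r < k\<close>] b_eps_eq[OF \<open>r < k\<close> \<open>l < k\<close>] eps_pos(4)[OF ei] eps_pos(4)[OF ej] ei ej l r by auto
    have "v = 0 \<and> w = 0" using cone_unique[OF \<open>l < k\<close> \<open>r < k\<close>, of v w v' w'] vw vw' l r prems(3) no by auto
    then show ?thesis using vw ctr_in_tau tri_0 by simp
  qed
  show ?thesis using p q cells[OF i j ij] cells cell_flap[OF i j ij] cell_flap[OF j i ij[symmetric]] flaps[OF i j ij]
    unfolding piece_def by blast
qed

lemma pieces_cover: "p \<in> B \<Longrightarrow> \<exists>i<k. p \<in> piece i"
proof -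
  assume "p \<in> B"
  then obtain i v w where vw: "i < k" "0 \<le> v" "0 \<le> w" "v + w \<le> 1" "p = tri i v w" by (rule cone_cover)
  show ?thesis
  proof (cases "eps (Suc i) * (1 - w) \<le> v")
    case True
    then have "p \<in> cell i" using vw by (auto simp: cell_def)
    then show ?thesis using vw by (auto simp: piece_def)
  next
    case False
    have e: "eps (Suc i) \<noteq> 0" using False vw by (cases "eps (Suc i) = 0") auto
    then have "Suc i < k" using eps_lt_k[of "Suc i"] vw by simp
    moreover have "p \<in> flap (Suc i)" using False vw e unfolding flap_def by fastforce
    ultimately show ?thesis by (auto simp: piece_def)
  qed
qed

lemma tri_in_B: assumes "i < k" "0 \<le> v" "0 \<le> w" "v + w \<le> 1" shows "tri i v w \<in> B"
proof -
  have "b i \<in> B" "b (Suc i) \<in> B" using b_in_B assms by auto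
  then show ?thesis using ctr_B(1) assms unfolding B_def tri_def by (simp add: affine_comb)
qed

lemma piece_in_B: assumes "i < k" "p \<in> piece i" shows "p \<in> B"
  using assms(2) unfolding piece_def
proof
  assume "p \<in> cell i" then show ?thesis using tri_in_B assms by (auto simp: cell_def)
next
  assume "p \<in> flap i"
  then obtain v w where vw: "p = tri (i - 1) v w" "0 \<le> v" "0 \<le> w" "w \<le> 1" "v \<le> eps i * (1 - w)" and ei: "eps i \<noteq> 0"
    by (auto simp: flap_def)
  have "v \<le> 1 - w" using vw eps_cases[of i] by (smt (verit) mult_left_le_one_le)
  then show ?thesis unfolding vw(1) using vw assms by (intro tri_in_B) auto
qed

text \<open>Inside a piece the tree is just the chain opposite to the side. The spoke separating a
  cell from its flap is interior to the piece and contributes only its ends \<open>ctr\<close> and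
  \<open>b i\<close>.\<close>

lemma tau_iff:
  assumes i: "i < k" and p: "p \<in> piece i"
  shows "p \<in> tau \<longleftrightarrow> C1 i p = 0 \<or> C2 i p = 0 \<or> C3 i p = 0"
proof
  have o: "0 < h i ctr" using coords_ctr_bounds[of i] by auto
  assume "p \<in> tau"
  then obtain j u where j: "j < k" "0 \<le> u" "u \<le> 1" "p = tri j (eps (Suc j) * (1 - u)) u"
    by (auto simp: tau_def hair_def)
  have ju: "0 \<le> eps (Suc j) * (1 - u)" using j eps_cases(2)[of "Suc j"] by simp
  from p show "C1 i p = 0 \<or> C2 i p = 0 \<or> C3 i p = 0" unfolding piece_def
  proof
    assume "p \<in> cell i"
    then obtain v w where vw: "p = tri i v w" "0 \<le> v" "0 \<le> w" "v + w \<le> 1" "eps (Suc i) * (1 - w) \<le> v"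
      by (auto simp: cell_def)
    have le: "0 \<le> eps (Suc i) * (1 - w)" using vw eps_cases(2)[of "Suc i"] by simp
    have "tri i v w = tri j (eps (Suc j) * (1 - u)) u" using vw j by simp
    from cone_unique[OF i j(1) this vw(2,3) ju j(2)]
    consider "v = 0" | "v = eps (Suc i) * (1 - w)" 
      | "i \<noteq> j" "w = 0" "eps (Suc j) * (1 - u) = 0" "v = u" "b i = b (Suc j)" by auto
    then show ?thesis
    proof cases
      case 1
      then show ?thesis using vw le by (simp add: C_cell)
    next
      case 2 then show ?thesis using vw by (simp add: C_cell)
    next
      case 3
      show ?thesis
      proof (cases "eps i = 0")
        case True then show ?thesis unfolding vw(1) C_cell(2)[OF True] 3 by simp
      next
        case False
        then have "u = 1" using 3 b_eps_eq[OF i j(1)] by simp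
        then show ?thesis unfolding vw(1) C_cell(4)[OF False] 3 by simp
      qed
    qed
  next
    assume "p \<in> flap i"
    then obtain v w where vw: "p = tri (i - 1) v w" "0 \<le> v" "0 \<le> w" "w \<le> 1" "v \<le> eps i * (1 - w)" and ei: "eps i \<noteq> 0"
      by (auto simp: flap_def)
    obtain l where l: "i = Suc l" using eps_pos(3)[OF ei] by (cases i) auto
    have el: "eps (Suc l) \<noteq> 0" "l < k" using ei l i by auto
    have p: "p = tri l v w" using vw l by simp
    have "tri l v w = tri j (eps (Suc j) * (1 - u)) u" using p j by simp
    from cone_unique[OF el(2) j(1) this vw(2,3) ju j(2)]
    consider "w = 0" | "v = eps (Suc l) * (1 - w)" | "b (Suc l) = b j" "v = 0" "u = 0" "w = eps (Suc j) * (1 - u)" by auto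
    then show ?thesis
    proof cases
      case 1 then show ?thesis unfolding p l C_flap[OF el(1)] by simp
    next
      case 2 then show ?thesis unfolding p l C_flap[OF el(1)] by simp
    next
      case 3
      then have "i = j" using b_inj i j l by auto
      then have "w = 0" using 3 eps_pos(2)[OF ei] by simp
      then show ?thesis unfolding p l C_flap[OF el(1)] by simp
    qed
  qed
next
  have o: "0 < h i ctr" using coords_ctr_bounds[of i] by auto
  assume C: "C1 i p = 0 \<or> C2 i p = 0 \<or> C3 i p = 0"
  from p show "p \<in> tau" unfolding piece_def
  proof
    assume "p \<in> cell i"
    then obtain v w where vw: "p = tri i v w" "0 \<le> v" "0 \<le> w" "v + w \<le> 1" "eps (Suc i) * (1 - w) \<le> v"
      by (auto simp: cell_def)
    have C3: "p \<in> tau" if "C3 i p = 0"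
    proof -
      have "v = eps (Suc i) * (1 - w)" using that vw(1) o by (simp add: C_cell)
      then show ?thesis using vw i by (auto intro: hair_in_tau)
    qed
    show ?thesis
    proof (cases "eps i = 0")
      case True
      have "p \<in> tau" if "C3 i p \<noteq> 0"
      proof -
        have "w = 0" using that C o eps_cases(3)[of "Suc i"] unfolding vw(1) C_cell(2,3)[OF True] by auto
        then show ?thesis using vw True i spoke_in_tau by simp
      qed
      then show ?thesis using C3 by blast
    next
      case False
      then have e: "0 < eps i" using eps_cases(2)[of i] by simp
      have "p \<in> tau" if "C1 i p = 0"
      proof -
        have "0 \<le> (1 - v - w) * eps i * D i" "0 \<le> 2 * w * HP i" using vw e D_pos[of i] breaks(4)[of i] by auto
        then have "2 * w * HP i = 0" "(1 - v - w) * eps i * D i = 0"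
          using that unfolding vw(1) C_cell(4)[OF False] by linarith+
        then have "w = 0" "v = 1" using breaks(4)[of i] e D_pos[of i] by auto
        then have "p = b i" using vw by (simp add: tri_def)
        then show ?thesis using tau_b i by simp
      qed
      moreover have "p \<in> tau" if "C2 i p = 0"
      proof -
        have "0 \<le> v * D i" "0 \<le> w * K i" using vw D_pos[of i] K_pos[of i] by auto
        moreover have "v * D i + w * K i = 0" using that e unfolding vw(1) C_cell(5)[OF False] by simp
        ultimately have "v * D i = 0" "w * K i = 0" by linarith+
        then have "v = 0" "w = 0" using D_pos[of i] K_pos[of i] by auto
        then show ?thesis using vw ctr_in_tau tri_0 by simp
      qed
      ultimately show ?thesis using C C3 by blast
    qed
  next
    assume "p \<in> flap i"
    then obtain v w where vw: "p = tri (i - 1) v w" "0 \<le> v" "0 \<le> w" "w \<le> 1" "v \<le> eps i * (1 - w)" and ei: "eps i \<noteq> 0"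
      by (auto simp: flap_def)
    obtain l where l: "i = Suc l" using eps_pos(3)[OF ei] by (cases i) auto
    have el: "eps (Suc l) \<noteq> 0" "l < k" using ei l i by auto
    have p: "p = tri l v w" using vw l by simp
    have spoke: "p \<in> tau" if "w = 0"
    proof -
      have "eps l = 0" using eps_pos(4)[OF ei] l by simp
      moreover have "v \<le> 1" using vw that eps_cases[of i] by simp
      ultimately show ?thesis using spoke_in_tau[OF el(2)] p vw that by simp
    qed
    have "p \<in> tau" if "C1 i p = 0"
    proof -
      have "v = eps (Suc l) * (1 - w)" using that D_pos[of "Suc l"] unfolding p l C_flap[OF el(1)] by simp
      then show ?thesis using p vw el by (auto intro: hair_in_tau)
    qed
    moreover have "w = 0" if "C2 i p = 0" using that el D_pos[of "Suc l"] unfolding p l C_flap[OF el(1)] by auto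
    moreover have "w = 0" if "C3 i p = 0"
    proof -
      have "0 \<le> 2 * h (Suc l) ctr * w" "0 \<le> v * K (Suc l)" using vw o l K_pos[of "Suc l"] by auto
      then have "2 * h (Suc l) ctr * w = 0" using that unfolding p l C_flap[OF el(1)] by linarith
      then show ?thesis using o l by simp
    qed
    ultimately show ?thesis using C spoke by blast
  qed
qed

end

section \<open>The prism\<close>

text \<open>If every function were positive somewhere on \<open>F\<close>, averaging the witnesses
  would give a point where all are positive. For a facet this yields a single supporting plane
  without enumerating faces.\<close>

lemma convex_in_one_hyperplane:
  fixes \<sigma> :: "'i \<Rightarrow> 'a::real_vector \<Rightarrow> real"
  assumes F: "convex F" "F \<noteq> {}" and I: "finite I"
    and affine: "\<And>i u p q. \<sigma> i ((1 - u) *\<^sub>R p + u *\<^sub>R q) = (1 - u) * \<sigma> i p + u * \<sigma> i q"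
    and nonneg: "\<And>i q. i \<in> I \<Longrightarrow> q \<in> F \<Longrightarrow> 0 \<le> \<sigma> i q"
    and tight: "\<And>q. q \<in> F \<Longrightarrow> \<exists>i\<in>I. \<sigma> i q = 0"
  shows "\<exists>i\<in>I. \<forall>q\<in>F. \<sigma> i q = 0"
proof (rule ccontr)
  assume "\<not> (\<exists>i\<in>I. \<forall>q\<in>F. \<sigma> i q = 0)"
  then have ex: "\<exists>q\<in>F. 0 < \<sigma> i q" if "i \<in> I" for i
    using nonneg that by (metis less_le)
  have "\<exists>q\<in>F. \<forall>i\<in>J. 0 < \<sigma> i q" if "finite J" "J \<subseteq> I" for J
    using that
  proof (induction J rule: finite_induct)
    case empty then show ?case using F by blast
  next
    case (insert j J)
    obtain q r where q: "q \<in> F" "\<forall>i\<in>J. 0 < \<sigma> i q" and r: "r \<in> F" "0 < \<sigma> j r"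
      using insert ex[of j] by auto
    define s where "s = (1 - 1/2) *\<^sub>R q + (1/2::real) *\<^sub>R r"
    have "s \<in> F" unfolding s_def using convexD_alt[OF F(1) q(1) r(1), of "1/2"] by simp
    moreover have "\<sigma> i s = (1 - 1/2) * \<sigma> i q + 1/2 * \<sigma> i r" for i
      unfolding s_def by (rule affine)
    moreover have "0 \<le> \<sigma> i q" "0 \<le> \<sigma> i r" if "i \<in> insert j J" for i
      using nonneg q r insert.prems that by auto
    ultimately have "\<forall>i\<in>insert j J. 0 < \<sigma> i s" using q r by (auto simp: add_pos_nonneg add_nonneg_pos)
    then show ?case using \<open>s \<in> F\<close> by blast
  qed
  then obtain q where "q \<in> F" "\<forall>i\<in>I. 0 < \<sigma> i q" using I by blast
  then show False using tight[of q] by auto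
qed

section \<open>Product coordinates on three-space\<close>

definition pr :: "real^3 \<Rightarrow> complex" where "pr q = Complex (q$1) (q$2)"
definition pt :: "complex \<Rightarrow> real \<Rightarrow> real^3" where "pt p z = vector [Re p, Im p, z]"

lemma pt_nth [simp]: "pr (pt p z) = p" "pt p z $ 3 = z" "pt p z $ 1 = Re p" "pt p z $ 2 = Im p"
  by (simp_all add: pt_def pr_def)

lemma vec3_eq_iff: "q = q' \<longleftrightarrow> pr q = pr q' \<and> q$3 = (q'$3 :: real)"
  by (auto simp: vec_eq_iff forall_3 pr_def)

lemma pt_pr [simp]: "pt (pr q) (q$3) = q"
  by (simp add: vec3_eq_iff)

lemma pt_eq_iff [simp]: "pt p z = pt p' z' \<longleftrightarrow> p = p' \<and> z = z'"
  by (simp add: vec3_eq_iff)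

lemma pr_linear: "pr (a *\<^sub>R q) = a *\<^sub>R pr q" "pr (q + q') = pr q + pr q'" "pr (q - q') = pr q - pr q'"
  by (simp_all add: pr_def complex_eq_iff)

lemma pt_comb: "a *\<^sub>R pt p z + a' *\<^sub>R pt p' z' = pt (a *\<^sub>R p + a' *\<^sub>R p') (a * z + a' * z')"
  by (simp add: vec3_eq_iff pr_linear)

lemma dist_vec3: "(dist q q')\<^sup>2 = (dist (pr q) (pr q'))\<^sup>2 + (q$3 - q'$3)\<^sup>2"
proof -
  have "(dist q q')\<^sup>2 = (q$1 - q'$1)\<^sup>2 + (q$2 - q'$2)\<^sup>2 + (q$3 - q'$3)\<^sup>2"
    unfolding dist_norm power2_norm_eq_inner inner_vec_def sum_3 by (simp add: power2_eq_square)
  moreover have "(dist (pr q) (pr q'))\<^sup>2 = (q$1 - q'$1)\<^sup>2 + (q$2 - q'$2)\<^sup>2"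
    by (simp add: dist_norm cmod_power2 pr_def)
  ultimately show ?thesis by simp
qed

lemma continuous_pr: "continuous_on S pr"
proof -
  have "linear pr" by (intro linearI pr_linear)
  then show ?thesis by (intro linear_continuous_on) (simp add: linear_conv_bounded_linear)
qed

lemma continuous_pt: "continuous_on S (\<lambda>p. pt p z)"
proof -
  have "linear (\<lambda>p. pt p 0)" by (intro linearI) (simp_all add: vec3_eq_iff pr_linear)
  then have "continuous_on S (\<lambda>p. pt p 0)" by (intro linear_continuous_on) (simp add: linear_conv_bounded_linear)
  then have "continuous_on S (\<lambda>p. pt p 0 + pt 0 z)" by (intro continuous_on_add continuous_on_const)
  moreover have "pt p 0 + pt 0 z = pt p z" for p by (simp add: vec3_eq_iff pr_linear)
  ultimately show ?thesis by simp
qed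

lemma pt_closed_segment: "closed_segment (pt p z) (pt p' z) = (\<lambda>p. pt p z) ` closed_segment p p'"
proof -
  have "(1 - u) *\<^sub>R pt p z + u *\<^sub>R pt p' z = pt ((1 - u) *\<^sub>R p + u *\<^sub>R p') z" for u
    unfolding pt_comb by (simp add: left_diff_distrib)
  then show ?thesis by (auto simp: closed_segment_def image_image image_iff)
qed

locale prism = ngon m for m +
  fixes H :: real
  assumes H: "0 < H"
begin

definition Q :: "(real^3) set" where "Q = {q. pr q \<in> B \<and> \<bar>q$3\<bar> \<le> H}"
definition V :: "(real^3) set" where "V = (\<lambda>(i, z). pt (b i) z) ` ({..<k} \<times> {H, - H})"

lemma finite_V: "finite V" by (simp add: V_def)

lemma card_V: "card V = 2 * k"
proof -
  have "inj_on (\<lambda>(i, z). pt (b i) z) ({..<k} \<times> {H, - H})"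
    using b_inj by (auto simp: inj_on_def)
  then have "card V = card ({..<k} \<times> {H, - H})" unfolding V_def by (rule card_image)
  also have "\<dots> = 2 * k" using H by (simp add: card_cartesian_product)
  finally show ?thesis .
qed

lemma convex_Q: "convex Q"
proof -
  have *: "\<bar>(1 - u) * s + u * s'\<bar> \<le> H" if "0 \<le> u" "u \<le> 1" "\<bar>s\<bar> \<le> H" "\<bar>s'\<bar> \<le> H" for u s s' :: real
    using convexD_alt[OF convex_real_interval(5)[of "-H" H], of s s' u] that by (auto simp: abs_le_iff)
  have "(1 - u) *\<^sub>R pr q + u *\<^sub>R pr q' \<in> B" if "q \<in> Q" "q' \<in> Q" "0 \<le> u" "u \<le> 1" for q q' u
    using convexD_alt[OF convex_B] that by (auto simp: Q_def)
  then show ?thesis unfolding convex_alt using * by (auto simp: Q_def pr_linear)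
qed

lemma Q_hull: "Q = convex hull V"
proof (rule subset_antisym)
  have "V \<subseteq> Q" using b_in_B H by (auto simp: V_def Q_def)
  then show "convex hull V \<subseteq> Q" by (intro hull_minimal convex_Q)
  have face: "pt p z \<in> convex hull V" if "p \<in> B" "z = H \<or> z = - H" for p z
  proof -
    let ?C = "{p. pt p z \<in> convex hull V}"
    have "convex ?C"
    proof (rule convex_alt[THEN iffD2], intro ballI allI impI)
      fix p p' u assume "p \<in> ?C" "p' \<in> ?C" "0 \<le> u \<and> u \<le> (1::real)"
      then have "(1 - u) *\<^sub>R pt p z + u *\<^sub>R pt p' z \<in> convex hull V"
        by (intro convexD_alt[OF convex_convex_hull]) auto
      moreover have "(1 - u) * z + u * z = z" by (simp add: left_diff_distrib)
      ultimately show "(1 - u) *\<^sub>R p + u *\<^sub>R p' \<in> ?C" unfolding pt_comb by simp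
    qed
    moreover have "b ` {..<k} \<subseteq> ?C" using that by (auto simp: V_def intro!: hull_inc)
    ultimately have "convex hull (b ` {..<k}) \<subseteq> ?C" by (intro hull_minimal)
    then show ?thesis using that B_hull by blast
  qed
  show "Q \<subseteq> convex hull V"
  proof
    fix q assume q: "q \<in> Q"
    define u where "u = (q$3 + H) / (2 * H)"
    have u: "0 \<le> u" "u \<le> 1" using q H by (auto simp: u_def Q_def field_simps)
    have "(1 - u) *\<^sub>R pt (pr q) (- H) + u *\<^sub>R pt (pr q) H = pt (pr q) ((1 - u) * (- H) + u * H)"
      unfolding pt_comb by (simp add: algebra_simps)
    also have "(1 - u) * (- H) + u * H = q$3" using H by (simp add: u_def field_simps)
    finally have "q = (1 - u) *\<^sub>R pt (pr q) (- H) + u *\<^sub>R pt (pr q) H" by simp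
    moreover have "\<dots> \<in> convex hull V"
      using q u by (intro convexD_alt[OF convex_convex_hull] face) (auto simp: Q_def)
    ultimately show "q \<in> convex hull V" by simp
  qed
qed

lemma compact_Q: "compact Q"
  unfolding Q_hull by (intro compact_convex_hull finite_imp_compact finite_V)

lemma interior_Q: "interior Q = {q. pr q \<in> interior B \<and> \<bar>q$3\<bar> < H}"
proof
  have "open (pr -` interior B)" by (rule open_vimage[OF open_interior]) (rule continuous_pr)
  moreover have "open {q::real^3. \<bar>q$3\<bar> < H}" by (intro open_Collect_less continuous_intros)
  ultimately have "open (pr -` interior B \<inter> {q. \<bar>q$3\<bar> < H})" by (rule open_Int)
  moreover have "pr -` interior B \<inter> {q. \<bar>q$3\<bar> < H} \<subseteq> Q"
  proof
    fix q assume "q \<in> pr -` interior B \<inter> {q. \<bar>q$3\<bar> < H}"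
    then have "pr q \<in> B" "\<bar>q$3\<bar> < H" using interior_subset[of B] by blast+
    then show "q \<in> Q" by (simp add: Q_def)
  qed
  ultimately have "pr -` interior B \<inter> {q. \<bar>q$3\<bar> < H} \<subseteq> interior Q" by (intro interior_maximal)
  then show "{q. pr q \<in> interior B \<and> \<bar>q$3\<bar> < H} \<subseteq> interior Q"
    by (simp add: vimage_def Collect_conj_eq)
  show "interior Q \<subseteq> {q. pr q \<in> interior B \<and> \<bar>q$3\<bar> < H}"
  proof (intro subsetI CollectI conjI)
    fix q assume "q \<in> interior Q"
    then obtain e where e: "e > 0" "cball q e \<subseteq> Q" using mem_interior_cball by blast
    have "ball (pr q) e \<subseteq> B"
    proof
      fix p assume "p \<in> ball (pr q) e"
      then have "(dist (pr q) p)\<^sup>2 \<le> e\<^sup>2" by (intro power_mono) auto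
      then have "(dist q (pt p (q$3)))\<^sup>2 \<le> e\<^sup>2" by (simp add: dist_vec3)
      then have "dist q (pt p (q$3)) \<le> e" using e(1) by (rule power2_le_imp_le[OF _ less_imp_le])
      then have "pt p (q$3) \<in> Q" using e(2) by auto
      then show "p \<in> B" by (simp add: Q_def)
    qed
    then show "pr q \<in> interior B" using e(1) mem_interior by blast
    have "dist q (pt (pr q) z) \<le> e" if "\<bar>q$3 - z\<bar> = e" for z
    proof -
      have "(dist q (pt (pr q) z))\<^sup>2 = \<bar>q$3 - z\<bar>\<^sup>2" by (simp add: dist_vec3)
      then show ?thesis using that e(1) power2_le_imp_le[of "dist q (pt (pr q) z)" e] by simp
    qed
    from this[of "q$3 + e"] this[of "q$3 - e"]
    have "pt (pr q) (q$3 + e) \<in> Q" "pt (pr q) (q$3 - e) \<in> Q" using e by auto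
    then show "\<bar>q$3\<bar> < H" using e(1) by (auto simp: Q_def)
  qed
qed

lemma frontier_Q: "frontier Q = {q. pr q \<in> B \<and> \<bar>q$3\<bar> \<le> H \<and> (\<bar>q$3\<bar> = H \<or> (\<exists>i<k. h i (pr q) = 0))}"
proof -
  have "frontier Q = Q - interior Q" using compact_Q by (simp add: frontier_def compact_imp_closed)
  also have "\<dots> = {q. pr q \<in> B \<and> \<bar>q$3\<bar> \<le> H \<and> (\<bar>q$3\<bar> = H \<or> pr q \<in> frontier B)}"
    using closed_B unfolding interior_Q by (auto simp: frontier_def Q_def)
  finally show ?thesis by (auto simp: frontier_B)
qed

lemma interior_Q_nonempty: "interior Q \<noteq> {}"
proof -
  have "pt 0 0 \<in> interior Q" using H A_bounds by (simp add: interior_Q interior_B h_def)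
  then show ?thesis by blast
qed

lemma convex_polytope3_Q: "convex_polytope3 Q"
  unfolding convex_polytope3_def
proof
  show "polytope Q" unfolding Q_hull by (intro finite_V polytope_convex_hull)
  show "aff_dim Q = 3" using aff_dim_nonempty_interior[OF interior_Q_nonempty] by simp
qed

text \<open>All points of \<open>V\<close> attain the largest norm on \<open>Q\<close>, and a point
  inside a segment is strictly closer to the origin than one of the ends.\<close>

lemma poly_vertices_Q: "poly_vertices Q = V"
proof (rule subset_antisym)
  show "poly_vertices Q \<subseteq> V"
  proof
    fix v assume "v \<in> poly_vertices Q"
    then have "v extreme_point_of (convex hull V)" by (simp add: poly_vertices_def Q_hull[symmetric])
    then show "v \<in> V" by (rule extreme_point_of_convex_hull)
  qed
  show "V \<subseteq> poly_vertices Q"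
  proof
    fix v assume v: "v \<in> V"
    define r where "r = (1 / sin \<theta>)\<^sup>2 + H\<^sup>2"
    have d: "(dist 0 q)\<^sup>2 = (cmod (pr q))\<^sup>2 + (q$3)\<^sup>2" for q
    proof -
      have "pr 0 = 0" by (simp add: pr_def complex_eq_iff)
      then show ?thesis using dist_vec3[of 0 q] by simp
    qed
    have vr: "(dist 0 v)\<^sup>2 = r" unfolding d using v by (auto simp: V_def r_def norm_b)
    have qr: "(dist 0 q)\<^sup>2 \<le> r" if "q \<in> Q" for q
    proof -
      have "(cmod (pr q))\<^sup>2 \<le> (1 / sin \<theta>)\<^sup>2" using norm_B that by (intro power_mono) (auto simp: Q_def)
      moreover have "(q$3)\<^sup>2 \<le> H\<^sup>2" using that H by (auto simp: Q_def abs_le_square_iff[symmetric])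
      ultimately show ?thesis unfolding d r_def by linarith
    qed
    have "v \<in> Q" unfolding Q_hull using v by (rule hull_inc)
    moreover have "v \<notin> open_segment q q'" if "q \<in> Q" "q' \<in> Q" for q q'
    proof
      assume "v \<in> open_segment q q'"
      then have "dist 0 v < dist 0 q \<or> dist 0 v < dist 0 q'" by (rule dist_decreases_open_segment)
      then have "(dist 0 v)\<^sup>2 < (dist 0 q)\<^sup>2 \<or> (dist 0 v)\<^sup>2 < (dist 0 q')\<^sup>2"
        by (auto intro: power_strict_mono)
      then show False using vr qr[OF that(1)] qr[OF that(2)] by auto
    qed
    ultimately show "v \<in> poly_vertices Q" by (auto simp: poly_vertices_def extreme_point_of_def)
  qed
qed

lemma facet_cases:
  assumes "F facet_of Q"
  shows "(\<exists>i<k. \<forall>q\<in>F. h i (pr q) = 0) \<or> (\<forall>q\<in>F. q$3 = H) \<or> (\<forall>q\<in>F. q$3 = - H)"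
proof -
  have "F \<noteq> Q" using assms by auto
  then have face: "F face_of Q" "F \<noteq> {}" "F \<noteq> Q"
    using assms by (simp_all add: facet_of_def)
  have "F \<subseteq> Q" using face by (simp add: face_of_imp_subset)
  have "F \<subseteq> frontier Q"
    using face_of_subset_rel_frontier[OF face(1,3)] rel_frontier_nonempty_interior[OF interior_Q_nonempty] by simp
  define \<sigma> where "\<sigma> i q = (if i < k then h i (pr q) else if i = k then H - q$3 else H + q$3)" for i and q :: "real^3"
  have "\<exists>i\<in>{..Suc k}. \<forall>q\<in>F. \<sigma> i q = 0"
  proof (rule convex_in_one_hyperplane)
    show "convex F" using face(1) by (rule face_of_imp_convex)
    show "\<sigma> i ((1 - u) *\<^sub>R p + u *\<^sub>R q) = (1 - u) * \<sigma> i p + u * \<sigma> i q" for i u p q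
    proof -
      have "h i (pr ((1 - u) *\<^sub>R p + u *\<^sub>R q)) = (1 - u) * h i (pr p) + u * h i (pr q)"
        by (simp only: pr_linear affine_segment)
      then show ?thesis unfolding \<sigma>_def by (simp add: left_diff_distrib right_diff_distrib distrib_left)
    qed
    show "0 \<le> \<sigma> i q" if "q \<in> F" for i q
      using that \<open>F \<subseteq> Q\<close> by (auto simp: \<sigma>_def Q_def B_def)
    show "\<exists>i\<in>{..Suc k}. \<sigma> i q = 0" if "q \<in> F" for q
    proof -
      have "\<bar>q$3\<bar> = H \<or> (\<exists>i<k. h i (pr q) = 0)" using that \<open>F \<subseteq> frontier Q\<close> by (auto simp: frontier_Q)
      then have "q$3 = H \<or> q$3 = - H \<or> (\<exists>i<k. h i (pr q) = 0)" by (auto simp: abs_if split: if_splits)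
      then consider "q$3 = H" | "q$3 = - H" | i where "i < k" "h i (pr q) = 0" by blast
      then show ?thesis
      proof cases
        case 1 then show ?thesis by (intro bexI[of _ k]) (auto simp: \<sigma>_def)
      next
        case 2 then show ?thesis by (intro bexI[of _ "Suc k"]) (auto simp: \<sigma>_def)
      next
        case 3 then show ?thesis by (intro bexI[of _ i]) (auto simp: \<sigma>_def)
      qed
    qed
  qed (use face in auto)
  then obtain i where i: "i \<le> Suc k" "\<forall>q\<in>F. \<sigma> i q = 0" by auto
  then consider "i < k" | "i = k" | "i = Suc k" by linarith
  then show ?thesis using i by cases (auto simp: \<sigma>_def)
qed

end

section \<open>Unfolding the prism\<close>

text \<open>The hypotheses \<open>a\<close> and \<open>b\<close> say that the slope does not
  increase at the two inner breaks, so the chain is the minimum of its three carrying lines. The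
  constant 2 is the length of a side.\<close>

lemma concave_chain:
  fixes x1 x2 y1 y2 x :: real
  assumes x: "0 < x1" "x1 < x2" "x2 < 2" and a: "y2 * x1 \<le> y1 * x2"
    and b: "0 \<le> (y2 - y1) * (2 - x2) + y2 * (x2 - x1)"
  defines "l1 \<equiv> y1 / x1 * x" and "l2 \<equiv> y2 + (y2 - y1) / (x2 - x1) * (x - x2)" and "l3 \<equiv> y2 / (2 - x2) * (2 - x)"
  shows "x \<le> x1 \<Longrightarrow> l1 \<le> l2 \<and> l1 \<le> l3" "x1 \<le> x \<Longrightarrow> x \<le> x2 \<Longrightarrow> l2 \<le> l1 \<and> l2 \<le> l3"
    "x2 \<le> x \<Longrightarrow> l3 \<le> l1 \<and> l3 \<le> l2"
proof -
  define s1 s2 s3 where "s1 = y1 / x1" and "s2 = (y2 - y1) / (x2 - x1)" and "s3 = - y2 / (2 - x2)"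
  have s12: "s2 \<le> s1" using x a by (simp add: s1_def s2_def field_simps)
  have s23: "s3 \<le> s2"
  proof -
    have "- y2 * (x2 - x1) \<le> (y2 - y1) * (2 - x2)" using b by linarith
    then show ?thesis unfolding s3_def s2_def using x by (simp add: divide_le_eq_1 frac_le_eq field_simps)
  qed
  have y1: "y2 + s2 * (x1 - x2) = y1"
    using x by (simp add: s2_def field_simps)
  have y1': "s1 * x1 = y1" using x by (simp add: s1_def)
  have y2': "s3 * (x2 - 2) = y2" using x by (simp add: s3_def field_simps)
  have l: "l1 = s1 * x" "l2 = y2 + s2 * (x - x2)" "l3 = s3 * (x - 2)"
    using x by (simp_all add: l1_def l2_def l3_def s1_def s2_def s3_def field_simps)
  have d12: "l1 - l2 = (s1 - s2) * (x - x1)" using y1 y1' unfolding l by (simp add: algebra_simps)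
  have d23: "l2 - l3 = (s2 - s3) * (x - x2)" using y2' unfolding l by (simp add: algebra_simps)
  have le: "l1 \<le> l2" if "x \<le> x1"
    using d12 mult_nonneg_nonpos[of "s1 - s2" "x - x1"] s12 that by linarith
  have ge: "l2 \<le> l1" if "x1 \<le> x"
    using d12 mult_nonneg_nonneg[of "s1 - s2" "x - x1"] s12 that by linarith
  have le': "l2 \<le> l3" if "x \<le> x2"
    using d23 mult_nonneg_nonpos[of "s2 - s3" "x - x2"] s23 that by linarith
  have ge': "l3 \<le> l2" if "x2 \<le> x"
    using d23 mult_nonneg_nonneg[of "s2 - s3" "x - x2"] s23 that by linarith
  show "x \<le> x1 \<Longrightarrow> l1 \<le> l2 \<and> l1 \<le> l3" using le le' x by force
  show "x1 \<le> x \<Longrightarrow> x \<le> x2 \<Longrightarrow> l2 \<le> l1 \<and> l2 \<le> l3" using ge le' by blast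
  show "x2 \<le> x \<Longrightarrow> l3 \<le> l1 \<and> l3 \<le> l2" using ge ge' x by force
qed

locale prism_tree = ngon_tree m c + prism m H for m c H
begin

text \<open>Three breaks per side: the corner and two inner points. The redundant midpoint of a side
  with \<open>eps i = 0\<close> keeps the index arithmetic uniform modulo 3.\<close>

definition RX :: "nat \<Rightarrow> real" where
  "RX r = 2 * real (r div 3) + (if r mod 3 = 0 then 0 else if r mod 3 = 1 then XP (r div 3) else XS (r div 3))"
definition RY :: "nat \<Rightarrow> real" where
  "RY r = H + (if r mod 3 = 0 then 0 else if r mod 3 = 1 then HP (r div 3) else HS (r div 3))"

lemma RX_simps: "RX (3 * i) = 2 * real i" "RX (3 * i + 1) = 2 * real i + XP i" "RX (3 * i + 2) = 2 * real i + XS i"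
    "RX (3 * i + 3) = 2 * real i + 2"
proof -
  have "(3 * i + 1) div 3 = i" "(3 * i + 1) mod 3 = 1" "(3 * i + 2) div 3 = i" "(3 * i + 2) mod 3 = 2"
     "(3 * i + 3) div 3 = i + 1" "(3 * i + 3) mod 3 = 0" by presburger+
  then show "RX (3 * i) = 2 * real i" "RX (3 * i + 1) = 2 * real i + XP i" "RX (3 * i + 2) = 2 * real i + XS i"
    "RX (3 * i + 3) = 2 * real i + 2" by (simp_all only: RX_def) simp_all
qed

lemma RY_simps: "RY (3 * i) = H" "RY (3 * i + 1) = H + HP i" "RY (3 * i + 2) = H + HS i" "RY (3 * i + 3) = H"
proof -
  have "(3 * i + 1) div 3 = i" "(3 * i + 1) mod 3 = 1" "(3 * i + 2) div 3 = i" "(3 * i + 2) mod 3 = 2"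
     "(3 * i + 3) div 3 = i + 1" "(3 * i + 3) mod 3 = 0" by presburger+
  then show "RY (3 * i) = H" "RY (3 * i + 1) = H + HP i" "RY (3 * i + 2) = H + HS i" "RY (3 * i + 3) = H"
    by (simp_all only: RY_def) simp_all
qed

lemma index_cases:
  fixes r :: nat obtains i where "r = 3 * i" | i where "r = 3 * i + 1" | i where "r = 3 * i + 2"
proof -
  have "r = 3 * (r div 3) \<or> r = 3 * (r div 3) + 1 \<or> r = 3 * (r div 3) + 2" by presburger
  then show ?thesis using that by blast
qed

sublocale R: roof RX RY "3 * k"
proof
  show "1 \<le> 3 * k" using k_ge by simp
  show "RX r < RX (Suc r)" for r
  proof (cases r rule: index_cases)
    case (1 i) then show ?thesis using RX_simps[of i] breaks[of i] by simp
  next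
    case (2 i)
    then have "Suc r = 3 * i + 2" by simp
    then show ?thesis using RX_simps[of i] breaks[of i] 2 by simp
  next
    case (3 i)
    then have "Suc r = 3 * i + 3" by simp
    then have "RX (Suc r) = 2 * real i + 2" using RX_simps(4)[of i] by metis
    then show ?thesis using RX_simps[of i] breaks[of i] 3 by simp
  qed
  show "0 < RY r" for r
    using H breaks[of "r div 3"] by (simp add: RY_def add_pos_pos)
qed

lemma RX_ends: "RX 0 = 0" "RX (3 * k) = 2 * real k"
  using RX_simps(1)[of 0] RX_simps(1)[of k] by simp_all

text \<open>By concavity the roof over one side is the minimum of three lines, so comparing with it
  is comparing with all of them.\<close>

lemma roof_strip:
  assumes i: "i < k" and x: "0 \<le> x i p" "x i p \<le> 2"
  shows "H + h i p \<le> R.g (2 * real i + x i p) \<longleftrightarrow> C1 i p \<le> 0 \<and> C2 i p \<le> 0 \<and> C3 i p \<le> 0"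
    and "C1 i p \<le> 0 \<Longrightarrow> C2 i p \<le> 0 \<Longrightarrow> C3 i p \<le> 0 \<Longrightarrow>
      H + h i p = R.g (2 * real i + x i p) \<longleftrightarrow> C1 i p = 0 \<or> C2 i p = 0 \<or> C3 i p = 0"
proof -
  note br = breaks[of i]
  define X where "X = x i p"
  define l1 where "l1 = HP i / XP i * X"
  define l2 where "l2 = HS i + (HS i - HP i) / (XS i - XP i) * (X - XS i)"
  define l3 where "l3 = HS i / (2 - XS i) * (2 - X)"
  have l2': "l2 = HP i + (X - XP i) / (XS i - XP i) * (HS i - HP i)"
    using br by (simp add: l2_def field_simps)
  \<comment> \<open>Concavity at the two inner breaks reduces to the signs of \<open>D i\<close> and
    \<open>K i\<close>, up to the factor \<open>eps i\<close>.\<close>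
  have a: "HS i * XP i \<le> HP i * XS i"
  proof (cases "eps i = 0")
    case True then show ?thesis by (simp add: XP_def HP_def)
  next
    case False
    have "HP i * XS i - HS i * XP i = eps i * D i"
      using False eps_pos(2)[OF False] by (simp add: XP_def HP_def XS_def HS_def D_def algebra_simps)
    moreover have "0 \<le> eps i * D i" using D_pos[of i] eps_cases(2)[of i] by simp
    ultimately show ?thesis by linarith
  qed
  have b: "0 \<le> (HS i - HP i) * (2 - XS i) + HS i * (XS i - XP i)"
  proof (cases "eps i = 0")
    case True
    then have "(HS i - HP i) * (2 - XS i) + HS i * (XS i - XP i) = HS i" by (simp add: XP_def HP_def field_simps)
    then show ?thesis using br by simp
  next
    case False
    have "(HS i - HP i) * (2 - XS i) + HS i * (XS i - XP i) = eps i * K i"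
      using False eps_pos(2)[OF False] by (simp add: XP_def HP_def XS_def HS_def K_def algebra_simps)
    then show ?thesis using K_pos[of i] eps_cases(2)[of i] by simp
  qed
  note conc = concave_chain[OF br(1,2,3) a b, of X, folded l1_def l2_def l3_def]
  have C: "C1 i p \<le> 0 \<longleftrightarrow> h i p \<le> l1" "C1 i p = 0 \<longleftrightarrow> h i p = l1"
    "C2 i p \<le> 0 \<longleftrightarrow> h i p \<le> l2" "C2 i p = 0 \<longleftrightarrow> h i p = l2"
    "C3 i p \<le> 0 \<longleftrightarrow> h i p \<le> l3" "C3 i p = 0 \<longleftrightarrow> h i p = l3"
  proof -
    have "C1 i p = XP i * (h i p - l1)" using br by (simp add: C1_def l1_def X_def algebra_simps)
    then show "C1 i p \<le> 0 \<longleftrightarrow> h i p \<le> l1" "C1 i p = 0 \<longleftrightarrow> h i p = l1" using br by (auto simp: mult_le_0_iff)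
    have "C2 i p = (XS i - XP i) * (h i p - l2)" using br by (simp add: C2_def l2_def X_def algebra_simps)
      (simp add: field_simps)
    then show "C2 i p \<le> 0 \<longleftrightarrow> h i p \<le> l2" "C2 i p = 0 \<longleftrightarrow> h i p = l2" using br by (auto simp: mult_le_0_iff)
    have "(2 - XS i) * l3 = HS i * (2 - X)" using br by (simp add: l3_def)
    then have "C3 i p = (2 - XS i) * (h i p - l3)" by (simp add: C3_def X_def algebra_simps)
    then show "C3 i p \<le> 0 \<longleftrightarrow> h i p \<le> l3" "C3 i p = 0 \<longleftrightarrow> h i p = l3" using br by (auto simp: mult_le_0_iff)
  qed
  have g: "R.g (2 * real i + X) = H + min l1 (min l2 l3)"
  proof -
    consider "X \<le> XP i" | "XP i \<le> X" "X \<le> XS i" | "XS i \<le> X" by linarith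
    then show ?thesis
    proof cases
      case 1
      have "R.g (2 * real i + X) = H + X / XP i * HP i"
        using R.g_eq[of "3 * i" "2 * real i + X"] RX_simps[of i] RY_simps[of i] i x 1 by (simp add: X_def)
      then show ?thesis using conc(1)[OF 1] by (simp add: l1_def min_def mult.commute)
    next
      case 2
      have s: "Suc (3 * i + 1) = 3 * i + 2" by simp
      have "R.g (2 * real i + X) = H + HP i + (X - XP i) / (XS i - XP i) * (HS i - HP i)"
        using R.g_eq[of "3 * i + 1" "2 * real i + X"] i x 2 unfolding s RX_simps RY_simps by (simp add: X_def)
      then show ?thesis using conc(2)[OF 2] by (simp add: l2' min_def)
    next
      case 3
      have s: "Suc (3 * i + 2) = 3 * i + 3" by simp
      have "R.g (2 * real i + X) = H + HS i + (X - XS i) / (2 - XS i) * (0 - HS i)"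
        using R.g_eq[of "3 * i + 2" "2 * real i + X"] i x 3 unfolding s RX_simps RY_simps by (simp add: X_def)
      also have "\<dots> = H + l3" using br by (simp add: l3_def field_simps)
      finally show ?thesis using conc(3)[OF 3] by (simp add: min_def)
    qed
  qed
  show "H + h i p \<le> R.g (2 * real i + x i p) \<longleftrightarrow> C1 i p \<le> 0 \<and> C2 i p \<le> 0 \<and> C3 i p \<le> 0"
    using g unfolding C X_def by auto
  show "C1 i p \<le> 0 \<Longrightarrow> C2 i p \<le> 0 \<Longrightarrow> C3 i p \<le> 0 \<Longrightarrow>
      H + h i p = R.g (2 * real i + x i p) \<longleftrightarrow> C1 i p = 0 \<or> C2 i p = 0 \<or> C3 i p = 0"
    using g unfolding C X_def by (auto simp: min_def)
qed

lemma piece_roof: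
  assumes "i < k"
  shows "p \<in> piece i \<longleftrightarrow> 0 \<le> x i p \<and> x i p \<le> 2 \<and> 0 \<le> h i p \<and> H + h i p \<le> R.g (2 * real i + x i p)"
  using piece_coords[of p i] roof_strip(1)[OF assms, of p] by blast

lemma tau_roof:
  assumes "i < k" "p \<in> piece i"
  shows "p \<in> tau \<longleftrightarrow> H + h i p = R.g (2 * real i + x i p)"
  using tau_iff[OF assms] roof_strip(2)[OF assms(1), of p] assms(2)[unfolded piece_coords] by blast

lemma not_tau_roof:
  assumes "i < k" "p \<in> piece i"
  shows "p \<notin> tau \<longleftrightarrow> H + h i p < R.g (2 * real i + x i p)"
  using tau_roof[OF assms] assms(2) unfolding piece_roof[OF assms(1)] by auto

section \<open>The cut tree and the unfolding map\<close>

definition T :: "(real^3) set" where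
  "T = {q. pr q \<in> tau \<and> \<bar>q$3\<bar> = H} \<union> {q. pr q = b 0 \<and> \<bar>q$3\<bar> \<le> H}"

text \<open>The factor \<open>q $ 3 / H\<close> is the sign of \<open>q $ 3\<close> on the two bases, while \<open>h i\<close> vanishes on the lateral face, so
  that one formula places the lateral face and the pieces of both bases attached to it.\<close>

definition unroll :: "nat \<Rightarrow> real^3 \<Rightarrow> real^2" where
  "unroll i q = vec2 (2 * real i + x i (pr q)) (q$3 + q$3 / H * h i (pr q))"

lemma edge_in_piece:
  assumes "i < k" "p \<in> B" "h i p = 0" shows "p \<in> piece i"
proof -
  obtain u where u: "0 \<le> u" "u \<le> 1" "p = (1 - u) *\<^sub>R b i + u *\<^sub>R b (Suc i)"
    using edge_segment(1)[OF assms(2,1,3)] by (auto simp: in_segment)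
  then have "p = tri i (1 - u) u" by (simp add: tri_def algebra_simps)
  moreover have "eps (Suc i) * (1 - u) \<le> 1 - u" using u eps_cases[of "Suc i"] by (simp add: mult_left_le_one_le)
  ultimately have "p \<in> cell i" using u unfolding cell_def by fastforce
  then show ?thesis by (simp add: piece_def)
qed

text \<open>Sides 0 and \<open>k - 1\<close> also share \<open>b 0\<close>, but the lateral strip is
  cut open there. Excluding that corner leaves consecutive indices, for which the unrolled abscissas
  agree.\<close>

lemma edges_meet:
  assumes "i < k" "j < k" "i \<noteq> j" "p \<in> B" "h i p = 0" "p \<in> piece j" "p \<noteq> b 0"
  shows "j = Suc i \<and> p = b j \<or> i = Suc j \<and> p = b i"
proof -
  obtain u where u: "0 \<le> u" "u \<le> 1" "p = (1 - u) *\<^sub>R b i + u *\<^sub>R b (Suc i)"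
    using edge_segment(1)[OF assms(4,1,5)] by (auto simp: in_segment)
  have p: "p = tri i (1 - u) u" using u by (simp add: tri_def algebra_simps)
  have wrap: "j = Suc i \<and> p = b j" if "u = 1" "b (Suc i) = b j"
  proof -
    have "p = b j" using u(3) that by simp
    then have "Suc i \<noteq> k" using that assms(7) b_k by auto
    then have "Suc i = j" using b_inj[of "Suc i" j] that assms(1,2) by auto
    then show ?thesis using \<open>p = b j\<close> by simp
  qed
  from assms(6) show ?thesis unfolding piece_def
  proof
    assume "p \<in> cell j"
    then obtain v w where vw: "p = tri j v w" "0 \<le> v" "0 \<le> w" by (auto simp: cell_def)
    from cone_unique[OF assms(1,2), of "1 - u" u v w] p vw u assms(3)
    consider "u = 1" "b (Suc i) = b j" | "u = 0" "b i = b (Suc j)" by auto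
    then show ?thesis
    proof cases
      case 2
      then have "adj j i" using b_eq_iff[OF assms(1,2)] by simp
      moreover have "p = b i" using 2 u by simp
      ultimately show ?thesis using assms(3,7) by (auto simp: adj_def)
    qed (use wrap in blast)
  next
    assume "p \<in> flap j"
    then obtain v w where vw: "p = tri (j - 1) v w" "0 \<le> v" "0 \<le> w" "w \<le> 1" "v \<le> eps j * (1 - w)" and ej: "eps j \<noteq> 0"
      by (auto simp: flap_def)
    have e8: "eps j = 1 / 8" using eps_pos[OF ej] by simp
    obtain l where l: "j = Suc l" using eps_pos(3)[OF ej] by (cases j) auto
    have lk: "l < k" using assms l by simp
    have pl: "p = tri l v w" using vw l by simp
    from cone_unique[OF assms(1) lk, of "1 - u" u v w] p pl vw u
    consider "i = l" "1 - u = v" "u = w" | "u = 0" "b i = b (Suc l)" | "v = 1" "w = 0" by auto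
    then show ?thesis
    proof cases
      case 1
      then have "u = 1" using vw e8 u by simp
      then show ?thesis using wrap 1 l by simp
    next
      case 2
      then have "i = j" using b_inj[of i j] assms l by simp
      then show ?thesis using assms(3) by simp
    next
      case 3
      then show ?thesis using vw e8 by simp
    qed
  qed
qed

lemma lateral_unroll:
  assumes "l < k" "i < k" "pr q \<in> B" "h l (pr q) = 0" "pr q \<in> piece i" "pr q \<noteq> b 0"
  shows "unroll i q = unroll l q" "h i (pr q) = 0"
proof -
  have "i = l \<or> i = Suc l \<and> pr q = b i \<or> l = Suc i \<and> pr q = b l"
    using edges_meet[OF assms(1,2) _ assms(3-6)] by blast
  then have "unroll i q = unroll l q \<and> h i (pr q) = 0"
    using assms(4) by (auto simp: unroll_def coords_b add.commute)
  then show "unroll i q = unroll l q" "h i (pr q) = 0" by auto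
qed

lemma frontier_minus_T:
  assumes "q \<in> frontier Q - T" "i < k" "pr q \<in> piece i"
  shows "\<bar>q$3\<bar> = H \<and> pr q \<notin> tau \<or> \<bar>q$3\<bar> < H \<and> h i (pr q) = 0" "pr q \<noteq> b 0" "pr q \<in> B"
proof -
  have q: "pr q \<in> B" "\<bar>q$3\<bar> \<le> H" "\<bar>q$3\<bar> = H \<or> (\<exists>i<k. h i (pr q) = 0)" "q \<notin> T"
    using assms(1) by (auto simp: frontier_Q)
  then show "pr q \<in> B" "pr q \<noteq> b 0" by (auto simp: T_def)
  then show "\<bar>q$3\<bar> = H \<and> pr q \<notin> tau \<or> \<bar>q$3\<bar> < H \<and> h i (pr q) = 0"
    using q lateral_unroll(2)[OF _ assms(2) _ _ assms(3)] by (auto simp: T_def)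
qed

text \<open>Makes the choice of a piece in \<open>\<phi>\<close> immaterial: in a base, pieces meet
  only inside the cut, and on the lateral surface only at a vertical edge, where both formulas give
  the same point.\<close>

lemma unroll_agree:
  assumes q: "q \<in> frontier Q - T" and i: "i < k" "pr q \<in> piece i" and j: "j < k" "pr q \<in> piece j"
  shows "unroll i q = unroll j q"
proof (cases "i = j")
  case False
  then have "pr q \<in> tau" using tau_pieces_meet i j by blast
  then have "h i (pr q) = 0" "pr q \<noteq> b 0" "pr q \<in> B" using frontier_minus_T[OF q i] by auto
  then show ?thesis using lateral_unroll(1)[OF i(1) j(1)] j by simp
qed simp

definition \<phi> :: "real^3 \<Rightarrow> real^2" where
  "\<phi> q = unroll (SOME i. i < k \<and> pr q \<in> piece i) q"

lemma \<phi>_eq: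
  assumes "q \<in> frontier Q - T" "i < k" "pr q \<in> piece i" shows "\<phi> q = unroll i q"
proof -
  have "(SOME i. i < k \<and> pr q \<in> piece i) < k \<and> pr q \<in> piece (SOME i. i < k \<and> pr q \<in> piece i)"
    by (rule someI[of "\<lambda>i. i < k \<and> pr q \<in> piece i"]) (use assms in auto)
  then show ?thesis unfolding \<phi>_def using unroll_agree[OF assms(1)] assms by blast
qed

lemma in_some_piece: "q \<in> frontier Q - T \<Longrightarrow> \<exists>i<k. pr q \<in> piece i"
  using pieces_cover by (auto simp: frontier_Q)

lemma closed_piece: "closed (piece i)"
proof -
  have "piece i = {p. 0 \<le> x i p} \<inter> {p. x i p \<le> 2} \<inter> {p. 0 \<le> h i p} \<inter> {p. C1 i p \<le> 0} \<inter> {p. C2 i p \<le> 0} \<inter> {p. C3 i p \<le> 0}"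
    using piece_coords by auto
  also have "closed \<dots>" unfolding C1_def C2_def C3_def
    by (intro closed_Int closed_Collect_le continuous_on_diff continuous_on_mult continuous_on_const continuous_coords)
  finally show ?thesis .
qed

lemma closed_pr_vimage: "closed S \<Longrightarrow> closed (pr -` S)"
  using continuous_closed_vimage continuous_pr by (metis continuous_on_eq_continuous_at open_UNIV UNIV_I)

lemma continuous_unroll: "continuous_on UNIV (unroll i)"
proof -
  have c: "continuous_on UNIV (\<lambda>q. x i (pr q))" "continuous_on UNIV (\<lambda>q. h i (pr q))"
    by (intro continuous_on_compose2[OF continuous_coords(2)[of UNIV] continuous_pr] continuous_on_compose2[OF continuous_coords(1)[of UNIV] continuous_pr] subset_UNIV)+
  have "unroll i = (\<lambda>q. \<chi> j. if j = 1 then 2 * real i + x i (pr q) else q$3 + q$3 / H * h i (pr q))"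
    by (rule ext) (simp add: unroll_def vec2_eq_iff)
  moreover have "continuous_on UNIV (\<lambda>q. \<chi> j::2. if j = 1 then 2 * real i + x i (pr q) else q$3 + q$3 / H * h i (pr q))"
  proof (rule continuous_on_vec_lambda)
    fix j :: 2
    have "continuous_on UNIV (\<lambda>q::real^3. q$3)" by (intro continuous_intros)
    then show "continuous_on UNIV (\<lambda>q. if j = 1 then 2 * real i + x i (pr q) else q$3 + q$3 / H * h i (pr q))"
      using c H by (cases "j = 1") (simp_all add: continuous_on_add continuous_on_mult continuous_on_divide)
  qed
  ultimately show ?thesis by simp
qed

lemma continuous_\<phi>: "continuous_on (frontier Q - T) \<phi>"
  unfolding continuous_on_closed_invariant
proof (intro allI impI)
  fix W :: "(real^2) set" assume W: "closed W"
  \<comment> \<open>The finitely many pieces are closed, so the preimage of a closed set is a finite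
    union of relatively closed sets.\<close>
  let ?W = "\<Union>i<k. pr -` piece i \<inter> unroll i -` W"
  have "closed (unroll i -` W)" for i
    using continuous_closed_vimage[OF W] continuous_unroll by (metis continuous_on_eq_continuous_at open_UNIV UNIV_I)
  then have "closed ?W" by (intro closed_UN ballI closed_Int closed_pr_vimage closed_piece) auto
  moreover have "?W \<inter> (frontier Q - T) = \<phi> -` W \<inter> (frontier Q - T)"
  proof (intro set_eqI)
    fix q
    show "q \<in> ?W \<inter> (frontier Q - T) \<longleftrightarrow> q \<in> \<phi> -` W \<inter> (frontier Q - T)"
    proof (cases "q \<in> frontier Q - T")
      case True
      then obtain i where i: "i < k" "pr q \<in> piece i" using in_some_piece by blast
      have "unroll j q = \<phi> q" if "j < k" "pr q \<in> piece j" for j using \<phi>_eq[OF True that] by simp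
      then have "q \<in> ?W \<longleftrightarrow> \<phi> q \<in> W" using i by auto
      then show ?thesis by simp
    next
      case False
      then show ?thesis by blast
    qed
  qed
  ultimately show "\<exists>W'. closed W' \<and> W' \<inter> (frontier Q - T) = \<phi> -` W \<inter> (frontier Q - T)" by blast
qed

lemma g_even: "i \<le> k \<Longrightarrow> R.g (2 * real i) = H"
  using R.g_break[of "3 * i"] RX_simps(1) RY_simps(1) by simp

lemma \<phi>_in_U: assumes q: "q \<in> frontier Q - T" shows "\<phi> q \<in> R.U"
proof -
  obtain i where i: "i < k" "pr q \<in> piece i" using in_some_piece[OF q] by blast
  have p: "0 \<le> x i (pr q)" "x i (pr q) \<le> 2" "0 \<le> h i (pr q)" "H + h i (pr q) \<le> R.g (2 * real i + x i (pr q))"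
    using i piece_roof by auto
  note f = frontier_minus_T[OF q i]
  have ik: "real i + 1 \<le> real k" using i by linarith
  \<comment> \<open>At either end of the strip the roof has height \<open>H\<close>, so the point
    would lie over \<open>b 0\<close>, where the surface is cut.\<close>
  have "0 < 2 * real i + x i (pr q)"
  proof (rule ccontr)
    assume "\<not> 0 < 2 * real i + x i (pr q)"
    then have "2 * real i + x i (pr q) = 0" "i = 0" "x i (pr q) = 0" using p by auto
    then have "h i (pr q) = 0" using p g_even[of 0] by simp
    then have "pr q = b 0" using \<open>i = 0\<close> \<open>x i (pr q) = 0\<close> by (intro coords_inject[of i]) (auto simp: coords_b)
    then show False using f by simp
  qed
  moreover have "2 * real i + x i (pr q) < 2 * real k"
  proof (rule ccontr)
    assume "\<not> 2 * real i + x i (pr q) < 2 * real k"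
    then have *: "2 * real i + x i (pr q) = 2 * real k" "Suc i = k" "x i (pr q) = 2" using p ik by auto
    moreover have "R.g (2 * real i + x i (pr q)) = H" unfolding *(1) by (rule g_even) simp
    ultimately have "h i (pr q) = 0" using p by linarith
    then have "pr q = b (Suc i)" using *(3) coords_b(3,4)[of i] by (intro coords_inject[of i]) auto
    then show False using f b_k *(2) by simp
  qed
  moreover have "\<bar>q$3 + q$3 / H * h i (pr q)\<bar> < R.g (2 * real i + x i (pr q))"
  proof (cases "\<bar>q$3\<bar> = H")
    case True
    then have "H + h i (pr q) < R.g (2 * real i + x i (pr q))" using f not_tau_roof[OF i] by auto
    moreover have "q$3 + q$3 / H * h i (pr q) = q$3 / H * (H + h i (pr q))" using H by (simp add: field_simps)
    then have "\<bar>q$3 + q$3 / H * h i (pr q)\<bar> = \<bar>q$3\<bar> / H * \<bar>H + h i (pr q)\<bar>" using H by (simp add: abs_mult)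
    then have "\<bar>q$3 + q$3 / H * h i (pr q)\<bar> = H + h i (pr q)" using True H p by simp
    ultimately show ?thesis by simp
  next
    case False
    then show ?thesis using f p by auto
  qed
  ultimately show ?thesis unfolding \<phi>_eq[OF q i] unroll_def R.U_def by (simp add: RX_ends)
qed

lemma edge_point:
  assumes i: "i < k" and s: "0 \<le> s" "s \<le> 2" and h: "h i p = 0" and x: "x i p = s"
  shows "p \<in> piece i"
proof (rule edge_in_piece[OF i _ h])
  have "p = (1 - s / 2) *\<^sub>R b i + (s / 2) *\<^sub>R b (Suc i)"
  proof (rule coords_inject[of i])
  qed (unfold affine_segment, simp_all add: coords_b h x)
  moreover have "b i \<in> B" "b (Suc i) \<in> B" using b_in_B i by auto
  ultimately show "p \<in> B" using convexD_alt[OF convex_B, of "b i" "b (Suc i)" "s / 2"] s by simp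
qed

lemma U_in_image: assumes v: "v \<in> R.U" shows "v \<in> \<phi> ` (frontier Q - T)"
proof -
  have v: "0 < v$1" "v$1 < 2 * real k" "\<bar>v$2\<bar> < R.g (v$1)" using v by (auto simp: R.U_def RX_ends)
  define i where "i = nat \<lfloor>v$1 / 2\<rfloor>"
  have "real i = of_int \<lfloor>v$1 / 2\<rfloor>" using v by (simp add: i_def)
  then have "real i \<le> v$1 / 2" "v$1 / 2 < real i + 1" by linarith+
  then have i: "2 * real i \<le> v$1" "v$1 \<le> 2 * real i + 2" "i < k" using v by auto
  define s where "s = v$1 - 2 * real i"
  have s: "0 \<le> s" "s \<le> 2" "2 * real i + s = v$1" using i by (auto simp: s_def)
  \<comment> \<open>Ordinates within the band come from lateral faces; beyond it the level
    \<open>z\<close> is that of a base and the excess \<open>e\<close> over \<open>H\<close> is the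
    distance from the side.\<close>
  define z where "z = (if \<bar>v$2\<bar> < H then v$2 else if 0 < v$2 then H else - H)"
  define e where "e = (if \<bar>v$2\<bar> < H then 0 else \<bar>v$2\<bar> - H)"
  define p where "p = n i * Complex (A - e) (s - 1)"
  have xp: "x i p = s" and hp: "h i p = e" by (simp_all add: p_def x_h_point)
  define q where "q = pt p z"
  have q: "pr q = p" "q$3 = z" by (simp_all add: q_def)
  have "p \<in> piece i"
  proof (cases "\<bar>v$2\<bar> < H")
    case True then show ?thesis using edge_point[OF i(3) s(1,2)] xp hp by (simp add: e_def)
  next
    case False
    then show ?thesis unfolding piece_roof[OF i(3)] xp hp s(3) using s v by (simp add: e_def)
  qed
  then have pB: "p \<in> B" using piece_in_B i by blast
  have zH: "\<bar>z\<bar> \<le> H" "\<bar>z\<bar> = H \<or> e = 0" using H by (auto simp: z_def e_def)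
  have "q \<in> frontier Q" unfolding frontier_Q using q pB zH hp i by auto
  moreover have "q \<notin> T"
  proof (cases "\<bar>v$2\<bar> < H")
    case True
    then have e0: "e = 0" "\<bar>z\<bar> < H" by (auto simp: e_def z_def)
    have "p \<noteq> b 0"
    proof
      assume "p = b 0"
      then have "adj i 0" using h_b_zero_iff[of 0 i] hp e0 i k_ge by simp
      then have "i = 0 \<or> i = k - 1" by (auto simp: adj_def)
      then show False
      proof
        assume "i = 0" then show False using \<open>p = b 0\<close> xp s v coords_b(1)[of 0] by simp
      next
        assume i': "i = k - 1"
        then have "Suc i = k" using k_ge by simp
        then have "x i p = 2" using \<open>p = b 0\<close> b_k coords_b(3)[of i] by simp
        then show False using xp s v \<open>Suc i = k\<close> by auto
      qed
    qed
    then show ?thesis using e0 q by (auto simp: T_def)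
  next
    case False
    then have "H + h i p < R.g (2 * real i + x i p)" unfolding xp hp s(3) using v by (simp add: e_def)
    then have "p \<notin> tau" using not_tau_roof[OF i(3) \<open>p \<in> piece i\<close>] by simp
    moreover have "b 0 \<in> tau" by (rule tau_b) simp
    ultimately show ?thesis using q by (auto simp: T_def)
  qed
  ultimately have qS: "q \<in> frontier Q - T" by blast
  have "\<phi> q = unroll i q" using \<phi>_eq[OF qS i(3)] q \<open>p \<in> piece i\<close> by simp
  also have "\<dots> = v" using H by (auto simp: unroll_def vec2_eq_iff q xp hp s(3) z_def e_def)
  finally show ?thesis using qS by blast
qed

lemma inj_\<phi>: "inj_on \<phi> (frontier Q - T)"
proof (rule inj_onI)
  fix q q' assume q: "q \<in> frontier Q - T" and q': "q' \<in> frontier Q - T" and eq: "\<phi> q = \<phi> q'"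
  obtain i where i: "i < k" "pr q \<in> piece i" using in_some_piece[OF q] by blast
  obtain j where j: "j < k" "pr q' \<in> piece j" using in_some_piece[OF q'] by blast
  have p: "0 \<le> x i (pr q)" "x i (pr q) \<le> 2" "0 \<le> h i (pr q)" "H + h i (pr q) \<le> R.g (2 * real i + x i (pr q))"
    using i piece_roof by auto
  have p': "0 \<le> x j (pr q')" "x j (pr q') \<le> 2" "0 \<le> h j (pr q')" "H + h j (pr q') \<le> R.g (2 * real j + x j (pr q'))"
    using j piece_roof by auto
  have e: "2 * real i + x i (pr q) = 2 * real j + x j (pr q')"
    "q$3 + q$3 / H * h i (pr q) = q'$3 + q'$3 / H * h j (pr q')"
    using eq unfolding \<phi>_eq[OF q i] \<phi>_eq[OF q' j] unroll_def vec2_eq_iff by simp_all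
  have f: "\<bar>q$3\<bar> = H \<or> \<bar>q$3\<bar> < H \<and> h i (pr q) = 0" "\<bar>q'$3\<bar> = H \<or> \<bar>q'$3\<bar> < H \<and> h j (pr q') = 0"
    using frontier_minus_T(1)[OF q i] frontier_minus_T(1)[OF q' j] by auto
  have ph: "q$3 = q'$3 \<and> h i (pr q) = h j (pr q')"
  proof -
    \<comment> \<open>The ordinate determines level and distance: inside the band the distance is 0,
      elsewhere the level is \<open>H\<close> or \<open>- H\<close> and the excess over
      \<open>H\<close> is the distance.\<close>
    have clamp: "z = z' \<and> a = a'" if "z + z / H * a = z' + z' / H * a'" "0 \<le> a" "0 \<le> a'"
      "\<bar>z\<bar> = H \<or> \<bar>z\<bar> < H \<and> a = 0" "\<bar>z'\<bar> = H \<or> \<bar>z'\<bar> < H \<and> a' = 0" for z z' a a' :: real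
    proof -
      have "z = H \<or> z = - H \<or> (\<bar>z\<bar> < H \<and> a = 0)" "z' = H \<or> z' = - H \<or> (\<bar>z'\<bar> < H \<and> a' = 0)"
        using that(4,5) by linarith+
      then show ?thesis using that(1-3) H by (elim disjE) auto
    qed
    show ?thesis by (rule clamp[OF e(2) p(3) p'(3) f])
  qed
  \<comment> \<open>Different strips share only a vertical line over a common corner, and there
    \<open>g_even\<close> forces both distances to be 0.\<close>
  have diff: "pr u = pr u'" if "i < j" "j < k" "x i (pr u) \<le> 2" "0 \<le> x j (pr u')" "2 * real i + x i (pr u) = 2 * real j + x j (pr u')"
    "H + h i (pr u) \<le> R.g (2 * real i + x i (pr u))" "H + h j (pr u') \<le> R.g (2 * real j + x j (pr u'))"
    "0 \<le> h i (pr u)" "0 \<le> h j (pr u')" for i j u u'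
  proof -
    have "real i + 1 \<le> real j" using that by linarith
    then have *: "j = Suc i" "x i (pr u) = 2" "x j (pr u') = 0" using that by auto
    then have **: "2 * real i + x i (pr u) = 2 * real j" "2 * real j + x j (pr u') = 2 * real j" by auto
    have "R.g (2 * real j) = H" using that by (intro g_even) auto
    then have "H + h i (pr u) \<le> H" "H + h j (pr u') \<le> H" using that(6,7) unfolding ** by auto
    then have "h i (pr u) = 0" "h j (pr u') = 0" using that by auto
    then have "pr u = b (Suc i)" "pr u' = b j"
      using * by (auto intro: coords_inject[of i] coords_inject[of j] simp: coords_b)
    then show ?thesis using * by simp
  qed
  have "pr q = pr q'"
  proof (cases i j rule: linorder_cases)
    case less then show ?thesis using diff[of i j q q'] e p p' j by simp
  next
    case equal then show ?thesis using e ph by (intro coords_inject[of i]) auto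
  next
    case greater then show ?thesis using diff[of j i q' q] e p p' i by simp
  qed
  then show "q = q'" using ph by (simp add: vec3_eq_iff)
qed

lemma \<phi>_isometric:
  assumes F: "F facet_of Q" and C: "C \<in> components (F - T)" and q: "q \<in> C" "q' \<in> C"
  shows "dist (\<phi> q) (\<phi> q') = dist q q'"
proof -
  have "F \<noteq> Q" "F face_of Q" using F by (auto simp: facet_of_def)
  then have "F \<subseteq> frontier Q"
    using face_of_subset_rel_frontier rel_frontier_nonempty_interior[OF interior_Q_nonempty] by metis
  then have CS: "C \<subseteq> frontier Q - T" and CF: "C \<subseteq> F" using in_components_subset[OF C] by auto
  have conC: "connected C" "C \<noteq> {}" using C in_components_connected in_components_nonempty by auto
  have sq: "dist (unroll i q) (unroll i q') = dist q q'"
    if "(x i (pr q) - x i (pr q'))\<^sup>2 + (q$3 + q$3 / H * h i (pr q) - (q'$3 + q'$3 / H * h i (pr q')))\<^sup>2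
      = (x i (pr q) - x i (pr q'))\<^sup>2 + (h i (pr q) - h i (pr q'))\<^sup>2 + (q$3 - q'$3)\<^sup>2" for i
  proof -
    have "dist (unroll i q) (unroll i q') = sqrt ((dist q q')\<^sup>2)"
      unfolding dist_vec2 dist_vec3 dist_coords[of _ _ i] using that by (simp add: unroll_def)
    then show ?thesis by simp
  qed
  \<comment> \<open>In one base the closed pieces overlap only inside the cut, so a connected set
    off the cut stays in one piece, where a single rigid formula applies.\<close>
  have top: ?thesis if s: "\<And>q. q \<in> C \<Longrightarrow> q$3 = s" "\<bar>s\<bar> = H" for s
  proof -
    have "\<exists>i\<in>{..<k}. C \<subseteq> pr -` piece i"
    proof (rule connected_subset_one_of_closed_cover)
      show "C \<subseteq> \<Union> ((\<lambda>i. pr -` piece i) ` {..<k})" using CS in_some_piece by fastforce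
      show "closedin (top_of_set C) (C \<inter> pr -` piece i)" for i
        by (intro closedin_closed_Int closed_pr_vimage closed_piece)
      show "C \<inter> pr -` piece i \<inter> pr -` piece j = {}" if "i \<in> {..<k}" "j \<in> {..<k}" "i \<noteq> j" for i j
      proof -
        have "q \<in> T" if "q \<in> C" "pr q \<in> piece i" "pr q \<in> piece j" for q
          using tau_pieces_meet[of i "pr q" j] \<open>i \<in> {..<k}\<close> \<open>j \<in> {..<k}\<close> \<open>i \<noteq> j\<close> that s by (simp add: T_def)
        then show ?thesis using CS by auto
      qed
    qed (use conC in auto)
    then obtain i where i: "i < k" "C \<subseteq> pr -` piece i" by auto
    have "\<phi> q = unroll i q" "\<phi> q' = unroll i q'" using \<phi>_eq[of _ i] q CS i by auto
    moreover have "dist (unroll i q) (unroll i q') = dist q q'"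
    proof (rule sq)
      have "s = H \<or> s = - H" using s(2) by linarith
      then show "(x i (pr q) - x i (pr q'))\<^sup>2 + (q$3 + q$3 / H * h i (pr q) - (q'$3 + q'$3 / H * h i (pr q')))\<^sup>2
        = (x i (pr q) - x i (pr q'))\<^sup>2 + (h i (pr q) - h i (pr q'))\<^sup>2 + (q$3 - q'$3)\<^sup>2"
        using s(1)[OF q(1)] s(1)[OF q(2)] H by (auto simp: power2_commute)
    qed
    ultimately show ?thesis by simp
  qed
  show ?thesis using facet_cases[OF F]
  proof (elim disjE)
    assume "\<exists>i<k. \<forall>q\<in>F. h i (pr q) = 0"
    then obtain i where i: "i < k" "\<And>q. q \<in> F \<Longrightarrow> h i (pr q) = 0" by blast
    have "pr u \<in> piece i" if "u \<in> C" for u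
      using that CS CF i by (intro edge_in_piece) (auto simp: frontier_Q)
    then have "\<phi> q = unroll i q" "\<phi> q' = unroll i q'" using \<phi>_eq[of _ i] q CS i(1) by auto
    moreover have "h i (pr q) = 0" "h i (pr q') = 0" using i(2) q CF by auto
    ultimately show ?thesis using sq[of i] by simp
  next
    assume "\<forall>q\<in>F. q$3 = H" then show ?thesis using top[of H] CF H by auto
  next
    assume "\<forall>q\<in>F. q$3 = - H" then show ?thesis using top[of "- H"] CF H by auto
  qed
qed

lemma unfolds: "unfolds_to Q T R.P"
  unfolding unfolds_to_def
proof (intro conjI exI[of _ \<phi>])
  show "\<phi> ` (frontier Q - T) = interior R.P"
    unfolding R.interior_P using \<phi>_in_U U_in_image by blast
qed (use R.simple_polygon_P continuous_\<phi> inj_\<phi> \<phi>_isometric in auto)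

end

section \<open>The cut tree and its nodes\<close>

context prism_tree begin

definition tip :: "nat \<Rightarrow> complex" where "tip i = tri i (eps (Suc i)) 0"

lemma tip_ctr: "eps (Suc i) = 0 \<Longrightarrow> tip i = ctr"
  by (simp add: tip_def tri_def)

lemma hair_segment: "hair i = closed_segment (tip i) (b (Suc i))"
proof -
  have "tri i (eps (Suc i) * (1 - w)) w = (1 - w) *\<^sub>R tip i + w *\<^sub>R b (Suc i)" for w
    by (simp add: tip_def tri_def algebra_simps)
  then show ?thesis by (auto simp: hair_def in_segment)
qed

lemma hair_ends: "tip i \<in> hair i" "b (Suc i) \<in> hair i"
  by (simp_all add: hair_segment)

text \<open>By uniqueness of the barycentric coordinates, branches can meet only on a common spoke,
  where at least one of them starts. Two shifted branches never meet, since the branch preceding a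
  shifted one is unshifted.\<close>

lemma hair_meet:
  assumes "i < k" "j < k" "i \<noteq> j" "p \<in> hair i" "p \<in> hair j"
  shows "(p = ctr \<and> eps (Suc i) = 0 \<and> eps (Suc j) = 0) \<or>
    (p = tip i \<and> eps (Suc i) \<noteq> 0 \<and> eps (Suc j) = 0 \<and> b i = b (Suc j)) \<or>
    (p = tip j \<and> eps (Suc j) \<noteq> 0 \<and> eps (Suc i) = 0 \<and> b j = b (Suc i))"
proof -
  obtain w where w: "0 \<le> w" "w \<le> 1" "p = tri i (eps (Suc i) * (1 - w)) w" using assms(4) by (auto simp: hair_def)
  obtain u where u: "0 \<le> u" "u \<le> 1" "p = tri j (eps (Suc j) * (1 - u)) u" using assms(5) by (auto simp: hair_def)
  have nn: "0 \<le> eps (Suc i) * (1 - w)" "0 \<le> eps (Suc j) * (1 - u)" using w u eps_cases(2) by auto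
  have "tri i (eps (Suc i) * (1 - w)) w = tri j (eps (Suc j) * (1 - u)) u" using w u by simp
  from cone_unique[OF assms(1,2) this nn(1) w(1) nn(2) u(1)] assms(3)
  consider "eps (Suc i) * (1 - w) = 0" "w = 0" "eps (Suc j) * (1 - u) = 0" "u = 0"
    | "w = 0" "eps (Suc j) * (1 - u) = 0" "eps (Suc i) * (1 - w) = u" "b i = b (Suc j)"
    | "u = 0" "eps (Suc i) * (1 - w) = 0" "w = eps (Suc j) * (1 - u)" "b (Suc i) = b j" by auto
  then show ?thesis
  proof cases
    case 1
    then show ?thesis using w by (simp add: tri_def)
  next
    case 2
    show ?thesis
    proof (cases "eps (Suc i) = 0")
      case True then show ?thesis using 2 w by (simp add: tri_def)
    next
      case False
      have "eps (Suc j) = eps i" using b_eps_eq[OF assms(1,2)] 2 by simp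
      then have "eps (Suc j) = 0" using eps_pos(4)[OF False] by simp
      then show ?thesis using 2 w False by (simp add: tip_def)
    qed
  next
    case 3
    show ?thesis
    proof (cases "eps (Suc j) = 0")
      case True then show ?thesis using 3 u by (simp add: tri_def)
    next
      case False
      have "eps (Suc i) = eps j" using b_eps_eq[OF assms(2,1)] 3 by simp
      then have "eps (Suc i) = 0" using eps_pos(4)[OF False] by simp
      then show ?thesis using 3 u False by (simp add: tip_def)
    qed
  qed
qed

lemma b_Suc_inj: "i < k \<Longrightarrow> j < k \<Longrightarrow> b (Suc i) = b (Suc j) \<Longrightarrow> i = j"
proof -
  assume a: "i < k" "j < k" "b (Suc i) = b (Suc j)"
  define s where "s i = (if Suc i = k then 0 else Suc i)" for i
  have "b (s i) = b (s j)" "s i < k" "s j < k" using a b_k k_ge by (auto simp: s_def)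
  then have "s i = s j" using b_inj by blast
  then show "i = j" by (auto simp: s_def split: if_splits)
qed

lemma tip_attached:
  assumes "i < k" "eps (Suc i) \<noteq> 0"
  obtains j where "j < k" "j \<noteq> i" "b i = b (Suc j)" "eps (Suc j) = 0" "tip i \<in> hair j"
proof -
  obtain j where j: "j < k" "b i = b (Suc j)" "eps i = eps (Suc j)" "i \<noteq> j" using b_prev[OF assms(1)] by metis
  have e: "eps (Suc j) = 0" using j eps_pos(4)[OF assms(2)] by simp
  have "tip i = tri j (eps (Suc j) * (1 - eps (Suc i))) (eps (Suc i))"
    using spoke_eq[OF j(2)] e by (simp add: tip_def)
  then have "tip i \<in> hair j" using eps_cases[of "Suc i"] unfolding hair_def by fastforce
  then show ?thesis using that j e by metis
qed

lemma h_tip_pos: "l < k \<Longrightarrow> i < k \<Longrightarrow> 0 < h l (tip i)"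
proof -
  assume l: "l < k" and i: "i < k"
  have "h l (tip i) = (1 - eps (Suc i)) * h l ctr + eps (Suc i) * h l (b i)"
    unfolding tip_def tri_def affine_comb by simp
  moreover have "0 < (1 - eps (Suc i)) * h l ctr" using coords_ctr_bounds(4) eps_cases(3)[of "Suc i"] by simp
  moreover have "0 \<le> eps (Suc i) * h l (b i)" using h_b_nonneg[OF i l] eps_cases(2)[of "Suc i"] by simp
  ultimately show ?thesis by simp
qed

lemma tip_ne_b: assumes "i < k" "j \<le> k" shows "tip i \<noteq> b j"
proof -
  define l where "l = (if j = k then 0 else j)"
  have l: "l < k" "b j = b l" using assms b_k k_ge by (auto simp: l_def)
  then have "h l (b j) = 0" by (simp add: coords_b)
  then show ?thesis using h_tip_pos[OF l(1) assms(1)] by auto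
qed

lemma ctr_ne_b: "j \<le> k \<Longrightarrow> ctr \<noteq> b j"
proof -
  assume "j \<le> k"
  moreover have "tip (k - 1) = ctr" "k - 1 < k" using eps_0 k_ge by (auto intro: tip_ctr)
  ultimately show ?thesis using tip_ne_b[of "k - 1" j] by simp
qed

lemma ctr_notin_hair: assumes "i < k" "eps (Suc i) \<noteq> 0" shows "ctr \<notin> hair i"
proof
  assume "ctr \<in> hair i"
  then obtain w where w: "0 \<le> w" "ctr = tri i (eps (Suc i) * (1 - w)) w" "w \<le> 1" by (auto simp: hair_def)
  have eq: "tri i (eps (Suc i) * (1 - w)) w = tri i 0 0" using w by (simp add: tri_0)
  have "0 \<le> eps (Suc i) * (1 - w)" using w eps_cases(2)[of "Suc i"] by simp
  from cone_unique[OF assms(1,1) eq this w(1) order_refl order_refl]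
  have "eps (Suc i) * (1 - w) = 0" "w = 0" by argo+
  then show False using assms(2) by simp
qed

text \<open>Branches that start at \<open>ctr\<close>, in contrast to \<open>twigs\<close>. As a
  twig hangs on a spoke, the tree is assembled in two layers.\<close>

definition spokes :: "nat set" where "spokes = {i. i < k \<and> eps (Suc i) = 0}"
definition twigs :: "nat set" where "twigs = {i. i < k \<and> eps (Suc i) \<noteq> 0}"

lemma tau_split: "tau = {ctr} \<union> \<Union>(hair ` spokes) \<union> \<Union>(hair ` twigs)"
  using ctr_in_tau by (auto simp: tau_def spokes_def twigs_def)

lemma AR_closed_tau: "AR tau" "closed tau"
proof -
  have hair: "AR (hair i)" "closed (hair i)" for i
    unfolding hair_segment by (auto intro: convex_imp_AR)
  have fin: "finite spokes" "finite twigs" by (auto simp: spokes_def twigs_def)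
  have L: "AR ({ctr} \<union> \<Union>(hair ` spokes)) \<and> closed ({ctr} \<union> \<Union>(hair ` spokes))"
  proof (rule AR_Un_finite_tree[OF fin(1)])
    show "\<exists>p. hair i \<inter> {ctr} = {p}" if "i \<in> spokes" for i
      using that hair_ends(1)[of i] tip_ctr[of i] by (auto simp: spokes_def)
    show "hair i \<inter> hair j \<subseteq> {ctr}" if "i \<in> spokes" "j \<in> spokes" "i \<noteq> j" for i j
      using hair_meet[of i j] that by (auto simp: spokes_def)
  qed (use hair AR_singleton in auto)
  have "AR (({ctr} \<union> \<Union>(hair ` spokes)) \<union> \<Union>(hair ` twigs)) \<and> closed (({ctr} \<union> \<Union>(hair ` spokes)) \<union> \<Union>(hair ` twigs))"
  proof (rule AR_Un_finite_tree[OF fin(2)])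
    show "\<exists>p. hair i \<inter> ({ctr} \<union> \<Union>(hair ` spokes)) = {p}" if i: "i \<in> twigs" for i
    proof (intro exI[of _ "tip i"] equalityI subsetI)
      fix p assume "p \<in> {tip i}"
      moreover obtain j where "j < k" "eps (Suc j) = 0" "tip i \<in> hair j"
        using tip_attached[of i] i unfolding twigs_def by blast
      ultimately show "p \<in> hair i \<inter> ({ctr} \<union> \<Union>(hair ` spokes))"
        using hair_ends(1)[of i] by (auto simp: spokes_def)
    next
      fix p assume p: "p \<in> hair i \<inter> ({ctr} \<union> \<Union>(hair ` spokes))"
      then have "p \<noteq> ctr" using ctr_notin_hair i by (auto simp: twigs_def)
      then obtain j where "j \<in> spokes" "p \<in> hair j" using p by blast
      then show "p \<in> {tip i}" using hair_meet[of i j p] p i \<open>p \<noteq> ctr\<close> by (auto simp: spokes_def twigs_def)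
    qed
    show "hair i \<inter> hair j \<subseteq> {ctr} \<union> \<Union>(hair ` spokes)" if "i \<in> twigs" "j \<in> twigs" "i \<noteq> j" for i j
      using hair_meet[of i j] that by (auto simp: twigs_def)
  qed (use hair L in auto)
  then show "AR tau" "closed tau" by (simp_all add: tau_split)
qed

section \<open>The tree lifted to the prism\<close>

definition level :: "real \<Rightarrow> (real^3) set" where "level z = (\<lambda>p. pt p z) ` tau"
definition post :: "(real^3) set" where "post = closed_segment (pt (b 0) (- H)) (pt (b 0) H)"

lemma post_eq: "post = {q. pr q = b 0 \<and> \<bar>q$3\<bar> \<le> H}"
proof (intro equalityI subsetI)
  fix q assume "q \<in> post"
  then obtain u where u: "0 \<le> u" "u \<le> 1" "q = (1 - u) *\<^sub>R pt (b 0) (- H) + u *\<^sub>R pt (b 0) H"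
    unfolding post_def in_segment by blast
  have "q = pt (b 0) ((1 - u) * (- H) + u * H)"
    unfolding u(3) pt_comb by (simp add: scaleR_left_diff_distrib)
  moreover have "0 \<le> u * H" "u * H \<le> 1 * H" using u H by (auto intro!: mult_right_mono simp del: mult_1)
  ultimately show "q \<in> {q. pr q = b 0 \<and> \<bar>q$3\<bar> \<le> H}" by (simp add: algebra_simps abs_le_iff)
next
  fix q assume "q \<in> {q. pr q = b 0 \<and> \<bar>q$3\<bar> \<le> H}"
  then have q: "pr q = b 0" "\<bar>q$3\<bar> \<le> H" by auto
  define u where "u = (q$3 + H) / (2 * H)"
  have u: "0 \<le> u" "u \<le> 1" using q H by (auto simp: u_def field_simps)
  have "(1 - u) * (- H) + u * H = q$3" using H by (simp add: u_def field_simps)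
  then have "q = (1 - u) *\<^sub>R pt (b 0) (- H) + u *\<^sub>R pt (b 0) H"
    unfolding pt_comb using q by (simp add: vec3_eq_iff algebra_simps)
  then show "q \<in> post" unfolding post_def in_segment using u by blast
qed

lemma level_eq: "level z = {q. pr q \<in> tau \<and> q$3 = z}"
  by (auto simp: level_def image_iff vec3_eq_iff)

lemma T_eq: "T = level H \<union> post \<union> level (- H)"
proof -
  have "\<bar>s\<bar> = H \<longleftrightarrow> s = H \<or> s = - H" for s using H by auto
  then show ?thesis unfolding T_def level_eq post_eq by auto
qed

lemma AR_level: "AR (level z)" "closed (level z)"
proof -
  have "tau homeomorphic level z"
  proof (rule homeomorphicI[of "\<lambda>p. pt p z" _ _ pr])
    show "pr ` level z = tau" by (auto simp: level_def image_image)
  qed (auto simp: level_def continuous_pt continuous_pr)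
  then show "AR (level z)" using AR_closed_tau(1) homeomorphic_AR_iff_AR by blast
  have "level z = pr -` tau \<inter> {q. q$3 = z}" by (auto simp: level_eq)
  also have "closed \<dots>" by (intro closed_Int closed_pr_vimage AR_closed_tau closed_Collect_eq continuous_intros)
  finally show "closed (level z)" .
qed

lemma AR_post: "AR post" "closed post"
  unfolding post_def by (auto intro: convex_imp_AR)

text \<open>The vertical cut touches each base tree only at its corner over \<open>b 0\<close>, so
  three absolute retracts are glued at single points.\<close>

lemma AR_T: "AR T"
proof -
  have b0: "b 0 \<in> tau" by (rule tau_b) simp
  have "level H \<inter> post = {pt (b 0) H}"
    using b0 H by (auto simp: level_eq post_eq vec3_eq_iff)
  then have 1: "AR (level H \<union> post)"
    by (intro AR_closed_Un) (use AR_level AR_post AR_singleton in auto)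
  have "(level H \<union> post) \<inter> level (- H) = {pt (b 0) (- H)}"
    using b0 H by (auto simp: level_eq post_eq vec3_eq_iff)
  then show ?thesis unfolding T_eq
    using AR_closed_Un[of "level H \<union> post" "level (- H)"] 1 AR_level AR_post AR_singleton[of "pt (b 0) (- H)"] by (simp add: closed_Un)
qed

lemma T_subset: "T \<subseteq> frontier Q"
proof
  fix q assume q: "q \<in> T"
  have "tau \<subseteq> B"
  proof
    fix p assume "p \<in> tau"
    then obtain i w where w: "i < k" "0 \<le> w" "w \<le> 1" "p = tri i (eps (Suc i) * (1 - w)) w"
      by (auto simp: tau_def hair_def)
    have "eps (Suc i) * (1 - w) \<le> 1 - w" using w eps_cases[of "Suc i"] by (simp add: mult_left_le_one_le)
    then show "p \<in> B" unfolding w(4) using w eps_cases(2)[of "Suc i"] by (intro tri_in_B) auto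
  qed
  moreover have "b 0 \<in> B" "h 0 (b 0) = 0" "0 < k" using b_in_B k_ge by (auto simp: coords_b)
  ultimately show "q \<in> frontier Q" using q unfolding T_def frontier_Q by auto
qed

lemma geometric_cut_tree_T: "geometric_cut_tree Q T"
  unfolding geometric_cut_tree_def
proof (intro conjI)
  show "T \<subseteq> frontier Q" by (rule T_subset)
  show "connected T" "simply_connected T"
    using AR_T AR_imp_contractible contractible_imp_connected contractible_imp_simply_connected by blast+
  show "\<exists>P. unfolds_to Q T P" using unfolds by blast
  define Ar where "Ar = insert (linepath (pt (b 0) (- H)) (pt (b 0) H))
     ((\<lambda>(i, z). linepath (pt (tip i) z) (pt (b (Suc i)) z)) ` ({..<k} \<times> {H, - H}))"
  have seg: "polygonal_arc (linepath p q)" if "p \<noteq> q" for p q :: "real^3"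
    unfolding polygonal_arc_def using that by (intro exI[of _ "[p, q]"]) (auto intro: arc_linepath)
  have "polygonal_arc g" if g: "g \<in> Ar" for g
    using g tip_ne_b H unfolding Ar_def by (auto intro!: seg)
  moreover have "T = \<Union> (path_image ` Ar)"
  proof -
    have "level z = (\<Union>i<k. path_image (linepath (pt (tip i) z) (pt (b (Suc i)) z)))" for z
      unfolding path_image_linepath pt_closed_segment hair_segment[symmetric] level_def tau_def by (simp add: image_UN)
    then show ?thesis unfolding T_eq Ar_def by (auto simp: post_def)
  qed
  ultimately show "\<exists>A. finite A \<and> A \<noteq> {} \<and> (\<forall>g\<in>A. polygonal_arc g) \<and> T = \<Union> (path_image ` A)"
    by (intro exI[of _ Ar]) (auto simp: Ar_def)
qed

section \<open>Nodes and arcs in the top base\<close>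

definition top_hair :: "nat \<Rightarrow> (real^3) set" where "top_hair i = (\<lambda>p. pt p H) ` hair i"
text \<open>The closed remainder demanded by \<open>point_degree_star\<close>. Only the top base is
  examined, so the bottom tree is kept whole.\<close>

definition others :: "nat set \<Rightarrow> (real^3) set" where
  "others I = (\<Union>i\<in>{..<k} - I. top_hair i) \<union> post \<union> level (- H)"

lemma top_hair_segment: "top_hair i = closed_segment (pt (tip i) H) (pt (b (Suc i)) H)"
  unfolding top_hair_def hair_segment pt_closed_segment ..

lemma closed_others: "closed (others I)"
  unfolding others_def top_hair_segment by (intro closed_Un closed_UN AR_post AR_level) auto

lemma T_others: "I \<subseteq> {..<k} \<Longrightarrow> T = (\<Union>i\<in>I. top_hair i) \<union> others I"
proof -
  assume "I \<subseteq> {..<k}"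
  moreover have "level H = (\<Union>i<k. top_hair i)" unfolding level_def tau_def top_hair_def by (simp add: image_UN)
  ultimately show ?thesis unfolding T_eq others_def by blast
qed

lemma top_in_others: "pt p H \<in> others I \<longleftrightarrow> (\<exists>i<k. i \<notin> I \<and> p \<in> hair i) \<or> p = b 0"
  using H by (auto simp: others_def top_hair_def post_eq level_eq)

text \<open>Nothing else touches such a branch away from its start: the vertical cut stands at the
  end of branch \<open>k - 1\<close>, and the last condition forbids twigs hanging on branch
  \<open>i\<close>.\<close>

definition free :: "nat \<Rightarrow> bool" where
  "free i \<longleftrightarrow> i < k \<and> i \<noteq> k - 1 \<and> (\<forall>l<k. eps (Suc l) \<noteq> 0 \<longrightarrow> b l \<noteq> b (Suc i))"

lemma b0_hair: assumes "i < k" "b 0 \<in> hair i" shows "i = k - 1"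
proof (rule ccontr)
  assume i: "i \<noteq> k - 1"
  have "b 0 \<in> hair (k - 1)" using hair_ends(2)[of "k - 1"] b_k k_ge by simp
  then have "b 0 = ctr \<or> b 0 = tip i \<or> b 0 = tip (k - 1)"
    using hair_meet[OF assms(1) _ i assms(2)] k_ge by auto
  then show False using ctr_ne_b[of 0] tip_ne_b[of i 0] tip_ne_b[of "k - 1" 0] assms(1) by auto
qed

lemma free_others:
  assumes f: "free i" and p: "p \<in> hair i" "pt p H \<in> others {i}"
  shows "p = tip i"
proof -
  have i: "i < k" "i \<noteq> k - 1" using f by (auto simp: free_def)
  then have "p \<noteq> b 0" using b0_hair p by blast
  then obtain l where l: "l < k" "l \<noteq> i" "p \<in> hair l" using p(2) by (auto simp: top_in_others)
  show ?thesis using hair_meet[OF i(1) l(1) l(2)[symmetric] p(1) l(3)] f l tip_ctr[of i] by (auto simp: free_def)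
qed

lemma node_ctr: "pt ctr H \<in> ct_nodes Q T"
proof -
  define C where "C = (\<lambda>i. pt (b (Suc i)) H) ` spokes"
  have fin: "finite spokes" by (simp add: spokes_def)
  have seg: "closed_segment (pt ctr H) (pt (b (Suc i)) H) = top_hair i" if "i \<in> spokes" for i
    using that tip_ctr[of i] unfolding top_hair_segment spokes_def by simp
  have "point_degree T (pt ctr H) (card C)"
  proof (rule point_degree_star)
    show "finite C" using fin by (simp add: C_def)
    show "pt ctr H \<notin> C" using ctr_ne_b by (auto simp: C_def spokes_def)
    show "closed (others spokes)" by (rule closed_others)
    show "pt ctr H \<notin> others spokes"
      using ctr_notin_hair ctr_ne_b[of 0] unfolding top_in_others by (auto simp: spokes_def)
    have "(\<Union>c\<in>C. closed_segment (pt ctr H) c) = (\<Union>i\<in>spokes. top_hair i)"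
      using seg by (auto simp: C_def)
    moreover have "spokes \<subseteq> {..<k}" by (auto simp: spokes_def)
    ultimately show "T = (\<Union>c\<in>C. closed_segment (pt ctr H) c) \<union> others spokes" using T_others by simp
    fix c d assume cd: "c \<in> C" "d \<in> C" "c \<noteq> d"
    then obtain i j where ij: "i \<in> spokes" "j \<in> spokes" "c = pt (b (Suc i)) H" "d = pt (b (Suc j)) H" "i \<noteq> j"
      by (auto simp: C_def)
    have "top_hair i \<inter> top_hair j \<subseteq> {pt ctr H}"
      using hair_meet[of i j] ij by (auto simp: top_hair_def spokes_def)
    then show "closed_segment (pt ctr H) c \<inter> closed_segment (pt ctr H) d = {pt ctr H}"
      using seg[OF ij(1)] seg[OF ij(2)] ij(3,4) by auto
  qed
  moreover have "card C \<noteq> 2"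
  proof -
    have "inj_on (\<lambda>i. pt (b (Suc i)) H) spokes" using b_Suc_inj by (auto simp: inj_on_def spokes_def)
    then have "card C = card spokes" unfolding C_def by (rule card_image)
    \<comment> \<open>These are the branches to the even corners 2, 4 and 6, which are never shifted
      and exist because \<open>7 \<le> k\<close>.\<close>
    moreover have "{1, 3, 5} \<subseteq> spokes" using k_ge by (auto simp: spokes_def eps_def)
    then have "card {1, 3, 5 :: nat} \<le> card spokes" using fin by (rule card_mono[rotated])
    ultimately show ?thesis by simp
  qed
  ultimately have "\<not> point_degree T (pt ctr H) 2" using point_degree_unique by blast
  moreover have "pt ctr H \<in> T" using ctr_in_tau H by (simp add: T_def)
  ultimately show ?thesis by (simp add: ct_nodes_def)
qed

lemma node_tip: assumes i: "i < k" shows "pt (tip i) H \<in> ct_nodes Q T"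
proof (cases "eps (Suc i) = 0")
  case True then show ?thesis using node_ctr tip_ctr by simp
next
  case False
  obtain j where j: "j < k" "j \<noteq> i" "b i = b (Suc j)" "eps (Suc j) = 0" "tip i \<in> hair j"
    using tip_attached[OF i False] .
  \<comment> \<open>From the start of a twig two segments run along the spoke carrying it and one
    along the twig itself, so the degree is 3.\<close>
  define C where "C = {pt ctr H, pt (b i) H, pt (b (Suc i)) H}"
  let ?x = "pt (tip i) H"
  have tipj: "?x \<in> closed_segment (pt ctr H) (pt (b i) H)"
    using j tip_ctr[OF j(4)] hair_segment[of j] unfolding pt_closed_segment by auto
  have hj: "closed_segment ?x (pt ctr H) \<union> closed_segment ?x (pt (b i) H) = top_hair j"
    using Un_closed_segment[OF tipj] tip_ctr[OF j(4)] j(3) unfolding top_hair_segment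
    by (simp add: closed_segment_commute)
  have hi: "closed_segment ?x (pt (b (Suc i)) H) = top_hair i" by (simp add: top_hair_segment)
  have meet: "top_hair i \<inter> top_hair j \<subseteq> {?x}"
    using hair_meet[OF i j(1) j(2)[symmetric]] False j(4) by (auto simp: top_hair_def)
  have tip_ctr': "tip i \<noteq> ctr" using hair_ends(1)[of i] ctr_notin_hair[OF i False] by auto
  have "b i \<noteq> b (Suc i)" using b_Suc_inj[OF j(1) i] j(2,3) by auto
  then have card: "card C = 3" using ctr_ne_b[of i] ctr_ne_b[of "Suc i"] i unfolding C_def by simp
  have "point_degree T ?x (card C)"
  proof (rule point_degree_star)
    show "finite C" by (simp add: C_def)
    show "?x \<notin> C" using tip_ne_b[OF i] i tip_ctr' by (auto simp: C_def)
    show "closed (others {i, j})" by (rule closed_others)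
    show "?x \<notin> others {i, j}"
    proof
      assume "?x \<in> others {i, j}"
      then obtain l where l: "l < k" "l \<noteq> i" "l \<noteq> j" "tip i \<in> hair l"
        unfolding top_in_others using tip_ne_b[OF i, of 0] by auto
      have "b i = b (Suc l)" using hair_meet[OF i l(1) l(2)[symmetric] hair_ends(1) l(4)] False by auto
      then show False using b_Suc_inj[OF l(1) j(1)] j(3) l(3) by simp
    qed
    have "(\<Union>c\<in>C. closed_segment ?x c) = top_hair i \<union> top_hair j"
      unfolding C_def hj[symmetric] hi[symmetric] by auto
    then show "T = (\<Union>c\<in>C. closed_segment ?x c) \<union> others {i, j}" using T_others[of "{i, j}"] i j(1) by simp
    have 1: "closed_segment ?x (pt ctr H) \<inter> closed_segment ?x (pt (b i) H) = {?x}"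
      using Int_closed_segment[of ?x "pt ctr H" "pt (b i) H"] tipj by (simp add: closed_segment_commute)
    have 2: "closed_segment ?x (pt ctr H) \<inter> closed_segment ?x (pt (b (Suc i)) H) = {?x}"
      "closed_segment ?x (pt (b i) H) \<inter> closed_segment ?x (pt (b (Suc i)) H) = {?x}"
      using meet unfolding hi[symmetric] hj[symmetric] by auto
    show "closed_segment ?x c \<inter> closed_segment ?x d = {?x}" if "c \<in> C" "d \<in> C" "c \<noteq> d" for c d
      using that 1 2 unfolding C_def by (auto simp: Int_commute)
  qed
  then have "\<not> point_degree T ?x 2" using point_degree_unique card by fastforce
  moreover have "?x \<in> T" using hair_ends(1)[of i] i H by (auto simp: T_def tau_def)
  ultimately show ?thesis by (simp add: ct_nodes_def)
qed

lemma node_vertex: "i < k \<Longrightarrow> pt (b (Suc i)) H \<in> ct_nodes Q T \<inter> poly_vertices Q"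
proof -
  assume i: "i < k"
  have "pt (b (Suc i)) H \<in> V"
  proof (cases "Suc i = k")
    case True then show ?thesis using b_k k_ge by (auto simp: V_def intro!: image_eqI[of _ _ "(0, H)"])
  next
    case False then show ?thesis using i by (auto simp: V_def intro!: image_eqI[of _ _ "(Suc i, H)"])
  qed
  moreover have "pt (b (Suc i)) H \<in> T" using hair_ends(2)[of i] i H by (auto simp: T_def tau_def)
  ultimately show ?thesis by (simp add: ct_nodes_def poly_vertices_Q)
qed

text \<open>Exactly two directions leave an inner point of a free spoke, and its distances to all
  sides are positive, so it is no corner either.\<close>

lemma not_node_spoke:
  assumes f: "free i" and e: "eps (Suc i) = 0" and p: "p \<in> hair i" "p \<noteq> ctr" "p \<noteq> b (Suc i)"
  shows "pt p H \<notin> ct_nodes Q T"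
proof -
  have i: "i < k" using f by (simp add: free_def)
  have tip: "tip i = ctr" using e by (rule tip_ctr)
  let ?a = "pt ctr H" and ?b = "pt (b (Suc i)) H" and ?x = "pt p H"
  have x: "?x \<in> closed_segment ?a ?b" using p(1) hair_segment[of i] tip unfolding pt_closed_segment by auto
  have "point_degree T ?x (card {?a, ?b})"
  proof (rule point_degree_star)
    show "?x \<notin> {?a, ?b}" using p by simp
    show "closed (others {i})" by (rule closed_others)
    show "?x \<notin> others {i}" using free_others[OF f p(1)] p(2) tip by auto
    have "(\<Union>c\<in>{?a, ?b}. closed_segment ?x c) = top_hair i"
      using Un_closed_segment[OF x] tip unfolding top_hair_segment by (simp add: closed_segment_commute)
    then show "T = (\<Union>c\<in>{?a, ?b}. closed_segment ?x c) \<union> others {i}" using T_others[of "{i}"] i by simp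
    have "closed_segment ?x ?a \<inter> closed_segment ?x ?b = {?x}"
      using Int_closed_segment[of ?x ?a ?b] x unfolding closed_segment_commute[of ?a ?x] by simp
    then show "closed_segment ?x c \<inter> closed_segment ?x d = {?x}" if "c \<in> {?a, ?b}" "d \<in> {?a, ?b}" "c \<noteq> d" for c d
      using that by (metis Int_commute insertE singletonD)
  qed simp
  moreover have "card {?a, ?b} = 2" using ctr_ne_b[of "Suc i"] i by simp
  ultimately have "point_degree T ?x 2" by simp
  moreover have "?x \<notin> V"
  proof
    assume "?x \<in> V"
    then obtain l where l: "l < k" "p = b l" by (auto simp: V_def)
    obtain u where u: "0 \<le> u" "u \<le> 1" "p = (1 - u) *\<^sub>R ctr + u *\<^sub>R b (Suc i)"
      using p(1) unfolding hair_segment tip in_segment by auto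
    have "u \<noteq> 1" using u p(3) by auto
    then have "0 < (1 - u) * h l ctr" using u coords_ctr_bounds(4)[of l] by simp
    moreover have "0 \<le> u * h l (b (Suc i))" using u b_in_B[of "Suc i"] i l by (simp add: B_def)
    moreover have "h l p = (1 - u) * h l ctr + u * h l (b (Suc i))" unfolding u(3) by (rule affine_segment)
    ultimately have "0 < h l p" by linarith
    then show False using l coords_b(2)[of l] by simp
  qed
  ultimately show ?thesis by (simp add: ct_nodes_def poly_vertices_Q)
qed

lemma arc_spoke:
  assumes f: "free i" and e: "eps (Suc i) = 0"
  shows "ct_arc Q T (pt (b (Suc i)) H) (pt ctr H)"
  unfolding ct_arc_def
proof (intro conjI exI)
  have i: "i < k" using f by (simp add: free_def)
  let ?g = "linepath (pt (b (Suc i)) H) (pt ctr H)"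
  have im: "path_image ?g = top_hair i"
    using tip_ctr[OF e] by (simp add: top_hair_segment closed_segment_commute)
  show "pt (b (Suc i)) H \<noteq> pt ctr H" using ctr_ne_b[of "Suc i"] i by auto
  then show "arc ?g" by (rule arc_linepath)
  show n: "pt (b (Suc i)) H \<in> ct_nodes Q T" "pt ctr H \<in> ct_nodes Q T" using node_vertex[OF i] node_ctr by auto
  show "path_image ?g \<subseteq> T" unfolding im using T_others[of "{i}"] i by auto
  have "pt p H \<in> {pt (b (Suc i)) H, pt ctr H}" if "p \<in> hair i" "pt p H \<in> ct_nodes Q T" for p
    using not_node_spoke[OF f e that(1)] that(2) by auto
  then have "path_image ?g \<inter> ct_nodes Q T \<subseteq> {pt (b (Suc i)) H, pt ctr H}" unfolding im top_hair_def by blast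
  then show "path_image ?g \<inter> ct_nodes Q T = {pt (b (Suc i)) H, pt ctr H}" using n by auto
qed auto

text \<open>Leaving the branch means passing its start, which is a node, whereas an arc of the
  combinatorial tree contains no nodes except its ends.\<close>

lemma arc_confined:
  assumes f: "free i" and arc: "ct_arc Q T (pt (b (Suc i)) H) q"
  shows "q \<in> top_hair i"
proof (rule ccontr)
  assume q: "q \<notin> top_hair i"
  have i: "i < k" using f by (simp add: free_def)
  let ?a = "pt (b (Suc i)) H" and ?s = "pt (tip i) H"
  obtain g where g: "arc g" "path_image g \<subseteq> T" "pathstart g = ?a" "pathfinish g = q"
    "path_image g \<inter> ct_nodes Q T = {?a, q}" using arc by (auto simp: ct_arc_def)
  have T: "T = top_hair i \<union> others {i}" using T_others[of "{i}"] i by simp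
  have "?s \<in> path_image g"
  proof (rule connected_meets_gate)
    show "connected (path_image g)" using g(1) by (simp add: arc_imp_path connected_path_image)
    show "path_image g \<subseteq> top_hair i \<union> others {i}" using g(2) T by simp
    show "closed (top_hair i)" by (simp add: top_hair_segment)
    show "closed (others {i})" by (rule closed_others)
    show "top_hair i \<inter> others {i} \<subseteq> {?s}" using free_others[OF f] by (auto simp: top_hair_def)
    have "?a \<in> top_hair i" by (simp add: top_hair_segment)
    then show "path_image g \<inter> top_hair i \<noteq> {}" using g(3) pathstart_in_path_image[of g] by auto
    have "q \<in> path_image g" using g(4) pathfinish_in_path_image[of g] by simp
    then show "path_image g \<inter> others {i} \<noteq> {}" using q g(2) T by blast
  qed
  then have "?s \<in> {?a, q}" using node_tip[OF i] g(5) by blast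
  moreover have "?s \<noteq> ?a" using tip_ne_b[OF i, of "Suc i"] i by simp
  moreover have "?s \<in> top_hair i" by (simp add: top_hair_segment)
  ultimately show False using q by auto
qed

lemma free_even: assumes "j < m" shows "free (2 * j)"
  unfolding free_def
proof (intro conjI allI impI)
  show "2 * j < k" "2 * j \<noteq> k - 1" using assms by (auto simp: k_def)
  fix l assume l: "l < k" "eps (Suc l) \<noteq> 0"
  then have "even l" using eps_pos(1)[OF l(2)] by simp
  moreover have "Suc (2 * j) < k" using assms by (simp add: k_def)
  ultimately show "b l \<noteq> b (Suc (2 * j))" using b_inj[OF l(1)] by fastforce
qed

lemma free_last: "free (2 * m - 1)" "eps (Suc (2 * m - 1)) = 0"
proof -
  have Suc: "Suc (2 * m - 1) = 2 * m" using m by simp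
  show "eps (Suc (2 * m - 1)) = 0" unfolding Suc by (simp add: eps_def)
  show "free (2 * m - 1)" unfolding free_def Suc
  proof (intro conjI allI impI)
    show "2 * m - 1 < k" "2 * m - 1 \<noteq> k - 1" using m by (auto simp: k_def)
    fix l assume l: "l < k" "eps (Suc l) \<noteq> 0"
    show "b l \<noteq> b (2 * m)"
    proof
      assume "b l = b (2 * m)"
      then have "l = 2 * m" using b_inj[OF l(1)] by (simp add: k_def)
      then have "Suc l = k" by (simp add: k_def)
      then show False using l eps_0 by simp
    qed
  qed
qed

lemma eps_even: "eps (Suc (2 * j)) = (if bit c j then 1 / 8 else 0)"
  by (simp add: eps_def)

lemma common_neighbour:
  assumes "j < m" "\<not> bit c j"
  shows "ct_arc Q T (pt (b (Suc (2 * j))) H) (pt ctr H)" "ct_arc Q T (pt (b (2 * m)) H) (pt ctr H)"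
proof -
  show "ct_arc Q T (pt (b (Suc (2 * j))) H) (pt ctr H)"
    using assms by (intro arc_spoke free_even) (auto simp: eps_even)
  have "Suc (2 * m - 1) = 2 * m" using m by simp
  then show "ct_arc Q T (pt (b (2 * m)) H) (pt ctr H)" using arc_spoke[OF free_last] by simp
qed

text \<open>Both arcs are confined to their branches, so a common neighbour lies on both. But among
  the other branches a shifted one touches only the branch to corner \<open>2 * j\<close>, never the
  one to \<open>2 * m\<close>.\<close>

lemma no_common_neighbour:
  assumes "j < m" "bit c j"
  shows "\<not> (ct_arc Q T (pt (b (Suc (2 * j))) H) q \<and> ct_arc Q T (pt (b (2 * m)) H) q)"
proof
  have Suc: "Suc (2 * m - 1) = 2 * m" using m by simp
  have e: "eps (Suc (2 * j)) \<noteq> 0" using assms by (simp add: eps_even)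
  have lt: "2 * j < k" "2 * m - 1 < k" "2 * j \<noteq> 2 * m - 1" using assms m by (auto simp: k_def)
  assume "ct_arc Q T (pt (b (Suc (2 * j))) H) q \<and> ct_arc Q T (pt (b (2 * m)) H) q"
  then have "q \<in> top_hair (2 * j)" "q \<in> top_hair (2 * m - 1)"
    using arc_confined[OF free_even[OF assms(1)]] arc_confined[OF free_last(1)] Suc by auto
  then obtain p where "p \<in> hair (2 * j)" "p \<in> hair (2 * m - 1)" by (auto simp: top_hair_def)
  then have "b (2 * j) = b (Suc (2 * m - 1))"
    using hair_meet[OF lt] e free_last(2) by auto
  then have "2 * j = 2 * m" using b_inj[of "2 * j" "2 * m"] lt by (simp add: Suc k_def)
  then show False using assms by simp
qed

lemma vertex_nodes:
  assumes "j < m"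
  shows "pt (b (Suc (2 * j))) H \<in> ct_nodes Q T \<inter> poly_vertices Q" "pt (b (2 * m)) H \<in> ct_nodes Q T \<inter> poly_vertices Q"
  using node_vertex[of "2 * j"] node_vertex[of "2 * m - 1"] assms by (auto simp: k_def)

end

text \<open>The labels force an isomorphism to fix both test corners, so the existence of a common
  neighbour is an invariant.\<close>

lemma not_comb_isomorphic:
  assumes 1: "prism_tree m c H" and 2: "prism_tree m c' H" and j: "j < m" and bits: "bit c j \<noteq> bit c' j"
  shows "\<not> comb_isomorphic (prism.Q m H) (prism_tree.T m c H) (prism_tree.T m c' H)"
proof
  interpret a: prism_tree m c H by (rule 1)
  interpret b: prism_tree m c' H by (rule 2)
  assume "comb_isomorphic (prism.Q m H) (prism_tree.T m c H) (prism_tree.T m c' H)"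
  then obtain f where f: "bij_betw f (ct_nodes a.Q a.T) (ct_nodes a.Q b.T)"
    and arcs: "\<And>p q. p \<in> ct_nodes a.Q a.T \<Longrightarrow> q \<in> ct_nodes a.Q a.T \<Longrightarrow> ct_arc a.Q a.T p q \<longleftrightarrow> ct_arc a.Q b.T (f p) (f q)"
    and fix_v: "\<And>p. p \<in> ct_nodes a.Q a.T \<Longrightarrow> p \<in> poly_vertices a.Q \<Longrightarrow> f p = p"
    unfolding comb_isomorphic_def by blast
  let ?u = "pt (a.b (Suc (2 * j))) H" and ?v = "pt (a.b (2 * m)) H"
  have uv: "?u \<in> ct_nodes a.Q a.T" "?v \<in> ct_nodes a.Q a.T" "f ?u = ?u" "f ?v = ?v"
    using a.vertex_nodes[OF j] fix_v by auto
  show False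
  proof (cases "bit c j")
    case False
    then show ?thesis
      using a.common_neighbour[OF j False] b.no_common_neighbour[OF j, of "f (pt a.ctr H)"] bits
        arcs[OF uv(1) a.node_ctr] arcs[OF uv(2) a.node_ctr] uv by simp
  next
    case True
    then have b: "\<not> bit c' j" using bits by simp
    \<comment> \<open>Here the common neighbour lives in the second tree and has to be pulled back,
      by surjectivity of \<open>f\<close>.\<close>
    have "pt b.ctr H \<in> f ` ct_nodes a.Q a.T"
      using bij_betw_imp_surj_on[OF f] b.node_ctr by simp
    then obtain q where q: "f q = pt b.ctr H" "q \<in> ct_nodes a.Q a.T" by (metis imageE)
    show ?thesis
      using b.common_neighbour[OF j b] a.no_common_neighbour[OF j True, of q] arcs[OF uv(1) q(2)] arcs[OF uv(2) q(2)] uv q(1) by simp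
  qed
qed

section \<open>Diameters of the nets\<close>

lemma finite_positive_bound:
  fixes f :: "'a \<Rightarrow> real"
  assumes "finite S" "\<And>s. s \<in> S \<Longrightarrow> 0 < f s"
  shows "\<exists>\<delta>>0. \<forall>s\<in>S. \<delta> \<le> f s"
  using assms
proof (induction S rule: finite_induct)
  case (insert s S)
  then obtain \<delta> where "\<delta> > 0" "\<forall>s\<in>S. \<delta> \<le> f s" by auto
  then show ?case using insert.prems[of s] by (intro exI[of _ "min \<delta> (f s)"]) auto
qed (auto intro: exI[of _ 1])

context ngon_tree begin

lemma HP_less: "HP i < A + t"
proof (cases "eps i = 0")
  case True
  have "(1 - eps (Suc i)) * h i ctr \<le> 1 * (A + t)"
    using coords_ctr_bounds[of i] eps_cases[of "Suc i"] by (intro mult_mono) auto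
  then show ?thesis using True breaks(5)[of i] by (simp add: HP_def HS_def)
next
  case False
  then have e8: "eps i = 1 / 8" using eps_pos by simp
  have "HP i = 7 / 8 * h i ctr + sin (2 * \<theta>) / 4" by (simp add: HP_def e8)
  then show ?thesis using coords_ctr_bounds[of i] A_bounds t_bounds by linarith
qed

lemma HS_less: assumes "i < k - 1" shows "HS i < A + t"
proof -
  have "(1 - eps (Suc i)) * h i ctr \<le> 1 * h i ctr"
    using coords_ctr_bounds[of i] eps_cases[of "Suc i"] by (intro mult_right_mono) auto
  then show ?thesis using h_ctr_less[OF assms] by (simp add: HS_def)
qed

lemma last_break: "XS (k - 1) = 1" "HS (k - 1) = A + t"
proof -
  have "Suc (k - 1) = k" using k_ge by simp
  then show "XS (k - 1) = 1" "HS (k - 1) = A + t" using coords_ctr_last eps_0 by (simp_all add: XS_def HS_def)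
qed

text \<open>All breaks except the peak over the last side stay below it by a margin that does not
  involve the height of the prism, which can therefore be chosen afterwards.\<close>

lemma roof_gap: "\<exists>\<delta>>0. \<delta> \<le> A + t \<and> (\<forall>i<k. HP i \<le> A + t - \<delta>) \<and> (\<forall>i<k - 1. HS i \<le> A + t - \<delta>)"
proof -
  obtain \<delta> where 1: "\<delta> > 0" "\<forall>i\<in>{..<k}. \<delta> \<le> A + t - HP i"
    using finite_positive_bound[of "{..<k}" "\<lambda>i. A + t - HP i"] HP_less by auto
  obtain \<delta>' where 2: "\<delta>' > 0" "\<forall>i\<in>{..<k - 1}. \<delta>' \<le> A + t - HS i"
    using finite_positive_bound[of "{..<k - 1}" "\<lambda>i. A + t - HS i"] HS_less by auto
  define d where "d = min (A + t) (min \<delta> \<delta>')"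
  have "0 < d" "d \<le> A + t" "d \<le> \<delta>" "d \<le> \<delta>'" using 1(1) 2(1) A_bounds t_bounds by (auto simp: d_def)
  moreover have "HP i \<le> A + t - d" if "i < k" for i using 1(2) that \<open>d \<le> \<delta>\<close> by force
  moreover have "HS i \<le> A + t - d" if "i < k - 1" for i using 2(2) that \<open>d \<le> \<delta>'\<close> by force
  ultimately show ?thesis by blast
qed

end

context prism_tree begin

definition net :: "(real^2) set" where "net = R.P"

text \<open>A tent with its apex at the peak. No break is farther than \<open>2 * real k\<close>
  from the apex horizontally, so the tent has dropped by at most \<open>\<delta>\<close> there;
  between breaks, convexity of the absolute value suffices.\<close>

lemma roof_cone:
  assumes \<delta>: "0 < \<delta>" "\<delta> \<le> A + t" "\<forall>i<k. HP i \<le> A + t - \<delta>" "\<forall>i<k - 1. HS i \<le> A + t - \<delta>"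
    and x: "0 \<le> x'" "x' \<le> 2 * real k"
  shows "R.g x' \<le> H + A + t - \<delta> / (2 * real k) * \<bar>x' - (2 * real k - 1)\<bar>"
proof -
  define L where "L = 2 * real k"
  define c0 where "c0 = L - 1"
  define M where "M = H + A + t"
  define \<sigma> where "\<sigma> = \<delta> / L"
  have L: "0 < L" using k_ge by (simp add: L_def)
  have \<sigma>: "0 \<le> \<sigma>" "\<sigma> * L = \<delta>" using \<delta> L by (simp_all add: \<sigma>_def)
  have break: "RY r \<le> M - \<sigma> * \<bar>RX r - c0\<bar>" if r: "r \<le> 3 * k" for r
  proof (cases "r = 3 * (k - 1) + 2")
    case True
    have "RX r = c0" "RY r = M"
      using RX_simps(3)[of "k - 1"] RY_simps(3)[of "k - 1"] last_break True k_ge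
      by (simp_all add: c0_def L_def M_def of_nat_diff)
    then show ?thesis by simp
  next
    case False
    have "0 \<le> RX r" "RX r \<le> L"
      using R.X_le[of 0 r] R.X_le[of r "3 * k"] r RX_ends by (auto simp: L_def)
    moreover have "1 \<le> L" using k_ge by (simp add: L_def)
    ultimately have "\<bar>RX r - c0\<bar> \<le> L" by (simp add: c0_def)
    then have "\<sigma> * \<bar>RX r - c0\<bar> \<le> \<delta>" using \<sigma> by (metis mult_left_mono)
    moreover have "RY r \<le> M - \<delta>"
    proof (cases r rule: index_cases)
      case (1 i) then show ?thesis using RY_simps(1)[of i] \<delta>(2) by (simp add: M_def)
    next
      case (2 i)
      then have "i < k" using r by presburger
      then have "HP i \<le> A + t - \<delta>" using \<delta>(3) by blast
      then show ?thesis using RY_simps(2)[of i] 2 by (simp add: M_def)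
    next
      case (3 i)
      then have "i < k - 1" using r False by presburger
      then have "HS i \<le> A + t - \<delta>" using \<delta>(4) by blast
      then show ?thesis using RY_simps(3)[of i] 3 by (simp add: M_def)
    qed
    ultimately show ?thesis by linarith
  qed
  obtain r where r: "r < 3 * k" "RX r \<le> x'" "x' \<le> RX (Suc r)"
    using R.interval_cover[of x'] x RX_ends by auto
  have d: "RX r < RX (Suc r)" using R.X_less r(1) by simp
  define u where "u = (x' - RX r) / (RX (Suc r) - RX r)"
  have u: "0 \<le> u" "u \<le> 1" using r d by (auto simp: u_def field_simps)
  have "x' = RX r + u * (RX (Suc r) - RX r)" using d by (simp add: u_def)
  then have xc: "x' - c0 = (1 - u) * (RX r - c0) + u * (RX (Suc r) - c0)" by (simp add: algebra_simps)
  have "R.g x' = RY r + u * (RY (Suc r) - RY r)" unfolding u_def by (rule R.g_eq[OF r])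
  also have "\<dots> = (1 - u) * RY r + u * RY (Suc r)" by (simp add: algebra_simps)
  also have "\<dots> \<le> (1 - u) * (M - \<sigma> * \<bar>RX r - c0\<bar>) + u * (M - \<sigma> * \<bar>RX (Suc r) - c0\<bar>)"
    using u break[of r] break[of "Suc r"] r(1) by (intro add_mono mult_left_mono) auto
  also have "\<dots> = M - \<sigma> * ((1 - u) * \<bar>RX r - c0\<bar> + u * \<bar>RX (Suc r) - c0\<bar>)" by (simp add: algebra_simps)
  also have "\<dots> \<le> M - \<sigma> * \<bar>x' - c0\<bar>"
  proof -
    have "\<bar>x' - c0\<bar> \<le> \<bar>(1 - u) * (RX r - c0)\<bar> + \<bar>u * (RX (Suc r) - c0)\<bar>" unfolding xc by (rule abs_triangle_ineq)
    also have "\<dots> = (1 - u) * \<bar>RX r - c0\<bar> + u * \<bar>RX (Suc r) - c0\<bar>" using u by (simp add: abs_mult)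
    finally show ?thesis using \<sigma>(1) by (simp add: mult_left_mono)
  qed
  finally show ?thesis by (simp add: M_def \<sigma>_def c0_def L_def)
qed

text \<open>The prism is so tall that the longest segment in the net is the vertical one joining the
  two copies of \<open>ctr\<close> over the last edge.\<close>

lemma net_diameter:
  assumes \<delta>: "0 < \<delta>" "\<delta> \<le> A + t" "\<forall>i<k. HP i \<le> A + t - \<delta>" "\<forall>i<k - 1. HS i \<le> A + t - \<delta>"
    and tall: "2 * real k * (1 + (\<delta> / (2 * real k))\<^sup>2) / (\<delta> / (2 * real k)) \<le> H"
  shows "\<And>v w. v \<in> net \<Longrightarrow> w \<in> net \<Longrightarrow> dist v w \<le> 2 * (H + A + t)"
    and "\<exists>v\<in>net. \<exists>w\<in>net. dist v w = 2 * (H + A + t)"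
proof -
  define L where "L = 2 * real k"
  define c0 where "c0 = L - 1"
  define M where "M = H + A + t"
  define \<sigma> where "\<sigma> = \<delta> / L"
  have L: "1 \<le> L" using k_ge by (simp add: L_def)
  have \<sigma>: "0 < \<sigma>" using \<delta> L by (simp add: \<sigma>_def)
  have M: "H \<le> M" using A_bounds t_bounds by (simp add: M_def)
  have g: "R.g x' \<le> M - \<sigma> * \<bar>x' - c0\<bar>" if "0 \<le> x'" "x' \<le> L" for x'
    using roof_cone[OF \<delta>, of x'] that by (simp add: M_def \<sigma>_def c0_def L_def)
  have tall': "L * (1 + \<sigma>\<^sup>2) \<le> M * \<sigma>"
  proof -
    have "L * (1 + \<sigma>\<^sup>2) / \<sigma> \<le> H" using tall by (simp add: L_def \<sigma>_def)
    then have "L * (1 + \<sigma>\<^sup>2) \<le> H * \<sigma>" using \<sigma> by (simp add: pos_divide_le_eq)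
    also have "\<dots> \<le> M * \<sigma>" using M \<sigma> by (intro mult_right_mono) auto
    finally show ?thesis .
  qed
  show "dist v w \<le> 2 * (H + A + t)" if vw: "v \<in> net" "w \<in> net" for v w
  proof -
    have v: "0 \<le> v$1" "v$1 \<le> L" "\<bar>v$2\<bar> \<le> R.g (v$1)" and w: "0 \<le> w$1" "w$1 \<le> L" "\<bar>w$2\<bar> \<le> R.g (w$1)"
      using vw by (auto simp: net_def R.P_def RX_ends L_def)
    \<comment> \<open>The horizontal distance of \<open>v\<close> and \<open>w\<close> is at most
      \<open>u\<close>, while the tents reduce their vertical distance to at most
      \<open>2 * M - \<sigma> * u\<close>.\<close>
    define u where "u = \<bar>v$1 - c0\<bar> + \<bar>w$1 - c0\<bar>"
    have u: "0 \<le> u" "u \<le> 2 * L" using v w L by (auto simp: u_def c0_def)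
    have "\<bar>v$1 - w$1\<bar> \<le> u" by (simp add: u_def)
    then have 1: "(v$1 - w$1)\<^sup>2 \<le> u\<^sup>2" using power_mono[of "\<bar>v$1 - w$1\<bar>" u 2] by simp
    have "\<bar>v$2 - w$2\<bar> \<le> R.g (v$1) + R.g (w$1)" using v w by linarith
    also have "\<dots> \<le> 2 * M - \<sigma> * u" using g[OF v(1,2)] g[OF w(1,2)] by (simp add: u_def algebra_simps)
    finally have 2: "(v$2 - w$2)\<^sup>2 \<le> (2 * M - \<sigma> * u)\<^sup>2" using power_mono[of "\<bar>v$2 - w$2\<bar>" _ 2] by simp
    \<comment> \<open>For \<open>u > 0\<close> the target \<open>u\<^sup>2 + (2 * M - \<sigma> *
      u)\<^sup>2 \<le> (2 * M)\<^sup>2\<close> amounts to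
      \<open>u * (1 + \<sigma>\<^sup>2) \<le> 4 * M * \<sigma>\<close>. The lower bound on
      \<open>H\<close> is chosen to give this for all \<open>u \<le> 2 * L\<close>.\<close>
    have "u * (1 + \<sigma>\<^sup>2) \<le> 2 * L * (1 + \<sigma>\<^sup>2)" using u by (intro mult_right_mono) auto
    also have "\<dots> = 2 * (L * (1 + \<sigma>\<^sup>2))" by simp
    also have "\<dots> \<le> 4 * (M * \<sigma>)"
    proof -
      have "0 \<le> M * \<sigma>" using M H \<sigma> by simp
      then show ?thesis using tall' by linarith
    qed
    finally have "u * (u * (1 + \<sigma>\<^sup>2)) \<le> u * (4 * (M * \<sigma>))" using u by (intro mult_left_mono) auto
    then have "u\<^sup>2 + (2 * M - \<sigma> * u)\<^sup>2 \<le> (2 * M)\<^sup>2" by (simp add: power2_eq_square algebra_simps)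
    then have "(v$1 - w$1)\<^sup>2 + (v$2 - w$2)\<^sup>2 \<le> (2 * M)\<^sup>2" using 1 2 by linarith
    then have "dist v w \<le> sqrt ((2 * M)\<^sup>2)" unfolding dist_vec2 by (rule real_sqrt_le_mono)
    then show ?thesis using M H by (simp add: M_def)
  qed
  have "R.g c0 = M"
    using R.g_break[of "3 * (k - 1) + 2"] RX_simps(3)[of "k - 1"] RY_simps(3)[of "k - 1"] last_break k_ge
    by (simp add: c0_def L_def M_def of_nat_diff)
  moreover have "0 \<le> c0" "c0 \<le> L" using L by (auto simp: c0_def)
  ultimately have "vec2 c0 M \<in> net" "vec2 c0 (- M) \<in> net"
    using M H by (simp_all add: net_def R.P_def RX_ends L_def)
  moreover have "dist (vec2 c0 M) (vec2 c0 (- M)) = sqrt ((2 * M)\<^sup>2)"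
    unfolding dist_vec2 by simp
  then have "dist (vec2 c0 M) (vec2 c0 (- M)) = 2 * M"
    unfolding real_sqrt_abs using M H by simp
  ultimately show "\<exists>v\<in>net. \<exists>w\<in>net. dist v w = 2 * (H + A + t)" unfolding M_def by blast
qed

end

text \<open>Stated as a threshold for each \<open>c\<close>, because one prism has to serve all
  \<open>c\<close> simultaneously.\<close>

lemma exists_tall:
  assumes "ngon_tree m c"
  shows "\<exists>H0. \<forall>H\<ge>H0. 0 < H \<longrightarrow> (\<forall>v\<in>prism_tree.net m c H. \<forall>w\<in>prism_tree.net m c H. dist v w \<le> 2 * (H + ngon.A m + ngon_tree.t m c)) \<and>
     (\<exists>v\<in>prism_tree.net m c H. \<exists>w\<in>prism_tree.net m c H. dist v w = 2 * (H + ngon.A m + ngon_tree.t m c))"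
proof -
  interpret ngon_tree m c by (rule assms)
  obtain \<delta> where \<delta>: "0 < \<delta>" "\<delta> \<le> A + t" "\<forall>i<k. HP i \<le> A + t - \<delta>" "\<forall>i<k - 1. HS i \<le> A + t - \<delta>"
    using roof_gap by blast
  show ?thesis
  proof (intro exI allI impI)
    fix H assume tall: "2 * real k * (1 + (\<delta> / (2 * real k))\<^sup>2) / (\<delta> / (2 * real k)) \<le> H" "0 < H"
    interpret prism_tree m c H by unfold_locales (rule tall(2))
    show "(\<forall>v\<in>net. \<forall>w\<in>net. dist v w \<le> 2 * (H + A + t)) \<and> (\<exists>v\<in>net. \<exists>w\<in>net. dist v w = 2 * (H + A + t))"
      using net_diameter[OF \<delta> tall(1)] by blast
  qed
qed

section \<open>Invariants and the final count\<close>

lemma low_bits_differ: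
  fixes c c' :: nat
  assumes "c < 2 ^ m" "c' < 2 ^ m" "c \<noteq> c'"
  shows "\<exists>j<m. bit c j \<noteq> bit c' j"
proof (rule ccontr)
  assume no: "\<not> (\<exists>j<m. bit c j \<noteq> bit c' j)"
  have high: "\<not> bit d j" if "d < 2 ^ m" "m \<le> j" for d j :: nat
  proof -
    have "d < 2 ^ j" using that by (meson less_le_trans one_le_numeral power_increasing)
    then show ?thesis by (simp add: bit_iff_odd)
  qed
  have "bit c j = bit c' j" for j using no high[OF assms(1)] high[OF assms(2)] by (cases "j < m") auto
  then have "c = c'" by (simp add: bit_eq_iff)
  then show False using assms by simp
qed

lemma comb_isomorphic_refl: "comb_isomorphic Q T T"
  unfolding comb_isomorphic_def by (intro exI[of _ id]) auto

text \<open>Together with its converse below: a distance-preserving map carries an extremal pair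
  along, so congruent sets have the same attained diameter.\<close>

lemma congruent_diameter_le:
  assumes "congruent P P'" and "\<exists>v\<in>P. \<exists>w\<in>P. dist v w = d" and "\<forall>v\<in>P'. \<forall>w\<in>P'. dist v w \<le> d'"
  shows "d \<le> d'"
  using assms unfolding congruent_def by (metis imageI)

lemma congruent_diameter_ge:
  assumes "congruent P P'" and "\<exists>v\<in>P'. \<exists>w\<in>P'. dist v w = d'" and "\<forall>v\<in>P. \<forall>w\<in>P. dist v w \<le> d"
  shows "d' \<le> d"
proof -
  obtain f :: "real^2 \<Rightarrow> real^2" where f: "\<And>x y. dist (f x) (f y) = dist x y" "f ` P = P'"
    using assms(1) unfolding congruent_def by blast
  then obtain v w where "v \<in> P" "w \<in> P" "dist (f v) (f w) = d'" using assms(2) by blast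
  then show ?thesis using assms(3) f(1) by metis
qed

theorem theorem11:
  shows "\<exists>c>0. \<forall>N::nat. \<exists>n\<ge>N. \<exists>Q :: (real^3) set.
     convex_polytope3 Q \<and> card (poly_vertices Q) = n \<and>
     (\<exists>\<T> \<P>.
        finite \<T> \<and> (\<forall>T\<in>\<T>. geometric_cut_tree Q T) \<and>
        (\<forall>T1\<in>\<T>. \<forall>T2\<in>\<T>. T1 \<noteq> T2 \<longrightarrow> \<not> comb_isomorphic Q T1 T2) \<and>
        real (card \<T>) \<ge> 2 powr (c * real n) \<and>
        finite \<P> \<and> (\<forall>P\<in>\<P>. \<exists>T\<in>\<T>. unfolds_to Q T P) \<and>
        (\<forall>P1\<in>\<P>. \<forall>P2\<in>\<P>. P1 \<noteq> P2 \<longrightarrow> \<not> congruent P1 P2) \<and>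
        real (card \<P>) \<ge> 2 powr (c * real n))"
proof (intro exI[of _ "1 / 6 :: real"] conjI allI)
  show "(0::real) < 1 / 6" by simp
  fix N :: nat
  \<comment> \<open>The bound 3 guarantees seven sides, the bound \<open>N\<close> enough
    vertices.\<close>
  define m where "m = max N 3"
  have m: "3 \<le> m" by (simp add: m_def)
  interpret ngon m by unfold_locales (rule m)
  let ?I = "{..<2 ^ m :: nat}"
  have tree: "ngon_tree m c" if "c \<in> ?I" for c
    using that by unfold_locales auto
  define good where "good c H \<longleftrightarrow> (\<forall>v\<in>prism_tree.net m c H. \<forall>w\<in>prism_tree.net m c H. dist v w \<le> 2 * (H + A + ngon_tree.t m c)) \<and>
     (\<exists>v\<in>prism_tree.net m c H. \<exists>w\<in>prism_tree.net m c H. dist v w = 2 * (H + A + ngon_tree.t m c))" for c H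
  have "\<forall>c\<in>?I. \<exists>H0. \<forall>H\<ge>H0. 0 < H \<longrightarrow> good c H"
    using exists_tall[OF tree] unfolding good_def by blast
  then obtain H0 where H0: "\<And>c H. c \<in> ?I \<Longrightarrow> H0 c \<le> H \<Longrightarrow> 0 < H \<Longrightarrow> good c H" by metis
  \<comment> \<open>One height for all \<open>c\<close>, since all trees must lie on the same
    polytope; the inserted 1 makes it positive.\<close>
  define H where "H = Max (insert 1 (H0 ` ?I))"
  have "1 \<le> H" "\<And>c. c \<in> ?I \<Longrightarrow> H0 c \<le> H" unfolding H_def by (auto intro!: Max_ge)
  then have H: "0 < H" and good: "\<And>c. c \<in> ?I \<Longrightarrow> good c H" using H0 by auto
  interpret prism m H by unfold_locales (rule H)
  have pt: "prism_tree m c H" if "c \<in> ?I" for c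
    using tree[OF that] prism_axioms by (simp add: prism_tree_def)
  let ?T = "\<lambda>c. prism_tree.T m c H" and ?P = "\<lambda>c. prism_tree.net m c H"
  have iso: "\<not> comb_isomorphic Q (?T c) (?T c')" if "c \<in> ?I" "c' \<in> ?I" "c \<noteq> c'" for c c'
  proof -
    obtain j where "j < m" "bit c j \<noteq> bit c' j" using low_bits_differ[of c m c'] \<open>c \<in> ?I\<close> \<open>c' \<in> ?I\<close> \<open>c \<noteq> c'\<close> by auto
    then show ?thesis using not_comb_isomorphic[OF pt pt] that by blast
  qed
  have t_inj: "c = c'" if "c \<in> ?I" "c' \<in> ?I" "ngon_tree.t m c = ngon_tree.t m c'" for c c'
    using that ngon_tree.t_def[OF tree[OF that(1)]] ngon_tree.t_def[OF tree[OF that(2)]] by simp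
  have cong: "\<not> congruent (?P c) (?P c')" if "c \<in> ?I" "c' \<in> ?I" "c \<noteq> c'" for c c'
  proof
    assume "congruent (?P c) (?P c')"
    then have "2 * (H + A + ngon_tree.t m c) \<le> 2 * (H + A + ngon_tree.t m c')"
      "2 * (H + A + ngon_tree.t m c') \<le> 2 * (H + A + ngon_tree.t m c)"
      using congruent_diameter_le congruent_diameter_ge good[OF that(1)] good[OF that(2)] unfolding good_def by blast+
    then show False using t_inj that by auto
  qed
  have congruent_refl: "congruent P P" for P unfolding congruent_def by (intro exI[of _ id]) auto
  \<comment> \<open>Equal trees would be isomorphic through the identity, so distinct indices give
    distinct trees and the family has full size.\<close>
  have injT: "inj_on ?T ?I"
  proof (rule inj_onI, rule ccontr)
    fix c c' assume c: "c \<in> ?I" "c' \<in> ?I" "?T c = ?T c'" "c \<noteq> c'"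
    then show False using iso[OF c(1,2,4)] comb_isomorphic_refl[of Q "?T c'"] by simp
  qed
  have injP: "inj_on ?P ?I"
  proof (rule inj_onI, rule ccontr)
    fix c c' assume c: "c \<in> ?I" "c' \<in> ?I" "?P c = ?P c'" "c \<noteq> c'"
    then show False using cong[OF c(1,2,4)] congruent_refl[of "?P c'"] by simp
  qed
  have count: "2 powr (1 / 6 * real (2 * k)) \<le> 2 ^ m"
  proof -
    \<comment> \<open>The polytope has \<open>2 * k = 4 * m + 2\<close> vertices, and a sixth of
      this is at most \<open>m\<close>; hence the constant 1/6.\<close>
    have "1 / 6 * real (2 * k) \<le> real m" using m by (simp add: k_def)
    then have "2 powr (1 / 6 * real (2 * k)) \<le> 2 powr real m" by (intro powr_mono) auto
    then show ?thesis by (simp add: powr_realpow)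
  qed
  have card: "card (?T ` ?I) = 2 ^ m" "card (?P ` ?I) = 2 ^ m" using injT injP by (simp_all add: card_image)
  show "\<exists>n\<ge>N. \<exists>Q :: (real^3) set.
     convex_polytope3 Q \<and> card (poly_vertices Q) = n \<and>
     (\<exists>\<T> \<P>.
        finite \<T> \<and> (\<forall>T\<in>\<T>. geometric_cut_tree Q T) \<and>
        (\<forall>T1\<in>\<T>. \<forall>T2\<in>\<T>. T1 \<noteq> T2 \<longrightarrow> \<not> comb_isomorphic Q T1 T2) \<and>
        real (card \<T>) \<ge> 2 powr (1 / 6 * real n) \<and>
        finite \<P> \<and> (\<forall>P\<in>\<P>. \<exists>T\<in>\<T>. unfolds_to Q T P) \<and>
        (\<forall>P1\<in>\<P>. \<forall>P2\<in>\<P>. P1 \<noteq> P2 \<longrightarrow> \<not> congruent P1 P2) \<and>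
        real (card \<P>) \<ge> 2 powr (1 / 6 * real n))"
  proof (intro exI[of _ "2 * k"] exI[of _ Q] exI[of _ "?T ` ?I"] exI[of _ "?P ` ?I"] conjI)
    have "N \<le> m" by (simp add: m_def)
    then show "N \<le> 2 * k" by (simp add: k_def)
    show "convex_polytope3 Q" by (rule convex_polytope3_Q)
    show "card (poly_vertices Q) = 2 * k" by (simp add: poly_vertices_Q card_V)
    show "\<forall>T\<in>?T ` ?I. geometric_cut_tree Q T" using prism_tree.geometric_cut_tree_T[OF pt] by blast
    show "\<forall>T1\<in>?T ` ?I. \<forall>T2\<in>?T ` ?I. T1 \<noteq> T2 \<longrightarrow> \<not> comb_isomorphic Q T1 T2"
      using iso by blast
    show "\<forall>P1\<in>?P ` ?I. \<forall>P2\<in>?P ` ?I. P1 \<noteq> P2 \<longrightarrow> \<not> congruent P1 P2" using cong by blast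
    show "\<forall>P\<in>?P ` ?I. \<exists>T\<in>?T ` ?I. unfolds_to Q T P"
      using prism_tree.unfolds[OF pt] prism_tree.net_def[OF pt] by auto
  qed (use count card in simp_all)
qed

end
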